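(* Let $\Gamma$ be a finitely generated group having the rapid decay property (RD) with exponent $C_1$, and let $(\rho_N)$ be a sequence of permutation representations $\rho_N:\Gamma\to S_N$ which converges in distribution toward $\lambda$. Let $p\in\mathbb C[\Gamma]$ with $p=p^*$ and let $I_0\subset\mathbb R$ be a compact interval such that conditions (AC) and (R4) hold for $P=\lambda(p)$ on $I_0$. Let $I$ be a closed interval (of positive length) contained in the interior of $I_0$ and, for each $N$, let $(\varphi_\alpha)_{\alpha\in[N]}$ be an orthonormal eigenbasis of $P_N=\rho_N(p)$. Then, for any finite $T\subset\Gamma$, there exists a sequence of subspaces $H_N\subset\mathbb C^N$ with $\dim(H_N)=o(N)$ such that for any sequence of $T$-local matrices $K_N\in M_N(\mathbb C)$ satisfying $\|K_N\|_{1,\infty}\le1$ and $(K_N(t.x,x))_{x\in[N]}\in H_N^\perp$ for all $t\in T$, quantum ergodicity (QE) and quantum mixing (QM) hold in $I$.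
   Context: Algebra. $e$ is the unit of $\Gamma$; $|g|$ is the word length of $g\in\Gamma$ for a fixed finite generating set. $\mathbb C[\Gamma]$ is the group algebra of finite sums $p=\sum_g p_g g$, with $p^*=\sum_g\bar p_g g^{-1}$ and $\|p\|_2^2=\sum_g|p_g|^2$. $\lambda$ is the left regular representation on $\ell^2(\Gamma)$, $\lambda(g)\delta_v=\delta_{gv}$. A permutation representation is a homomorphism $\rho_N:\Gamma\to S_N$; $g.x=\rho_N(g)(x)$ for $x\in[N]=\{1,\dots,N\}$, and $\rho_N(g)$ is identified with the matrix $\rho_N(g)(x,y)=\mathbf 1(x=g.y)$. For a representation $\rho$, $\rho(p)=\sum_g p_g\rho(g)$. Sequences $(\rho_N)$ are indexed by an infinite set of integers $N\to\infty$. $(\rho_N)$ converges in distribution toward $\lambda$ if $\frac1N\mathrm{Tr}(\rho_N(g))\to0$ for all $g\in\Gamma\setminus\{e\}$. Scalar products are $\langle f,h\rangle=\sum_x\overline{f(x)}h(x)$. (RD): for some finite generating set $S$ of $\Gamma$ there are $C,C_1>0$ with $\|\lambda(q)\|_{\rm op}\le C(\mathrm{diam}_S(q))^{C_1}\|q\|_2$ for all $q\in\mathbb C[\Gamma]$, where $\mathrm{diam}_S(q)$ is the maximum of $1$ and the diameter of the support of $q$ in the Cayley graph $\mathrm{Cay}(\Gamma,S)$ (vertices $\Gamma$, edges from $g$ to $sg$, $s\in S$). With $R^z=(P-z\,\mathrm{Id})^{-1}$, $\Im R^z=(R^z-(R^z)^* )/(2i)$ and $Q(g,h)=\langle\delta_g,Q\delta_h\rangle$: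 (AC) on $I_0$: there is $C_0\ge1$ with $C_0^{-1}\le(\Im R^z)(e,e)\le C_0$ for all $z=E+i\eta$, $E\in I_0$, $0<\eta\le1$. (R4) on $I_0$: for some $C_1'>2C_1+1$, $\displaystyle\lim_{\eta\to0}\sup_{\lambda_0\in I_0}\sum_{g\in\Gamma}\eta^2|(\Im R^{\lambda_0+i\eta})(e,g)|^4|g|^{C_1'}=0$. Observables. $\|K\|_{1,\infty}=\max_{x,y}|K(x,y)|$. For finite $T\subset\Gamma$, $K_N\in M_N(\mathbb C)$ is $T$-local if $K_N(x,y)=0$ unless $x=g.y$ for some $g\in T$. Its average is $\langle K_N\rangle=\rho_N(k_N)$, $k_N=\sum_{g\in T}k_{N,g}\,g$, $k_{N,g}=\frac1N\sum_{x=1}^N K_N(g.x,x)$. $H_N^\perp$ is the orthogonal complement in $\mathbb C^N$. Let $\lambda_\alpha$ be the eigenvalue of $\varphi_\alpha$, $\Lambda_J=\{\alpha:\lambda_\alpha\in J\}$ and $J_E^\eta=[E-\eta,E+\eta]$; averages over an empty index set are $0$. (QE) in $I$: $\displaystyle\lim_{N\to\infty}\frac1{|\Lambda_I|}\sum_{\alpha\in\Lambda_I}|\langle\varphi_\alpha,K_N\varphi_\alpha\rangle-\langle\varphi_\alpha,\langle K_N\rangle\varphi_\alpha\rangle|^2=0$. (QM) in $I$: $\displaystyle\lim_{\eta\to0}\limsup_{N\to\infty}\sup_{E_1,E_2}\frac1{|\Lambda_{J_{E_1}^\eta}|}\sum_{\alpha\in\Lambda_{J_{E_1}^\eta}}\sum_{\beta\in\Lambda_{J_{E_2}^\eta}}|\langle\varphi_\beta,K_N\varphi_\alpha\rangle-\langle\varphi_\beta,\langle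 K_N\rangle\varphi_\alpha\rangle|^2=0$, the supremum being over $E_1,E_2$ in the interior of $I$. *)

theory Defs
  imports
    "HOL-Analysis.Analysis"
    "HOL-Algebra.Sym_Groups"
    "HOL-Algebra.Generated_Groups"
    "HOL-Library.Function_Algebras"
    "HOL-Library.Landau_Symbols"
begin

section \<open>Complex $\ell^2$ spaces over a set\<close>

text \<open>
  Vectors indexed by a set \<open>X\<close> are functions on the whole type that vanish outside \<open>X\<close>.
  For \<open>X = {1..N}\<close> the space \<open>ell2 X\<close> is $\mathbb C^N$; for \<open>X = carrier G\<close> it is
  $\ell^2(\Gamma)$.
\<close>

definition ell2 :: "'a set \<Rightarrow> ('a \<Rightarrow> complex) set" where
  "ell2 X = {f. (\<lambda>x. (cmod (f x))\<^sup>2) summable_on X \<and> (\<forall>x. x \<notin> X \<longrightarrow> f x = 0)}"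

definition ell2_inner :: "'a set \<Rightarrow> ('a \<Rightarrow> complex) \<Rightarrow> ('a \<Rightarrow> complex) \<Rightarrow> complex" where
  "ell2_inner X f h = (\<Sum>\<^sub>\<infinity>x\<in>X. cnj (f x) * h x)"

definition ell2_norm :: "'a set \<Rightarrow> ('a \<Rightarrow> complex) \<Rightarrow> real" where
  "ell2_norm X f = sqrt (\<Sum>\<^sub>\<infinity>x\<in>X. (cmod (f x))\<^sup>2)"

definition delta :: "'a \<Rightarrow> 'a \<Rightarrow> complex" where
  "delta g = (\<lambda>x. if x = g then 1 else 0)"

lemma ell2_finite:
  assumes "finite X"
  shows "ell2 X = {f. \<forall>x. x \<notin> X \<longrightarrow> f x = 0}"
    and "ell2_inner X f h = (\<Sum>x\<in>X. cnj (f x) * h x)"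
  using assms by (auto simp: ell2_def ell2_inner_def)

type_synonym 'a operator = "('a \<Rightarrow> complex) \<Rightarrow> ('a \<Rightarrow> complex)"

text \<open>The supremum is taken in \<^typ>\<open>ennreal\<close>, so that it is meaningful for every operator.\<close>

definition op_norm :: "'a set \<Rightarrow> 'a operator \<Rightarrow> ennreal" where
  "op_norm X A = (SUP f\<in>{f \<in> ell2 X. ell2_norm X f \<le> 1}. ennreal (ell2_norm X (A f)))"

definition op_adjoint :: "'a set \<Rightarrow> 'a operator \<Rightarrow> 'a operator" where
  "op_adjoint X A f =
     (THE h. h \<in> ell2 X \<and> (\<forall>k\<in>ell2 X. ell2_inner X h k = ell2_inner X f (A k)))"

definition op_Im :: "'a set \<Rightarrow> 'a operator \<Rightarrow> 'a operator" where
  "op_Im X A f = (\<lambda>x. (A f x - op_adjoint X A f x) / (2 * \<i>))"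

definition op_coeff :: "'a set \<Rightarrow> 'a operator \<Rightarrow> 'a \<Rightarrow> 'a \<Rightarrow> complex" where
  "op_coeff X A g h = ell2_inner X (delta g) (A (delta h))"

text \<open>
  $(A - z\,\mathrm{Id})^{-1}$ on \<open>ell2 X\<close>.  It is only used for \<open>z\<close> in the resolvent set of \<open>A\<close>,
  where $A - z\,\mathrm{Id}$ is a bijection of \<open>ell2 X\<close>.
\<close>

definition resolvent :: "'a set \<Rightarrow> 'a operator \<Rightarrow> complex \<Rightarrow> 'a operator" where
  "resolvent X A z = inv_into (ell2 X) (\<lambda>f x. A f x - z * f x)"


section \<open>Group algebra, regular representation, rapid decay\<close>

definition supp :: "('a \<Rightarrow> complex) \<Rightarrow> 'a set" where
  "supp p = {g. p g \<noteq> 0}"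

definition group_algebra :: "('a, 'b) monoid_scheme \<Rightarrow> ('a \<Rightarrow> complex) set" where
  "group_algebra G = {p. finite (supp p) \<and> supp p \<subseteq> carrier G}"

definition ga_star :: "('a, 'b) monoid_scheme \<Rightarrow> ('a \<Rightarrow> complex) \<Rightarrow> ('a \<Rightarrow> complex)" where
  "ga_star G p = (\<lambda>g. if g \<in> carrier G then cnj (p (m_inv G g)) else 0)"

definition left_translation :: "('a, 'b) monoid_scheme \<Rightarrow> 'a \<Rightarrow> 'a operator" where
  "left_translation G g f =
     (\<lambda>x. if x \<in> carrier G then f (m_inv G g \<otimes>\<^bsub>G\<^esub> x) else 0)"

lemma left_translation_delta:
  assumes "group G" "g \<in> carrier G" "v \<in> carrier G"
  shows "left_translation G g (delta v) = delta (g \<otimes>\<^bsub>G\<^esub> v)"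
proof -
  interpret group G by fact
  have "(m_inv G g \<otimes>\<^bsub>G\<^esub> x = v) = (x = g \<otimes>\<^bsub>G\<^esub> v)" if "x \<in> carrier G" for x
    using that assms inv_solve_left' by blast
  then show ?thesis
    using assms by (auto simp: left_translation_def delta_def fun_eq_iff)
qed

definition left_regular :: "('a, 'b) monoid_scheme \<Rightarrow> ('a \<Rightarrow> complex) \<Rightarrow> 'a operator" where
  "left_regular G p f = (\<lambda>x. \<Sum>g\<in>supp p. p g * left_translation G g f x)"

definition finite_generating_set :: "('a, 'b) monoid_scheme \<Rightarrow> 'a set \<Rightarrow> bool" where
  "finite_generating_set G S \<longleftrightarrow> finite S \<and> S \<subseteq> carrier G \<and> generate G S = carrier G"

definition word_length :: "('a, 'b) monoid_scheme \<Rightarrow> 'a set \<Rightarrow> 'a \<Rightarrow> nat" where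
  "word_length G S g = (LEAST n. \<exists>ws. length ws = n \<and> set ws \<subseteq> S \<union> m_inv G ` S \<and>
                          foldr (mult G) ws \<one>\<^bsub>G\<^esub> = g)"

definition cayley_edges :: "('a, 'b) monoid_scheme \<Rightarrow> 'a set \<Rightarrow> ('a \<times> 'a) set" where
  "cayley_edges G S = {(g, s \<otimes>\<^bsub>G\<^esub> g) | g s. g \<in> carrier G \<and> s \<in> S}"

text \<open>Distances in the Cayley graph ignore the orientation of the edges.\<close>

definition cayley_dist :: "('a, 'b) monoid_scheme \<Rightarrow> 'a set \<Rightarrow> 'a \<Rightarrow> 'a \<Rightarrow> nat" where
  "cayley_dist G S g h =
     (LEAST n. (g, h) \<in> (cayley_edges G S \<union> (cayley_edges G S)\<inverse>) ^^ n)"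

definition ga_diam :: "('a, 'b) monoid_scheme \<Rightarrow> 'a set \<Rightarrow> ('a \<Rightarrow> complex) \<Rightarrow> nat" where
  "ga_diam G S q = Max (insert 1 {cayley_dist G S g h | g h. g \<in> supp q \<and> h \<in> supp q})"

definition rapid_decay :: "('a, 'b) monoid_scheme \<Rightarrow> real \<Rightarrow> bool" where
  "rapid_decay G C\<^sub>1 \<longleftrightarrow>
     (\<exists>S C. finite_generating_set G S \<and> C > 0 \<and> C\<^sub>1 > 0 \<and>
        (\<forall>q\<in>group_algebra G.
           op_norm (carrier G) (left_regular G q)
             \<le> ennreal (C * real (ga_diam G S q) powr C\<^sub>1 * ell2_norm (carrier G) q)))"


section \<open>The spectral conditions\<close>

definition ImR :: "('a, 'b) monoid_scheme \<Rightarrow> ('a \<Rightarrow> complex) \<Rightarrow> complex \<Rightarrow> 'a \<Rightarrow> 'a \<Rightarrow> complex" where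
  "ImR G p z =
     op_coeff (carrier G) (op_Im (carrier G) (resolvent (carrier G) (left_regular G p) z))"

text \<open>A diagonal coefficient of an imaginary part is a real number, whence the \<^const>\<open>Re\<close>.\<close>

definition cond_AC :: "('a, 'b) monoid_scheme \<Rightarrow> ('a \<Rightarrow> complex) \<Rightarrow> real set \<Rightarrow> bool" where
  "cond_AC G p I\<^sub>0 \<longleftrightarrow>
     (\<exists>C\<^sub>0\<ge>1. \<forall>E\<in>I\<^sub>0. \<forall>\<eta>. 0 < \<eta> \<and> \<eta> \<le> 1 \<longrightarrow>
        1 / C\<^sub>0 \<le> Re (ImR G p (Complex E \<eta>) \<one>\<^bsub>G\<^esub> \<one>\<^bsub>G\<^esub>) \<and>
        Re (ImR G p (Complex E \<eta>) \<one>\<^bsub>G\<^esub> \<one>\<^bsub>G\<^esub>) \<le> C\<^sub>0)"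

text \<open>
  The series has nonnegative terms but is not assumed to converge; it is therefore summed in
  \<^typ>\<open>ennreal\<close>.  Word lengths refer to the generating set \<open>S\<close>, which need not be the one
  occurring in \<^const>\<open>rapid_decay\<close>.
\<close>

definition cond_R4 ::
  "('a, 'b) monoid_scheme \<Rightarrow> 'a set \<Rightarrow> real \<Rightarrow> ('a \<Rightarrow> complex) \<Rightarrow> real set \<Rightarrow> bool" where
  "cond_R4 G S C\<^sub>1 p I\<^sub>0 \<longleftrightarrow>
     (\<exists>C\<^sub>1' > 2 * C\<^sub>1 + 1.
        ((\<lambda>\<eta>. SUP E\<in>I\<^sub>0. \<Sum>\<^sub>\<infinity>g\<in>carrier G.
             ennreal (\<eta>\<^sup>2 * (cmod (ImR G p (Complex E \<eta>) \<one>\<^bsub>G\<^esub> g)) ^ 4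
                          * real (word_length G S g) powr C\<^sub>1'))
          \<longlongrightarrow> 0) (at_right 0))"


section \<open>Permutation representations and matrices\<close>

text \<open>
  Matrices in $M_N(\mathbb C)$ are functions \<^typ>\<open>nat \<Rightarrow> nat \<Rightarrow> complex\<close>, of which only the entries
  with both indices in \<open>{1..N}\<close> are relevant.
\<close>

type_synonym cmatrix = "nat \<Rightarrow> nat \<Rightarrow> complex"

definition perm_matrix :: "(nat \<Rightarrow> nat) \<Rightarrow> cmatrix" where
  "perm_matrix \<sigma> x y = (if x = \<sigma> y then 1 else 0)"

definition rep_matrix :: "('a \<Rightarrow> nat \<Rightarrow> nat) \<Rightarrow> ('a \<Rightarrow> complex) \<Rightarrow> cmatrix" where
  "rep_matrix \<rho> p x y = (\<Sum>g\<in>supp p. p g * perm_matrix (\<rho> g) x y)"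

definition mtrace :: "nat \<Rightarrow> cmatrix \<Rightarrow> complex" where
  "mtrace N M = (\<Sum>x\<in>{1..N}. M x x)"

definition mat_vec :: "nat \<Rightarrow> cmatrix \<Rightarrow> (nat \<Rightarrow> complex) \<Rightarrow> (nat \<Rightarrow> complex)" where
  "mat_vec N M v = (\<lambda>x. if x \<in> {1..N} then \<Sum>y\<in>{1..N}. M x y * v y else 0)"

abbreviation cvec :: "nat \<Rightarrow> (nat \<Rightarrow> complex) set" where
  "cvec N \<equiv> ell2 {1..N}"

text \<open>Complex subspaces, spans and dimensions, via the vector space of all complex sequences.\<close>

interpretation cseq: vector_space "\<lambda>(c::complex) (f::nat \<Rightarrow> complex) x. c * f x"
  by unfold_locales (auto simp: fun_eq_iff algebra_simps)

definition orth_compl :: "nat \<Rightarrow> (nat \<Rightarrow> complex) set \<Rightarrow> (nat \<Rightarrow> complex) set" where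
  "orth_compl N H = {v \<in> cvec N. \<forall>h\<in>H. ell2_inner {1..N} h v = 0}"

text \<open>The limit \<open>N \<rightarrow> \<infinity>\<close> along the index set \<open>\<N>\<close>.\<close>

definition along :: "nat set \<Rightarrow> nat filter" where
  "along \<N> = inf sequentially (principal \<N>)"

definition converges_to_regular ::
  "('a, 'b) monoid_scheme \<Rightarrow> nat set \<Rightarrow> (nat \<Rightarrow> 'a \<Rightarrow> nat \<Rightarrow> nat) \<Rightarrow> bool" where
  "converges_to_regular G \<N> \<rho> \<longleftrightarrow>
     (\<forall>g\<in>carrier G - {\<one>\<^bsub>G\<^esub>}.
        ((\<lambda>N. 1 / of_nat N * mtrace N (perm_matrix (\<rho> N g))) \<longlongrightarrow> 0) (along \<N>))"

text \<open>
  \<open>\<phi> 1, \<dots>, \<phi> N\<close> is an orthonormal basis of $\mathbb C^N$ and \<open>\<phi> \<alpha>\<close> is an eigenvector of \<open>M\<close> with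
  eigenvalue \<open>ev \<alpha>\<close>.  Eigenvalues are real since \<open>M\<close> is only ever a Hermitian matrix.
\<close>

definition orthonormal_eigenbasis ::
  "nat \<Rightarrow> cmatrix \<Rightarrow> (nat \<Rightarrow> real) \<Rightarrow> (nat \<Rightarrow> nat \<Rightarrow> complex) \<Rightarrow> bool" where
  "orthonormal_eigenbasis N M ev \<phi> \<longleftrightarrow>
     (\<forall>\<alpha>\<in>{1..N}. \<phi> \<alpha> \<in> cvec N) \<and>
     (\<forall>\<alpha>\<in>{1..N}. \<forall>\<beta>\<in>{1..N}. ell2_inner {1..N} (\<phi> \<alpha>) (\<phi> \<beta>) = (if \<alpha> = \<beta> then 1 else 0)) \<and>
     cseq.span (\<phi> ` {1..N}) = cvec N \<and>
     (\<forall>\<alpha>\<in>{1..N}. mat_vec N M (\<phi> \<alpha>) = (\<lambda>x. complex_of_real (ev \<alpha>) * \<phi> \<alpha> x))"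


section \<open>Local observables\<close>

text \<open>Maximal modulus of an entry, for \<open>N \<ge> 1\<close>.\<close>

definition norm_1_inf :: "nat \<Rightarrow> cmatrix \<Rightarrow> real" where
  "norm_1_inf N K = Max {cmod (K x y) | x y. x \<in> {1..N} \<and> y \<in> {1..N}}"

definition is_local :: "('a \<Rightarrow> nat \<Rightarrow> nat) \<Rightarrow> 'a set \<Rightarrow> nat \<Rightarrow> cmatrix \<Rightarrow> bool" where
  "is_local \<rho> T N K \<longleftrightarrow>
     (\<forall>x\<in>{1..N}. \<forall>y\<in>{1..N}. (\<nexists>g. g \<in> T \<and> x = \<rho> g y) \<longrightarrow> K x y = 0)"

definition avg_coeff :: "('a \<Rightarrow> nat \<Rightarrow> nat) \<Rightarrow> 'a set \<Rightarrow> nat \<Rightarrow> cmatrix \<Rightarrow> ('a \<Rightarrow> complex)" where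
  "avg_coeff \<rho> T N K =
     (\<lambda>g. if g \<in> T then 1 / of_nat N * (\<Sum>x\<in>{1..N}. K (\<rho> g x) x) else 0)"

definition avg :: "('a \<Rightarrow> nat \<Rightarrow> nat) \<Rightarrow> 'a set \<Rightarrow> nat \<Rightarrow> cmatrix \<Rightarrow> cmatrix" where
  "avg \<rho> T N K = rep_matrix \<rho> (avg_coeff \<rho> T N K)"

definition local_vector :: "('a \<Rightarrow> nat \<Rightarrow> nat) \<Rightarrow> 'a \<Rightarrow> nat \<Rightarrow> cmatrix \<Rightarrow> (nat \<Rightarrow> complex)" where
  "local_vector \<rho> t N K = (\<lambda>x. if x \<in> {1..N} then K (\<rho> t x) x else 0)"

definition spec_indices :: "nat \<Rightarrow> (nat \<Rightarrow> real) \<Rightarrow> real set \<Rightarrow> nat set" where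
  "spec_indices N ev J = {\<alpha> \<in> {1..N}. ev \<alpha> \<in> J}"

definition mat_elem :: "nat \<Rightarrow> (nat \<Rightarrow> complex) \<Rightarrow> cmatrix \<Rightarrow> (nat \<Rightarrow> complex) \<Rightarrow> complex" where
  "mat_elem N u M v = ell2_inner {1..N} u (mat_vec N M v)"

text \<open>
  In both conditions the average over an empty index set is \<open>0\<close>, because \<open>1 / 0 = 0\<close>.
\<close>

definition quantum_ergodicity ::
  "nat set \<Rightarrow> (nat \<Rightarrow> 'a \<Rightarrow> nat \<Rightarrow> nat) \<Rightarrow> (nat \<Rightarrow> nat \<Rightarrow> real) \<Rightarrow> (nat \<Rightarrow> nat \<Rightarrow> nat \<Rightarrow> complex)
   \<Rightarrow> 'a set \<Rightarrow> (nat \<Rightarrow> cmatrix) \<Rightarrow> real set \<Rightarrow> bool" where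
  "quantum_ergodicity \<N> \<rho> ev \<phi> T K I \<longleftrightarrow>
     ((\<lambda>N. 1 / real (card (spec_indices N (ev N) I)) *
        (\<Sum>\<alpha>\<in>spec_indices N (ev N) I.
           (cmod (mat_elem N (\<phi> N \<alpha>) (K N) (\<phi> N \<alpha>)
                - mat_elem N (\<phi> N \<alpha>) (avg (\<rho> N) T N (K N)) (\<phi> N \<alpha>)))\<^sup>2))
      \<longlongrightarrow> 0) (along \<N>)"

definition mixing_average ::
  "(nat \<Rightarrow> 'a \<Rightarrow> nat \<Rightarrow> nat) \<Rightarrow> (nat \<Rightarrow> nat \<Rightarrow> real) \<Rightarrow> (nat \<Rightarrow> nat \<Rightarrow> nat \<Rightarrow> complex)
   \<Rightarrow> 'a set \<Rightarrow> (nat \<Rightarrow> cmatrix) \<Rightarrow> nat \<Rightarrow> real set \<Rightarrow> real set \<Rightarrow> real" where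
  "mixing_average \<rho> ev \<phi> T K N J\<^sub>1 J\<^sub>2 =
     1 / real (card (spec_indices N (ev N) J\<^sub>1)) *
       (\<Sum>\<alpha>\<in>spec_indices N (ev N) J\<^sub>1. \<Sum>\<beta>\<in>spec_indices N (ev N) J\<^sub>2.
          (cmod (mat_elem N (\<phi> N \<beta>) (K N) (\<phi> N \<alpha>)
               - mat_elem N (\<phi> N \<beta>) (avg (\<rho> N) T N (K N)) (\<phi> N \<alpha>)))\<^sup>2)"

definition quantum_mixing ::
  "nat set \<Rightarrow> (nat \<Rightarrow> 'a \<Rightarrow> nat \<Rightarrow> nat) \<Rightarrow> (nat \<Rightarrow> nat \<Rightarrow> real) \<Rightarrow> (nat \<Rightarrow> nat \<Rightarrow> nat \<Rightarrow> complex)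
   \<Rightarrow> 'a set \<Rightarrow> (nat \<Rightarrow> cmatrix) \<Rightarrow> real set \<Rightarrow> bool" where
  "quantum_mixing \<N> \<rho> ev \<phi> T K I \<longleftrightarrow>
     ((\<lambda>\<eta>. Limsup (along \<N>) (\<lambda>N. SUP (E\<^sub>1, E\<^sub>2)\<in>interior I \<times> interior I.
         ennreal (mixing_average \<rho> ev \<phi> T K N {E\<^sub>1 - \<eta>..E\<^sub>1 + \<eta>} {E\<^sub>2 - \<eta>..E\<^sub>2 + \<eta>})))
      \<longlongrightarrow> 0) (at_right 0)"

end

theory Submission
  imports Defs "HOL-Real_Asymp.Real_Asymp"
begin

text \<open>Let \<open>f\<close> be the Lorentzian of width \<open>\<eta>\<close> around an energy \<open>E\<close>, so that \<open>f(P)\<close> is the imaginary part of the resolvent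
  at \<open>E + i\<eta>\<close>.  It is at least \<open>1/(2\<eta>)\<close> on the window of size \<open>\<eta>\<close> around \<open>E\<close>.  For two such functions the sum of
  \<open>|\<langle>\<phi>\<^sub>\<beta>, K\<phi>\<^sub>\<alpha>\<rangle>|\<^sup>2\<close> over two windows is therefore at most \<open>4\<eta>\<^sup>2\<close> times the trace of
  \<open>f\<^sub>2(P\<^sub>N) K f\<^sub>1(P\<^sub>N) K\<^sup>*\<close>.  A truncated Neumann series replaces \<open>f\<close> by a polynomial in \<open>p\<close>, hence by an element \<open>q\<close> of the
  group algebra, which acts compatibly on \<open>\<ell>\<^sup>2(\<Gamma>)\<close> and on every \<open>\<complex>\<^sup>N\<close>; the truncation error is exponentially
  small whereas the support grows linearly (\<open>resolvent_approximation\<close>, \<open>polynomial_approximant\<close>).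

  A local observable is, apart from the few points where the action is not free, a sum of operators \<open>\<rho>(t)D\<close>
  with \<open>D\<close> multiplication by a vector \<open>v\<close> (\<open>local_decomposition\<close>).  For such an operator the trace is a sum, over
  pairs of group elements in the supports of \<open>q\<^sub>1\<close> and \<open>q\<^sub>2\<close>, over the fixed points of a word in them.  Convergence in
  distribution says that only words trivial in \<open>\<Gamma>\<close> matter, and those sum to \<open>\<langle>v, \<rho>\<^sub>N(A)v\<rangle>\<close>, where
  \<open>A(h) = q\<^sub>1(h\<^sup>-\<^sup>1) q\<^sub>2(tht\<^sup>-\<^sup>1)\<close> (\<open>variance_kernel\<close>).

  If \<open>\<rho>\<^sub>N\<close> converged strongly, the norm of \<open>\<rho>\<^sub>N(A)\<close> would be asymptotically that of \<open>\<lambda>(A)\<close>.  Convergence in distribution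
  gives as much on the orthogonal complement of a space of dimension \<open>o(N)\<close>, by comparing moments of high order
  (\<open>exceptional_subspace\<close>); these spaces, for a countable family of kernels, make up \<open>H\<^sub>N\<close> (\<open>diagonal_union\<close>,
  \<open>exceptional_sets\<close>).  Adding the constants to \<open>H\<^sub>N\<close> makes the average of the observable vanish.  Rapid decay
  bounds the norm of \<open>\<lambda>(A)\<close> by a weighted \<open>\<ell>\<^sup>2\<close> norm of \<open>A\<close> (\<open>rapid_decay_weighted\<close>), hence by weighted fourth powers
  of resolvent entries (\<open>kernel_weight\<close>), and the fourth-power condition makes the sum over two windows
  \<open>o(\<eta>)N\<close> (\<open>window_variance\<close>).  Since the density of states is bounded below, a window contains at least a constant
  times \<open>\<eta>N\<close> eigenvalues (\<open>count_lower\<close>), and all the normalised sums tend to zero.\<close>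

section \<open>The Hilbert space of square-summable functions\<close>

lemma ell2_outside: "f \<in> ell2 X \<Longrightarrow> x \<notin> X \<Longrightarrow> f x = 0"
  by (simp add: ell2_def)

lemma ell2_norm_nonneg [simp]: "0 \<le> ell2_norm X f"
  by (simp add: ell2_norm_def infsum_nonneg)

lemma L2_set_le_ell2_norm:
  assumes "f \<in> ell2 X" "finite F" "F \<subseteq> X"
  shows "L2_set (\<lambda>x. cmod (f x)) F \<le> ell2_norm X f"
  unfolding L2_set_def ell2_norm_def
  by (rule real_sqrt_le_mono, rule finite_sum_le_infsum) (use assms in \<open>auto simp: ell2_def\<close>)

lemma ell2_boundedI:
  assumes "\<And>x. x \<notin> X \<Longrightarrow> f x = 0"
    and "\<And>F. finite F \<Longrightarrow> F \<subseteq> X \<Longrightarrow> L2_set (\<lambda>x. cmod (f x)) F \<le> c"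
  shows "f \<in> ell2 X" "ell2_norm X f \<le> c"
proof -
  have c: "0 \<le> c" using assms(2)[of "{}"] by simp
  have *: "(\<Sum>x\<in>F. (cmod (f x))\<^sup>2) \<le> c\<^sup>2" if "finite F" "F \<subseteq> X" for F
    using assms(2)[OF that] c unfolding L2_set_def
    by (metis real_sqrt_le_iff real_sqrt_unique)
  have s: "(\<lambda>x. (cmod (f x))\<^sup>2) summable_on X"
    by (rule nonneg_bdd_above_summable_on) (auto intro!: bdd_aboveI2[where M="c\<^sup>2"] *)
  then show "f \<in> ell2 X" using assms(1) by (simp add: ell2_def)
  have "(\<Sum>\<^sub>\<infinity>x\<in>X. (cmod (f x))\<^sup>2) \<le> c\<^sup>2"
    by (rule infsum_le_finite_sums[OF s]) (use * in auto)
  then show "ell2_norm X f \<le> c"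
    unfolding ell2_norm_def using c real_le_lsqrt infsum_nonneg by (metis real_sqrt_le_iff real_sqrt_unique)
qed

lemma cmod_le_ell2_norm:
  assumes "f \<in> ell2 X" shows "cmod (f x) \<le> ell2_norm X f"
proof (cases "x \<in> X")
  case True
  then show ?thesis using L2_set_le_ell2_norm[OF assms, of "{x}"] by simp
qed (use assms in \<open>simp add: ell2_outside\<close>)

lemma ell2_zero [simp]: "(\<lambda>x. 0) \<in> ell2 X" "ell2_norm X (\<lambda>x. 0) = 0"
  by (auto simp: ell2_def ell2_norm_def)

lemma ell2_add:
  assumes "f \<in> ell2 X" "h \<in> ell2 X"
  shows "(\<lambda>x. f x + h x) \<in> ell2 X"
    and ell2_norm_triangle: "ell2_norm X (\<lambda>x. f x + h x) \<le> ell2_norm X f + ell2_norm X h"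
proof -
  have *: "L2_set (\<lambda>x. cmod (f x + h x)) F \<le> ell2_norm X f + ell2_norm X h"
    if F: "finite F" "F \<subseteq> X" for F
  proof -
    have "L2_set (\<lambda>x. cmod (f x + h x)) F \<le> L2_set (\<lambda>x. cmod (f x) + cmod (h x)) F"
      by (rule L2_set_mono) (auto intro: norm_triangle_ineq)
    also have "\<dots> \<le> L2_set (\<lambda>x. cmod (f x)) F + L2_set (\<lambda>x. cmod (h x)) F"
      by (rule L2_set_triangle_ineq)
    finally show ?thesis
      using L2_set_le_ell2_norm[OF assms(1) F] L2_set_le_ell2_norm[OF assms(2) F] by linarith
  qed
  show "(\<lambda>x. f x + h x) \<in> ell2 X" "ell2_norm X (\<lambda>x. f x + h x) \<le> ell2_norm X f + ell2_norm X h"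
    by (rule ell2_boundedI[OF _ *]; use assms in \<open>simp add: ell2_outside\<close>)+
qed

lemma ell2_norm_scale: "ell2_norm X (\<lambda>x. c * f x) = cmod c * ell2_norm X f"
  by (simp add: ell2_norm_def norm_mult power_mult_distrib infsum_cmult_right' real_sqrt_mult)

lemma ell2_scale:
  assumes "f \<in> ell2 X" shows "(\<lambda>x. c * f x) \<in> ell2 X"
  using assms by (auto simp: ell2_def norm_mult power_mult_distrib intro!: summable_on_cmult_right)

lemma ell2_diff:
  assumes "f \<in> ell2 X" "h \<in> ell2 X"
  shows "(\<lambda>x. f x - h x) \<in> ell2 X"
  using ell2_add(1)[OF assms(1) ell2_scale[OF assms(2), of "-1"]] by simp

lemma ell2_sum:
  assumes "finite A" "\<And>i. i \<in> A \<Longrightarrow> f i \<in> ell2 X"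
  shows "(\<lambda>x. \<Sum>i\<in>A. f i x) \<in> ell2 X"
    and ell2_norm_sum: "ell2_norm X (\<lambda>x. \<Sum>i\<in>A. f i x) \<le> (\<Sum>i\<in>A. ell2_norm X (f i))"
proof -
  have "(\<lambda>x. \<Sum>i\<in>A. f i x) \<in> ell2 X \<and> ell2_norm X (\<lambda>x. \<Sum>i\<in>A. f i x) \<le> (\<Sum>i\<in>A. ell2_norm X (f i))"
    using assms
  proof (induction A)
    case (insert a A)
    then show ?case
      using ell2_add[of "f a" X "\<lambda>x. \<Sum>i\<in>A. f i x"] by (auto intro: order_trans)
  qed auto
  then show "(\<lambda>x. \<Sum>i\<in>A. f i x) \<in> ell2 X"
    "ell2_norm X (\<lambda>x. \<Sum>i\<in>A. f i x) \<le> (\<Sum>i\<in>A. ell2_norm X (f i))" by auto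
qed

lemma ell2_inner_sums:
  assumes "f \<in> ell2 X" "h \<in> ell2 X" "finite F" "F \<subseteq> X"
  shows "(\<Sum>x\<in>F. cmod (cnj (f x) * h x)) \<le> ell2_norm X f * ell2_norm X h"
proof -
  have "(\<Sum>x\<in>F. cmod (cnj (f x) * h x)) = (\<Sum>x\<in>F. \<bar>cmod (f x)\<bar> * \<bar>cmod (h x)\<bar>)"
    by (simp add: norm_mult)
  also have "\<dots> \<le> L2_set (\<lambda>x. cmod (f x)) F * L2_set (\<lambda>x. cmod (h x)) F"
    by (rule L2_set_mult_ineq)
  also have "\<dots> \<le> ell2_norm X f * ell2_norm X h"
    by (intro mult_mono L2_set_le_ell2_norm assms) auto
  finally show ?thesis .
qed

lemma ell2_inner_abs_summable:
  assumes "f \<in> ell2 X" "h \<in> ell2 X"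
  shows "(\<lambda>x. cmod (cnj (f x) * h x)) summable_on X"
proof (rule nonneg_bdd_above_summable_on)
  show "bdd_above (sum (\<lambda>x. cmod (cnj (f x) * h x)) ` {F. F \<subseteq> X \<and> finite F})"
    by (rule bdd_aboveI2[where M="ell2_norm X f * ell2_norm X h"])
      (use ell2_inner_sums[OF assms] in blast)
qed simp

lemma ell2_inner_summable:
  assumes "f \<in> ell2 X" "h \<in> ell2 X"
  shows "(\<lambda>x. cnj (f x) * h x) summable_on X"
  using ell2_inner_abs_summable[OF assms] by (rule abs_summable_summable)

lemma ell2_Cauchy_Schwarz:
  assumes "f \<in> ell2 X" "h \<in> ell2 X"
  shows "cmod (ell2_inner X f h) \<le> ell2_norm X f * ell2_norm X h"
proof -
  have "cmod (ell2_inner X f h) \<le> (\<Sum>\<^sub>\<infinity>x\<in>X. cmod (cnj (f x) * h x))"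
    unfolding ell2_inner_def by (rule norm_infsum_bound[OF ell2_inner_abs_summable[OF assms]])
  also have "\<dots> \<le> ell2_norm X f * ell2_norm X h"
    by (rule infsum_le_finite_sums[OF ell2_inner_abs_summable[OF assms]])
      (use ell2_inner_sums[OF assms] in auto)
  finally show ?thesis .
qed

lemma ell2_inner_self: "ell2_inner X f f = complex_of_real ((ell2_norm X f)\<^sup>2)"
proof -
  have "cnj (f x) * f x = of_real ((cmod (f x))\<^sup>2)" for x
    by (metis complex_norm_square mult.commute)
  then have "ell2_inner X f f = (\<Sum>\<^sub>\<infinity>x\<in>X. of_real ((cmod (f x))\<^sup>2))"
    unfolding ell2_inner_def by simp
  also have "\<dots> = of_real (\<Sum>\<^sub>\<infinity>x\<in>X. (cmod (f x))\<^sup>2)"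
  proof (cases "(\<lambda>x. (cmod (f x))\<^sup>2) summable_on X")
    case True
    then show ?thesis
      by (intro infsumI has_sum_of_real has_sum_infsum)
  next
    case False
    then have "\<not> (\<lambda>x. complex_of_real ((cmod (f x))\<^sup>2)) summable_on X"
      by (metis has_sum_of_real_iff has_sum_Re summable_on_def Re_complex_of_real summable_on_cong)
    then show ?thesis using False by (simp add: infsum_not_exists)
  qed
  finally show ?thesis by (simp add: ell2_norm_def infsum_nonneg)
qed

lemma ell2_inner_commute: "ell2_inner X h f = cnj (ell2_inner X f h)"
  by (simp add: ell2_inner_def mult.commute flip: infsum_cnj)

lemma ell2_inner_scale_right: "ell2_inner X f (\<lambda>x. c * h x) = c * ell2_inner X f h"
  by (simp add: ell2_inner_def mult.left_commute infsum_cmult_right')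

lemma ell2_inner_scale_left: "ell2_inner X (\<lambda>x. c * h x) f = cnj c * ell2_inner X h f"
  by (subst (1 2) ell2_inner_commute) (simp add: ell2_inner_scale_right)

lemma ell2_inner_add_right:
  assumes "f \<in> ell2 X" "h \<in> ell2 X" "k \<in> ell2 X"
  shows "ell2_inner X f (\<lambda>x. h x + k x) = ell2_inner X f h + ell2_inner X f k"
  unfolding ell2_inner_def
  by (subst infsum_add[symmetric]) (auto intro!: ell2_inner_summable assms simp: distrib_left)

lemma ell2_inner_diff_right:
  assumes "f \<in> ell2 X" "h \<in> ell2 X" "k \<in> ell2 X"
  shows "ell2_inner X f (\<lambda>x. h x - k x) = ell2_inner X f h - ell2_inner X f k"
  using ell2_inner_add_right[OF assms(1,2) ell2_scale[OF assms(3), of "-1"]]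
  by (simp add: ell2_inner_scale_right[of X f "-1" k, simplified])

lemma ell2_inner_diff_left:
  assumes "f \<in> ell2 X" "h \<in> ell2 X" "k \<in> ell2 X"
  shows "ell2_inner X (\<lambda>x. h x - k x) f = ell2_inner X h f - ell2_inner X k f"
  by (subst (1 2 3) ell2_inner_commute) (simp add: ell2_inner_diff_right[OF assms])

lemma ell2_inner_sum_right:
  assumes "finite A" "f \<in> ell2 X" "\<And>i. i \<in> A \<Longrightarrow> u i \<in> ell2 X"
  shows "ell2_inner X f (\<lambda>x. \<Sum>i\<in>A. c i * u i x) = (\<Sum>i\<in>A. c i * ell2_inner X f (u i))"
  using assms(1,3)
proof (induction A)
  case empty
  show ?case by (simp add: ell2_inner_def)
next
  case (insert a A)
  then show ?case
    using ell2_inner_add_right[OF assms(2), of "\<lambda>x. c a * u a x" "\<lambda>x. \<Sum>i\<in>A. c i * u i x"]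
    by (simp add: ell2_scale ell2_sum ell2_inner_scale_right)
qed

lemma ell2_inner_sum_left:
  assumes "finite A" "f \<in> ell2 X" "\<And>i. i \<in> A \<Longrightarrow> u i \<in> ell2 X"
  shows "ell2_inner X (\<lambda>x. \<Sum>i\<in>A. c i * u i x) f = (\<Sum>i\<in>A. cnj (c i) * ell2_inner X (u i) f)"
  by (subst (1 2) ell2_inner_commute) (simp add: ell2_inner_sum_right[OF assms])

lemma delta_ell2 [simp]: "x \<in> X \<Longrightarrow> delta x \<in> ell2 X"
  and ell2_norm_delta: "x \<in> X \<Longrightarrow> ell2_norm X (delta x) = 1"
proof -
  assume x: "x \<in> X"
  have 1: "((\<lambda>y. (cmod (delta x y))\<^sup>2) has_sum 1) X"
    by (rule has_sum_finite_neutralI[where B="{x}"]) (use x in \<open>auto simp: delta_def\<close>)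
  then show "delta x \<in> ell2 X" 
    using x by (auto simp: ell2_def delta_def summable_on_def)
  show "ell2_norm X (delta x) = 1"
    using infsumI[OF 1] by (simp add: ell2_norm_def)
qed

lemma ell2_inner_delta: 
  assumes "x \<in> X" shows "ell2_inner X (delta x) f = f x"
proof -
  have "((\<lambda>y. cnj (delta x y) * f y) has_sum f x) X"
    by (rule has_sum_finite_neutralI[where B="{x}"]) (use assms in \<open>auto simp: delta_def\<close>)
  then show ?thesis unfolding ell2_inner_def by (rule infsumI)
qed

lemma ell2_norm_eq_0: 
  assumes "f \<in> ell2 X" "ell2_norm X f = 0" shows "f = (\<lambda>x. 0)"
  using cmod_le_ell2_norm[OF assms(1)] assms(2) by (auto simp: fun_eq_iff)

lemma ell2_norm_diff_sq:
  assumes "f \<in> ell2 X" "h \<in> ell2 X"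
  shows "(ell2_norm X (\<lambda>x. f x - h x))\<^sup>2
    = (ell2_norm X f)\<^sup>2 - 2 * Re (ell2_inner X f h) + (ell2_norm X h)\<^sup>2"
proof -
  have "complex_of_real ((ell2_norm X (\<lambda>x. f x - h x))\<^sup>2)
     = ell2_inner X f f - ell2_inner X f h - (ell2_inner X h f - ell2_inner X h h)"
    unfolding ell2_inner_self[symmetric]
    by (simp add: ell2_inner_diff_right[OF ell2_diff[OF assms] assms]
        ell2_inner_diff_left[OF assms(1) assms] ell2_inner_diff_left[OF assms(2) assms])
  then have "Re (complex_of_real ((ell2_norm X (\<lambda>x. f x - h x))\<^sup>2))
     = Re (ell2_inner X f f - ell2_inner X f h - (cnj (ell2_inner X f h) - ell2_inner X h h))"
    using ell2_inner_commute[of X h f] by metis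
  then show ?thesis by (simp add: ell2_inner_self)
qed

text \<open>Completeness of \<open>\<ell>\<^sup>2\<close>.  The sum is taken pointwise, so that operators built from finitely many
  translations commute with it without any appeal to continuity.\<close>

lemma ell2_absolutely_convergent_series:
  fixes u :: "nat \<Rightarrow> 'x \<Rightarrow> complex"
  assumes u: "\<And>k. u k \<in> ell2 X" and c: "\<And>k. ell2_norm X (u k) \<le> c k" and "summable c"
  shows "(\<lambda>x. \<Sum>k. u k x) \<in> ell2 X"
    and "\<And>x. summable (\<lambda>k. u k x)"
    and "ell2_norm X (\<lambda>x. (\<Sum>k. u k x) - (\<Sum>k<n. u k x)) \<le> (\<Sum>k. c (k + n))"
proof -
  have le: "cmod (u k x) \<le> c k" for k x
    using cmod_le_ell2_norm[OF u] c order_trans by blast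
  have c0: "0 \<le> c k" for k using c[of k] ell2_norm_nonneg order_trans by blast
  show sm: "summable (\<lambda>k. u k x)" for x
    by (rule summable_comparison_test'[OF assms(3), of 0]) (use le in auto)
  have tail: "L2_set (\<lambda>x. cmod ((\<Sum>k. u k x) - (\<Sum>k<n. u k x))) F \<le> (\<Sum>k. c (k + n))"
    if F: "finite F" "F \<subseteq> X" for F n
  proof -
    have part: "L2_set (\<lambda>x. cmod (\<Sum>k<m. u (k + n) x)) F \<le> (\<Sum>k. c (k + n))" for m
    proof -
      have "L2_set (\<lambda>x. cmod (\<Sum>k<m. u (k + n) x)) F \<le> ell2_norm X (\<lambda>x. \<Sum>k<m. u (k + n) x)"
        by (rule L2_set_le_ell2_norm) (use F u in \<open>auto intro!: ell2_sum\<close>)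
      also have "\<dots> \<le> (\<Sum>k<m. ell2_norm X (u (k + n)))"
        by (rule ell2_norm_sum) (use u in auto)
      also have "\<dots> \<le> (\<Sum>k<m. c (k + n))"
        by (rule sum_mono) (use c in auto)
      also have "\<dots> \<le> (\<Sum>k. c (k + n))"
        by (rule sum_le_suminf) (use c0 assms(3) in \<open>auto simp: summable_iff_shift\<close>)
      finally show ?thesis .
    qed
    have lim: "(\<lambda>m. \<Sum>k<m. u (k + n) x) \<longlonglongrightarrow> (\<Sum>k. u k x) - (\<Sum>k<n. u k x)" for x
      unfolding suminf_minus_initial_segment[OF sm, of n x, symmetric]
      by (rule summable_LIMSEQ) (use sm summable_iff_shift[of "\<lambda>k. u k x" n] in auto)
    have "(\<lambda>m. L2_set (\<lambda>x. cmod (\<Sum>k<m. u (k + n) x)) F)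
        \<longlonglongrightarrow> L2_set (\<lambda>x. cmod ((\<Sum>k. u k x) - (\<Sum>k<n. u k x))) F"
      unfolding L2_set_def by (intro tendsto_intros lim)
    then show ?thesis by (rule LIMSEQ_le_const2) (use part in auto)
  qed
  show "(\<lambda>x. \<Sum>k. u k x) \<in> ell2 X"
    by (rule ell2_boundedI[OF _ tail[of _ 0, simplified]]) (simp add: ell2_outside[OF u])
  show "ell2_norm X (\<lambda>x. (\<Sum>k. u k x) - (\<Sum>k<n. u k x)) \<le> (\<Sum>k. c (k + n))"
    by (rule ell2_boundedI(2)[OF _ tail]) (simp add: ell2_outside[OF u])
qed

text \<open>Bounds on the \<^typ>\<open>ennreal\<close>-valued supremum become homogeneous inequalities between real norms.\<close>

lemma op_norm_bound:
  assumes "op_norm X A \<le> ennreal c" "0 \<le> c" "f \<in> ell2 X"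
    and hom: "\<And>a f. f \<in> ell2 X \<Longrightarrow> A (\<lambda>x. a * f x) = (\<lambda>x. a * A f x)"
  shows "ell2_norm X (A f) \<le> c * ell2_norm X f"
proof (cases "ell2_norm X f = 0")
  case True
  then have "f = (\<lambda>x. 0)" using assms(3) by (rule ell2_norm_eq_0[rotated])
  then have "A f = (\<lambda>x. 0)" using hom[OF assms(3), of 0] by simp
  then show ?thesis using True by simp
next
  case False
  then have pos: "ell2_norm X f > 0" using ell2_norm_nonneg[of X f] by linarith
  define a where "a = complex_of_real (1 / ell2_norm X f)"
  have a: "cmod a = 1 / ell2_norm X f" using pos by (simp add: a_def norm_divide)
  let ?h = "\<lambda>x. a * f x"
  have h: "?h \<in> ell2 X" "ell2_norm X ?h = 1"
    using pos assms(3) by (auto simp: a ell2_norm_scale intro!: ell2_scale)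
  have "ennreal (ell2_norm X (A ?h)) \<le> op_norm X A"
    unfolding op_norm_def by (rule SUP_upper) (use h in auto)
  then have "ell2_norm X (A ?h) \<le> c" using assms(1,2) by (metis ennreal_le_iff order_trans)
  then show ?thesis using pos unfolding hom[OF assms(3)] ell2_norm_scale 
    by (simp add: a field_simps)
qed

section \<open>The group algebra acting on a permutation representation\<close>

text \<open>The operator \<open>\<rho>(q)\<close> of a permutation representation on an arbitrary set.  With \<open>X = carrier G\<close> it is
  the left regular representation, with \<open>X = {1..N}\<close> it is \<open>\<rho>\<^sub>N(q)\<close>; facts about \<open>*\<close>-representations
  are thus proved once for both.\<close>

definition perm_op ::
  "('a, 'b) monoid_scheme \<Rightarrow> 'x set \<Rightarrow> ('a \<Rightarrow> 'x \<Rightarrow> 'x) \<Rightarrow> ('a \<Rightarrow> complex) \<Rightarrow> 'x operator" where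
  "perm_op G X act q f =
     (\<lambda>x. if x \<in> X then \<Sum>g\<in>supp q. q g * f (act (m_inv G g) x) else 0)"

lemma group_algebraD: "q \<in> group_algebra G \<Longrightarrow> finite (supp q)"
  "q \<in> group_algebra G \<Longrightarrow> g \<in> supp q \<Longrightarrow> g \<in> carrier G"
  "q \<in> group_algebra G \<Longrightarrow> g \<notin> carrier G \<Longrightarrow> q g = 0"
  by (auto simp: group_algebra_def supp_def)

lemma group_algebraI:
  "finite F \<Longrightarrow> F \<subseteq> carrier G \<Longrightarrow> (\<And>g. g \<notin> F \<Longrightarrow> q g = 0) \<Longrightarrow> q \<in> group_algebra G"
  unfolding group_algebra_def supp_def by (auto intro: finite_subset)

lemma group_algebra_add:
  assumes "q \<in> group_algebra G" "r \<in> group_algebra G"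
  shows "(\<lambda>g. q g + r g) \<in> group_algebra G"
  by (rule group_algebraI[of "supp q \<union> supp r"]) (use assms in \<open>auto simp: group_algebra_def supp_def\<close>)

lemma group_algebra_scale:
  assumes "q \<in> group_algebra G" shows "(\<lambda>g. c * q g) \<in> group_algebra G"
  by (rule group_algebraI[of "supp q"]) (use assms in \<open>auto simp: group_algebra_def supp_def\<close>)

lemma group_algebra_diff:
  assumes "q \<in> group_algebra G" "r \<in> group_algebra G"
  shows "(\<lambda>g. q g - r g) \<in> group_algebra G"
  by (rule group_algebraI[of "supp q \<union> supp r"]) (use assms in \<open>auto simp: group_algebra_def supp_def\<close>)

lemma group_algebra_sum:
  assumes "finite A" "\<And>i. i \<in> A \<Longrightarrow> q i \<in> group_algebra G"
  shows "(\<lambda>g. \<Sum>i\<in>A. q i g) \<in> group_algebra G"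
  by (rule group_algebraI[of "\<Union>i\<in>A. supp (q i)"])
    (use assms in \<open>auto simp: group_algebra_def supp_def intro!: sum.neutral\<close>)

lemma (in group) ell2_norm_group_algebra:
  assumes "finite F" "supp q \<subseteq> F" "F \<subseteq> carrier G"
  shows "(ell2_norm (carrier G) q)\<^sup>2 = (\<Sum>g\<in>F. (cmod (q g))\<^sup>2)"
proof -
  have "((\<lambda>g. (cmod (q g))\<^sup>2) has_sum (\<Sum>g\<in>F. (cmod (q g))\<^sup>2)) (carrier G)"
    by (rule has_sum_finite_neutralI[OF assms(1,3)]) (use assms in \<open>auto simp: supp_def\<close>)
  then show ?thesis by (simp add: ell2_norm_def infsumI sum_nonneg)
qed

lemma (in group) delta_group_algebra: "g \<in> carrier G \<Longrightarrow> delta g \<in> group_algebra G"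
  by (rule group_algebraI[of "{g}"]) (auto simp: delta_def)

lemma (in group) supp_ga_star:
  assumes "q \<in> group_algebra G" shows "supp (ga_star G q) = m_inv G ` supp q"
proof -
  have "x \<in> m_inv G ` supp q" if "x \<in> carrier G" "q (inv x) \<noteq> 0" for x
    using that by (intro image_eqI[of x _ "inv x"]) (auto simp: supp_def)
  then show ?thesis
    using group_algebraD(2)[OF assms] by (auto simp: supp_def ga_star_def)
qed

lemma (in group) ga_star_group_algebra:
  assumes "q \<in> group_algebra G" shows "ga_star G q \<in> group_algebra G"
  using assms unfolding group_algebra_def supp_ga_star[OF assms] 
  by (auto simp: supp_ga_star[OF assms])

locale perm_action = group G for G (structure) +
  fixes X :: "'x set" and act :: "'a \<Rightarrow> 'x \<Rightarrow> 'x"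
  assumes act_closed: "g \<in> carrier G \<Longrightarrow> x \<in> X \<Longrightarrow> act g x \<in> X"
    and act_one: "x \<in> X \<Longrightarrow> act \<one> x = x"
    and act_mult: "g \<in> carrier G \<Longrightarrow> h \<in> carrier G \<Longrightarrow> x \<in> X \<Longrightarrow> act (g \<otimes> h) x = act g (act h x)"
begin

abbreviation "\<pi> \<equiv> perm_op G X act"

lemma act_inv:
  assumes "g \<in> carrier G" "x \<in> X"
  shows "act (inv g) (act g x) = x" "act g (act (inv g) x) = x"
  using act_mult[of "inv g" g x] act_mult[of g "inv g" x] assms by (auto simp: act_one)

lemma act_bij: "g \<in> carrier G \<Longrightarrow> bij_betw (act g) X X"
  by (rule bij_betw_byWitness[where f'="act (inv g)"]) (auto simp: act_inv act_closed)

lemma perm_op_alt: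
  assumes "finite F" "supp q \<subseteq> F" "x \<in> X"
  shows "\<pi> q f x = (\<Sum>g\<in>F. q g * f (act (inv g) x))"
  using assms by (auto simp: perm_op_def supp_def intro!: sum.mono_neutral_left)

lemma perm_op_outside: "x \<notin> X \<Longrightarrow> \<pi> q f x = 0"
  by (simp add: perm_op_def)

definition translate :: "'a \<Rightarrow> 'x operator" where
  "translate g f = (\<lambda>x. if x \<in> X then f (act (inv g) x) else 0)"

lemma translate_ell2:
  assumes "g \<in> carrier G" "f \<in> ell2 X"
  shows "translate g f \<in> ell2 X" "ell2_norm X (translate g f) \<le> ell2_norm X f"
proof -
  have *: "L2_set (\<lambda>x. cmod (translate g f x)) F \<le> ell2_norm X f" if F: "finite F" "F \<subseteq> X" for F
  proof -
    have inj: "inj_on (act (inv g)) F"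
      using act_bij[of "inv g"] assms(1) F(2) by (meson bij_betw_imp_inj_on inj_on_subset inv_closed)
    have "L2_set (\<lambda>x. cmod (translate g f x)) F = L2_set (\<lambda>x. cmod (f x)) (act (inv g) ` F)"
      using F inj by (simp add: L2_set_def sum.reindex translate_def subset_iff cong: sum.cong)
    also have "\<dots> \<le> ell2_norm X f"
      by (rule L2_set_le_ell2_norm) (use assms F act_closed in auto)
    finally show ?thesis .
  qed
  show "translate g f \<in> ell2 X" "ell2_norm X (translate g f) \<le> ell2_norm X f"
    by (rule ell2_boundedI[OF _ *]; simp add: translate_def)+
qed

lemma perm_op_translate: "\<pi> q f = (\<lambda>x. \<Sum>g\<in>supp q. q g * translate g f x)"
  by (auto simp: perm_op_def translate_def)

lemma perm_op_ell2:
  assumes "q \<in> group_algebra G" "f \<in> ell2 X"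
  shows "\<pi> q f \<in> ell2 X"
    and perm_op_norm: "ell2_norm X (\<pi> q f) \<le> (\<Sum>g\<in>supp q. cmod (q g)) * ell2_norm X f"
proof -
  show "\<pi> q f \<in> ell2 X"
    unfolding perm_op_translate
    by (intro ell2_sum ell2_scale translate_ell2 group_algebraD assms) (use group_algebraD assms in auto)
  have "ell2_norm X (\<pi> q f) \<le> (\<Sum>g\<in>supp q. ell2_norm X (\<lambda>x. q g * translate g f x))"
    unfolding perm_op_translate
    by (intro ell2_norm_sum ell2_scale translate_ell2 group_algebraD assms) (use group_algebraD assms in auto)
  also have "\<dots> \<le> (\<Sum>g\<in>supp q. cmod (q g) * ell2_norm X f)"
    unfolding ell2_norm_scale
    by (intro sum_mono mult_left_mono translate_ell2 assms) (use group_algebraD assms in auto)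
  finally show "ell2_norm X (\<pi> q f) \<le> (\<Sum>g\<in>supp q. cmod (q g)) * ell2_norm X f"
    by (simp add: sum_distrib_right)
qed

lemma perm_op_scale_right: "\<pi> q (\<lambda>x. c * f x) = (\<lambda>x. c * \<pi> q f x)"
  by (auto simp: perm_op_def sum_distrib_left mult_ac)

lemma perm_op_diff_right: "\<pi> q (\<lambda>x. f x - h x) = (\<lambda>x. \<pi> q f x - \<pi> q h x)"
  by (auto simp: perm_op_def sum_subtractf right_diff_distrib)

lemma perm_op_scale: assumes "q \<in> group_algebra G" shows "\<pi> (\<lambda>g. c * q g) f = (\<lambda>x. c * \<pi> q f x)"
proof
  fix x show "\<pi> (\<lambda>g. c * q g) f x = c * \<pi> q f x"
  proof (cases "x \<in> X")
    case True
    have "\<pi> (\<lambda>g. c * q g) f x = (\<Sum>g\<in>supp q. c * q g * f (act (inv g) x))"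
      by (rule perm_op_alt) (use assms True in \<open>auto simp: group_algebra_def supp_def\<close>)
    then show ?thesis using True by (simp add: perm_op_def sum_distrib_left mult_ac)
  qed (simp add: perm_op_def)
qed

lemma perm_op_add:
  assumes "q \<in> group_algebra G" "r \<in> group_algebra G"
  shows "\<pi> (\<lambda>g. q g + r g) f = (\<lambda>x. \<pi> q f x + \<pi> r f x)"
proof
  fix x show "\<pi> (\<lambda>g. q g + r g) f x = \<pi> q f x + \<pi> r f x"
  proof (cases "x \<in> X")
    case True
    have F: "finite (supp q \<union> supp r)" using assms by (auto simp: group_algebra_def)
    show ?thesis
      by (subst (1 2 3) perm_op_alt[OF F]) (use True in \<open>auto simp: supp_def distrib_right sum.distrib\<close>)
  qed (simp add: perm_op_def)
qed

lemma perm_op_sum: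
  assumes "finite A" "\<And>i. i \<in> A \<Longrightarrow> q i \<in> group_algebra G"
  shows "\<pi> (\<lambda>g. \<Sum>i\<in>A. q i g) f = (\<lambda>x. \<Sum>i\<in>A. \<pi> (q i) f x)"
  using assms
proof (induction A)
  case empty
  show ?case by (auto simp: perm_op_def supp_def)
next
  case (insert a A)
  then show ?case
    using perm_op_add[of "q a" "\<lambda>g. \<Sum>i\<in>A. q i g" f] by (simp add: group_algebra_sum)
qed

lemma perm_op_diff:
  assumes "q \<in> group_algebra G" "r \<in> group_algebra G"
  shows "\<pi> (\<lambda>g. q g - r g) f = (\<lambda>x. \<pi> q f x - \<pi> r f x)"
  using perm_op_add[OF assms(1) group_algebra_scale[OF assms(2), of "-1"], of f]
    perm_op_scale[OF assms(2), of "-1" f] by simp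

lemma perm_op_delta_one:
  assumes "\<And>x. x \<notin> X \<Longrightarrow> f x = 0" shows "\<pi> (delta \<one>) f = f"
proof -
  have "supp (delta \<one>) = {\<one>}" by (auto simp: supp_def delta_def)
  then show ?thesis using assms by (auto simp: perm_op_def act_one delta_def)
qed

lemma translate_adjoint:
  assumes "g \<in> carrier G"
  shows "ell2_inner X (translate (inv g) f) h = ell2_inner X f (translate g h)"
proof -
  have "ell2_inner X (translate (inv g) f) h = (\<Sum>\<^sub>\<infinity>x\<in>X. cnj (f (act g x)) * h x)"
    unfolding ell2_inner_def by (rule infsum_cong) (simp add: translate_def assms)
  also have "\<dots> = (\<Sum>\<^sub>\<infinity>x\<in>X. (\<lambda>y. cnj (f y) * h (act (inv g) y)) (act g x))"
    by (rule infsum_cong) (simp add: act_inv assms)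
  also have "\<dots> = (\<Sum>\<^sub>\<infinity>y\<in>X. cnj (f y) * h (act (inv g) y))"
    by (rule infsum_reindex_bij_betw[OF act_bij[OF assms]])
  also have "\<dots> = ell2_inner X f (translate g h)"
    unfolding ell2_inner_def by (rule infsum_cong) (simp add: translate_def)
  finally show ?thesis .
qed

lemma perm_op_adjoint:
  assumes q: "q \<in> group_algebra G" and "f \<in> ell2 X" "h \<in> ell2 X"
  shows "ell2_inner X (\<pi> (ga_star G q) f) h = ell2_inner X f (\<pi> q h)"
proof -
  have inj: "inj_on (m_inv G) (supp q)"
    by (rule inj_onI) (metis inv_inv group_algebraD(2)[OF q])
  have "\<pi> (ga_star G q) f = (\<lambda>x. \<Sum>g\<in>supp q. cnj (q g) * translate (inv g) f x)"
    unfolding perm_op_translate supp_ga_star[OF q] sum.reindex[OF inj] o_def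
    by (intro ext sum.cong) (auto simp: ga_star_def group_algebraD(2)[OF q])
  then have "ell2_inner X (\<pi> (ga_star G q) f) h
      = (\<Sum>g\<in>supp q. cnj (cnj (q g)) * ell2_inner X (translate (inv g) f) h)"
    by (simp only:) (rule ell2_inner_sum_left,
      use assms group_algebraD[OF q] in \<open>auto intro!: translate_ell2\<close>)
  also have "\<dots> = (\<Sum>g\<in>supp q. q g * ell2_inner X f (translate g h))"
    by (intro sum.cong) (auto simp: translate_adjoint group_algebraD(2)[OF q])
  also have "\<dots> = ell2_inner X f (\<pi> q h)"
    unfolding perm_op_translate
    by (rule ell2_inner_sum_right[symmetric],
      use assms group_algebraD[OF q] in \<open>auto intro!: translate_ell2\<close>)
  finally show ?thesis .
qed

text \<open>An operator and its adjoint have the same norm bound: \<open>\<parallel>A\<^sup>*f\<parallel>\<^sup>2 = \<langle>f, A A\<^sup>*f\<rangle> \<le> \<parallel>f\<parallel> c \<parallel>A\<^sup>*f\<parallel>\<close>.\<close>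

lemma perm_op_adjoint_norm:
  assumes q: "q \<in> group_algebra G" and "f \<in> ell2 X" "0 \<le> c"
    and "\<And>h. h \<in> ell2 X \<Longrightarrow> ell2_norm X (\<pi> q h) \<le> c * ell2_norm X h"
  shows "ell2_norm X (\<pi> (ga_star G q) f) \<le> c * ell2_norm X f"
proof -
  define h where "h = \<pi> (ga_star G q) f"
  have h: "h \<in> ell2 X" unfolding h_def by (intro perm_op_ell2 ga_star_group_algebra assms)
  have "(ell2_norm X h)\<^sup>2 = cmod (ell2_inner X h h)"
    by (simp add: ell2_inner_self norm_power)
  also have "ell2_inner X h h = ell2_inner X f (\<pi> q h)"
    using perm_op_adjoint[OF q assms(2) h] h_def by simp
  also have "cmod \<dots> \<le> ell2_norm X f * ell2_norm X (\<pi> q h)"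
    by (intro ell2_Cauchy_Schwarz perm_op_ell2 assms h)
  also have "\<dots> \<le> ell2_norm X f * (c * ell2_norm X h)"
    by (intro mult_left_mono assms h) simp
  finally have "ell2_norm X h * ell2_norm X h \<le> (c * ell2_norm X f) * ell2_norm X h"
    by (simp add: power2_eq_square mult_ac)
  moreover have "ell2_norm X h = 0 \<or> ell2_norm X h > 0" using ell2_norm_nonneg[of X h] by linarith
  ultimately show ?thesis using assms(3) unfolding h_def[symmetric] by auto
qed

end

text \<open>The convolution product of \<open>p\<close> and \<open>q\<close> is \<open>\<lambda>(p)q\<close>, since \<open>q = \<lambda>(q)\<delta>\<^sub>e\<close>; \<^const>\<open>left_regular\<close> therefore also
  serves as the multiplication of the group algebra.\<close>

lemma (in group) supp_left_regular:
  assumes "p \<in> group_algebra G" "q \<in> group_algebra G"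
  shows "supp (left_regular G p q) \<subseteq> (\<lambda>(g, h). g \<otimes> h) ` (supp p \<times> supp q)"
proof
  fix x assume "x \<in> supp (left_regular G p q)"
  then have "(\<Sum>g\<in>supp p. p g * left_translation G g q x) \<noteq> 0"
    by (simp add: supp_def left_regular_def)
  then obtain g where g: "g \<in> supp p" "p g * left_translation G g q x \<noteq> 0"
    by (rule sum.not_neutral_contains_not_neutral)
  then have x: "x \<in> carrier G" "inv g \<otimes> x \<in> supp q"
    by (auto simp: left_translation_def supp_def split: if_splits)
  then show "x \<in> (\<lambda>(g, h). g \<otimes> h) ` (supp p \<times> supp q)"
    using g group_algebraD(2)[OF assms(1) g(1)]
    by (intro image_eqI[of _ _ "(g, inv g \<otimes> x)"]) (auto simp: m_assoc[symmetric])
qed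

lemma (in group) left_regular_group_algebra:
  assumes "p \<in> group_algebra G" "q \<in> group_algebra G"
  shows "left_regular G p q \<in> group_algebra G"
proof -
  have "finite ((\<lambda>(g, h). g \<otimes> h) ` (supp p \<times> supp q))"
    using assms group_algebraD(1) by blast
  moreover have "(\<lambda>(g, h). g \<otimes> h) ` (supp p \<times> supp q) \<subseteq> carrier G"
    using assms by (auto simp: group_algebra_def)
  ultimately show ?thesis
    using supp_left_regular[OF assms] unfolding group_algebra_def
    by (auto intro: finite_subset)
qed

lemma left_regular_eq_perm_op: "left_regular G q f = perm_op G (carrier G) (mult G) q f"
  by (auto simp: left_regular_def left_translation_def perm_op_def)

lemma (in group) regular_action: "perm_action G (carrier G) (mult G)"
  by unfold_locales (auto simp: m_assoc)

lemma (in perm_action) perm_op_mult: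
  assumes p: "p \<in> group_algebra G" and q: "q \<in> group_algebra G"
  shows "\<pi> (left_regular G p q) f = \<pi> p (\<pi> q f)"
proof
  fix x
  let ?F = "(\<lambda>(g, h). g \<otimes> h) ` (supp p \<times> supp q)"
  have F: "finite ?F" "?F \<subseteq> carrier G"
    using group_algebraD[OF p] group_algebraD[OF q] by (auto simp del: Sigma_cong)
  show "\<pi> (left_regular G p q) f x = \<pi> p (\<pi> q f) x"
  proof (cases "x \<in> X")
    case True
    have inner: "(\<Sum>k\<in>?F. left_translation G g q k * f (act (inv k) x))
        = \<pi> q f (act (inv g) x)" if g: "g \<in> supp p" for g
    proof -
      have gc: "g \<in> carrier G" using group_algebraD(2)[OF p g] .
      have inj: "inj_on (mult G g) (supp q)"
        using group_algebraD(2)[OF q] gc by (auto intro!: inj_onI)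
      have "(\<Sum>k\<in>?F. left_translation G g q k * f (act (inv k) x))
        = (\<Sum>k\<in>mult G g ` supp q. left_translation G g q k * f (act (inv k) x))"
      proof (rule sum.mono_neutral_right[OF F(1)])
        show "mult G g ` supp q \<subseteq> ?F" using g by auto
        show "\<forall>k\<in>?F - mult G g ` supp q. left_translation G g q k * f (act (inv k) x) = 0"
        proof
          fix k assume k: "k \<in> ?F - mult G g ` supp q"
          then have kc: "k \<in> carrier G" using F by blast
          have "inv g \<otimes> k \<notin> supp q"
          proof
            assume "inv g \<otimes> k \<in> supp q"
            moreover have "k = g \<otimes> (inv g \<otimes> k)" using gc kc by (simp add: m_assoc[symmetric])
            ultimately show False using k by blast
          qed
          then show "left_translation G g q k * f (act (inv k) x) = 0"
            by (simp add: left_translation_def supp_def)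
        qed
      qed
      also have "\<dots> = (\<Sum>h\<in>supp q. q h * f (act (inv h) (act (inv g) x)))"
        unfolding sum.reindex[OF inj] o_def
      proof (rule sum.cong[OF refl])
        fix h assume "h \<in> supp q"
        then have hc: "h \<in> carrier G" by (rule group_algebraD(2)[OF q])
        show "left_translation G g q (g \<otimes> h) * f (act (inv (g \<otimes> h)) x)
            = q h * f (act (inv h) (act (inv g) x))"
          using gc hc True by (simp add: left_translation_def inv_mult_group act_mult m_assoc[symmetric])
      qed
      finally show ?thesis using True gc by (simp add: perm_op_def act_closed)
    qed
    have "\<pi> (left_regular G p q) f x = (\<Sum>k\<in>?F. left_regular G p q k * f (act (inv k) x))"
      by (rule perm_op_alt[OF F(1) supp_left_regular[OF p q] True])
    also have "\<dots> = (\<Sum>k\<in>?F. \<Sum>g\<in>supp p. p g * (left_translation G g q k * f (act (inv k) x)))"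
      by (simp add: left_regular_def sum_distrib_right mult.assoc)
    also have "\<dots> = (\<Sum>g\<in>supp p. p g * (\<Sum>k\<in>?F. left_translation G g q k * f (act (inv k) x)))"
      by (subst sum.swap) (simp add: sum_distrib_left)
    also have "\<dots> = \<pi> p (\<pi> q f) x"
      using True by (simp add: inner perm_op_def[of G X act p])
    finally show ?thesis .
  qed (simp add: perm_op_def)
qed

context group
begin

interpretation reg: perm_action G "carrier G" "mult G" by (rule regular_action)

lemmas left_regular_ell2 = reg.perm_op_ell2[folded left_regular_eq_perm_op]
lemmas left_regular_adjoint = reg.perm_op_adjoint[folded left_regular_eq_perm_op]
lemmas left_regular_adjoint_norm = reg.perm_op_adjoint_norm[folded left_regular_eq_perm_op]
lemmas left_regular_mult = reg.perm_op_mult[folded left_regular_eq_perm_op]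

lemma left_regular_delta_one:
  assumes "q \<in> group_algebra G" shows "left_regular G q (delta \<one>) = q"
proof
  fix x
  show "left_regular G q (delta \<one>) x = q x"
  proof (cases "x \<in> carrier G")
    case True
    have eq: "inv g \<otimes> x = \<one> \<longleftrightarrow> g = x" if "g \<in> supp q" for g
      using group_algebraD(2)[OF assms that] True
      by (metis inv_closed inv_equality inv_inv l_inv)
    have "left_regular G q (delta \<one>) x = (\<Sum>g\<in>supp q. if g = x then q g else 0)"
      unfolding left_regular_def left_translation_def
      by (rule sum.cong) (use True eq in \<open>auto simp: delta_def\<close>)
    also have "\<dots> = q x" using group_algebraD(1)[OF assms] by (auto simp: supp_def)
    finally show ?thesis .
  next
    case False
    then show ?thesis
      by (simp add: left_regular_def left_translation_def group_algebraD(3)[OF assms])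
  qed
qed

end

lemma sym_group_action:
  assumes "group G" "\<rho> \<in> hom G (sym_group N)"
  shows "perm_action G {1..N} \<rho>"
proof -
  interpret group G by fact
  interpret gh: group_hom G "sym_group N" \<rho>
    using assms sym_group_is_group by (simp add: group_hom_def group_hom_axioms_def)
  have perm: "\<rho> g permutes {1..N}" if "g \<in> carrier G" for g
    using gh.hom_closed[OF that] by (simp add: sym_group_carrier)
  show ?thesis
  proof unfold_locales
    show "\<rho> g x \<in> {1..N}" if "g \<in> carrier G" "x \<in> {1..N}" for g x
      using permutes_in_image[OF perm[OF that(1)], of x] that(2) by simp
    show "\<rho> \<one>\<^bsub>G\<^esub> x = x" for x using gh.hom_one by (simp add: sym_group_one)
    show "\<rho> (g \<otimes>\<^bsub>G\<^esub> h) x = \<rho> g (\<rho> h x)" if "g \<in> carrier G" "h \<in> carrier G" for g h x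
      using gh.hom_mult[OF that] by (simp add: sym_group_mult)
  qed
qed

lemma (in perm_action) act_eq_iff:
  assumes "g \<in> carrier G" "x \<in> X" "y \<in> X"
  shows "x = act g y \<longleftrightarrow> y = act (inv g) x"
  using act_inv assms by metis

lemma mat_vec_rep_matrix:
  assumes "perm_action G {1..N} \<rho>" "q \<in> group_algebra G"
  shows "mat_vec N (rep_matrix \<rho> q) v = perm_op G {1..N} \<rho> q v"
proof
  interpret perm_action G "{1..N}" \<rho> by fact
  fix x
  show "mat_vec N (rep_matrix \<rho> q) v x = perm_op G {1..N} \<rho> q v x"
  proof (cases "x \<in> {1..N}")
    case True
    have one: "(\<Sum>y\<in>{1..N}. perm_matrix (\<rho> g) x y * v y) = v (\<rho> (inv\<^bsub>G\<^esub> g) x)"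
      if "g \<in> supp q" for g
    proof -
      have gc: "g \<in> carrier G" using group_algebraD(2)[OF assms(2) that] .
      have "(\<Sum>y\<in>{1..N}. perm_matrix (\<rho> g) x y * v y)
          = (\<Sum>y\<in>{1..N}. if y = \<rho> (inv\<^bsub>G\<^esub> g) x then v y else 0)"
        by (rule sum.cong) (use act_eq_iff[OF gc True] in \<open>auto simp: perm_matrix_def\<close>)
      also have "\<dots> = v (\<rho> (inv\<^bsub>G\<^esub> g) x)"
        using act_closed[of "inv\<^bsub>G\<^esub> g" x] gc True by auto
      finally show ?thesis .
    qed
    have "mat_vec N (rep_matrix \<rho> q) v x
        = (\<Sum>y\<in>{1..N}. \<Sum>g\<in>supp q. q g * (perm_matrix (\<rho> g) x y * v y))"
      using True by (simp add: mat_vec_def rep_matrix_def sum_distrib_right mult.assoc)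
    also have "\<dots> = (\<Sum>g\<in>supp q. q g * (\<Sum>y\<in>{1..N}. perm_matrix (\<rho> g) x y * v y))"
      by (subst sum.swap) (simp add: sum_distrib_left)
    also have "\<dots> = perm_op G {1..N} \<rho> q v x" using True by (simp add: one perm_op_def del: One_nat_def)
    finally show ?thesis .
  qed (auto simp: mat_vec_def perm_op_def)
qed

section \<open>Word length\<close>

locale finitely_generated = group G for G (structure) + fixes S :: "'a set"
  assumes gen: "finite_generating_set G S"
begin

abbreviation "letters \<equiv> S \<union> m_inv G ` S"
abbreviation "word_prod ws \<equiv> foldr (\<otimes>) ws \<one>"
abbreviation wl :: "'a \<Rightarrow> nat" where "wl \<equiv> word_length G S"

lemma letters_carrier: "letters \<subseteq> carrier G"
  using gen by (auto simp: finite_generating_set_def)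

lemma word_prod_closed: "set ws \<subseteq> letters \<Longrightarrow> word_prod ws \<in> carrier G"
  using letters_carrier by (induction ws) auto

lemma word_prod_append:
  assumes "set us \<subseteq> letters" "set vs \<subseteq> letters"
  shows "word_prod (us @ vs) = word_prod us \<otimes> word_prod vs"
  using assms(1)
proof (induction us)
  case Nil
  then show ?case using word_prod_closed[OF assms(2)] by simp
next
  case (Cons a us)
  then show ?case 
    using word_prod_closed[OF assms(2)] word_prod_closed[of us] letters_carrier
    by (auto simp: m_assoc)
qed

lemma ex_word:
  assumes "g \<in> carrier G" shows "\<exists>ws. set ws \<subseteq> letters \<and> word_prod ws = g"
proof -
  have "g \<in> generate G S" using assms gen by (simp add: finite_generating_set_def)
  then show ?thesis
  proof induction
    case one
    show ?case by (rule exI[of _ "[]"]) simp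
  next
    case (incl h)
    then show ?case using letters_carrier by (intro exI[of _ "[h]"]) auto
  next
    case (inv h)
    then show ?case using letters_carrier by (intro exI[of _ "[inv h]"]) auto
  next
    case (eng h1 h2)
    then obtain us vs where "set us \<subseteq> letters \<and> word_prod us = h1" "set vs \<subseteq> letters \<and> word_prod vs = h2"
      by blast
    then show ?case using word_prod_append by (intro exI[of _ "us @ vs"]) auto
  qed
qed

lemma wl_word:
  assumes "g \<in> carrier G"
  obtains ws where "length ws = wl g" "set ws \<subseteq> letters" "word_prod ws = g"
proof -
  have "\<exists>n ws. length ws = n \<and> set ws \<subseteq> letters \<and> word_prod ws = g"
    using ex_word[OF assms] by blast
  from LeastI_ex[OF this] show thesis using that unfolding word_length_def by blast
qed

lemma wl_le: "set ws \<subseteq> letters \<Longrightarrow> wl (word_prod ws) \<le> length ws"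
  unfolding word_length_def by (rule Least_le) blast

lemma wl_mult:
  assumes "g \<in> carrier G" "h \<in> carrier G" shows "wl (g \<otimes> h) \<le> wl g + wl h"
proof -
  obtain us vs where "length us = wl g" "set us \<subseteq> letters" "word_prod us = g"
    "length vs = wl h" "set vs \<subseteq> letters" "word_prod vs = h"
    using wl_word assms by metis
  then show ?thesis using wl_le[of "us @ vs"] word_prod_append[of us vs] by simp
qed

lemma wl_one [simp]: "wl \<one> = 0"
  using wl_le[of "[]"] by simp

lemma wl_eq_0: "g \<in> carrier G \<Longrightarrow> wl g = 0 \<Longrightarrow> g = \<one>"
  by (metis wl_word foldr.simps(1) id_apply length_0_conv)

lemma word_prod_inverse:
  assumes "set ws \<subseteq> letters"
  shows "set (rev (map (m_inv G) ws)) \<subseteq> letters" "word_prod (rev (map (m_inv G) ws)) = inv (word_prod ws)"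
proof -
  have sub: "set (map (m_inv G) ws) \<subseteq> letters" if "set ws \<subseteq> letters" for ws
    using that gen unfolding finite_generating_set_def by (auto simp: subset_iff image_iff)
  then show "set (rev (map (m_inv G) ws)) \<subseteq> letters" using assms by simp
  show "word_prod (rev (map (m_inv G) ws)) = inv (word_prod ws)"
    using assms
  proof (induction ws)
    case (Cons a ws)
    have "word_prod (rev (map (m_inv G) (a # ws))) = word_prod (rev (map (m_inv G) ws) @ [inv a])" by simp
    also have "\<dots> = word_prod (rev (map (m_inv G) ws)) \<otimes> word_prod [inv a]"
      by (rule word_prod_append) (use sub[of ws] sub[of "[a]"] Cons.prems in auto)
    also have "\<dots> = inv (word_prod ws) \<otimes> inv a"
      using Cons letters_carrier by auto
    also have "\<dots> = inv (a \<otimes> word_prod ws)"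
      using Cons.prems letters_carrier word_prod_closed[of ws] by (auto simp: inv_mult_group)
    finally show ?case by simp
  qed simp
qed

lemma wl_inv [simp]:
  assumes "g \<in> carrier G" shows "wl (inv g) = wl g"
proof -
  have le: "wl (inv g) \<le> wl g" if g: "g \<in> carrier G" for g
  proof -
    obtain ws where ws: "length ws = wl g" "set ws \<subseteq> letters" "word_prod ws = g"
      by (rule wl_word[OF g])
    show ?thesis using wl_le[OF word_prod_inverse(1)[OF ws(2)]] word_prod_inverse(2)[OF ws(2)] ws by simp
  qed
  from le[of g] le[of "inv g"] show ?thesis using assms by (simp add: le_antisym)
qed

end

section \<open>The resolvent as a Neumann series\<close>

text \<open>The element \<open>(p - E)\<^sup>2 + \<eta>\<^sup>2 = (p - z)(p - \<bar>z\<bar>)\<close>, for \<open>z = E + i\<eta>\<close>.\<close>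

definition quad_elt :: "('a, 'b) monoid_scheme \<Rightarrow> ('a \<Rightarrow> complex) \<Rightarrow> real \<Rightarrow> real \<Rightarrow> 'a \<Rightarrow> complex" where
  "quad_elt G p E \<eta> =
     (let d = (\<lambda>g. p g - of_real E * delta \<one>\<^bsub>G\<^esub> g)
      in (\<lambda>g. left_regular G d d g + of_real (\<eta>\<^sup>2) * delta \<one>\<^bsub>G\<^esub> g))"

text \<open>If \<open>B\<close> is the quadratic element then \<open>B\<^sup>-\<^sup>1\<close> is the sum of the powers of \<open>1 - B/M\<close>, divided by \<open>M\<close>.\<close>

definition neumann_elt ::
  "('a, 'b) monoid_scheme \<Rightarrow> ('a \<Rightarrow> complex) \<Rightarrow> real \<Rightarrow> real \<Rightarrow> real \<Rightarrow> 'a \<Rightarrow> complex" where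
  "neumann_elt G p E \<eta> M = (\<lambda>g. delta \<one>\<^bsub>G\<^esub> g - of_real (1 / M) * quad_elt G p E \<eta> g)"

context group
begin

lemma quad_elt_group_algebra: "p \<in> group_algebra G \<Longrightarrow> quad_elt G p E \<eta> \<in> group_algebra G"
  unfolding quad_elt_def Let_def
  by (intro group_algebra_add group_algebra_scale left_regular_group_algebra group_algebra_diff
      delta_group_algebra one_closed) auto

lemma neumann_elt_group_algebra: "p \<in> group_algebra G \<Longrightarrow> neumann_elt G p E \<eta> M \<in> group_algebra G"
  unfolding neumann_elt_def
  by (intro group_algebra_scale group_algebra_diff delta_group_algebra quad_elt_group_algebra one_closed) auto

end

locale self_adjoint_action = perm_action +
  fixes p :: "'a \<Rightarrow> complex" and E \<eta> :: real
  assumes p: "p \<in> group_algebra G" and p_star: "p = ga_star G p" and \<eta>: "0 < \<eta>"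
begin

lemma p_self_adjoint:
  "f \<in> ell2 X \<Longrightarrow> h \<in> ell2 X \<Longrightarrow> ell2_inner X (\<pi> p f) h = ell2_inner X f (\<pi> p h)"
  using perm_op_adjoint[OF p] p_star by metis

definition shifted :: "'c operator" where
  "shifted f = (\<lambda>x. \<pi> p f x - of_real E * f x)"

definition quad :: "'c operator" where
  "quad f = (\<lambda>x. shifted (shifted f) x + of_real (\<eta>\<^sup>2) * f x)"

lemma shifted_ell2: "f \<in> ell2 X \<Longrightarrow> shifted f \<in> ell2 X"
  unfolding shifted_def by (intro ell2_diff ell2_scale perm_op_ell2 p)

lemma shifted_self_adjoint:
  assumes "f \<in> ell2 X" "h \<in> ell2 X"
  shows "ell2_inner X (shifted f) h = ell2_inner X f (shifted h)"
  unfolding shifted_def using assms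
  by (simp add: ell2_inner_diff_left ell2_inner_diff_right perm_op_ell2 p ell2_scale p_self_adjoint
      ell2_inner_scale_left ell2_inner_scale_right)

lemma quad_ell2: "f \<in> ell2 X \<Longrightarrow> quad f \<in> ell2 X"
  unfolding quad_def by (intro ell2_add ell2_scale shifted_ell2)

lemma quad_inner:
  assumes "f \<in> ell2 X" "h \<in> ell2 X"
  shows "ell2_inner X f (quad h) = ell2_inner X (shifted f) (shifted h) + of_real (\<eta>\<^sup>2) * ell2_inner X f h"
  unfolding quad_def using assms
  by (simp add: ell2_inner_add_right shifted_ell2 ell2_scale shifted_self_adjoint ell2_inner_scale_right)

lemma quad_self_adjoint:
  assumes "f \<in> ell2 X" "h \<in> ell2 X"
  shows "ell2_inner X (quad f) h = ell2_inner X f (quad h)"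
  by (subst ell2_inner_commute, simp only: quad_inner[OF assms] quad_inner[OF assms(2,1)])
    (simp add: ell2_inner_commute[of X h f] ell2_inner_commute[of X "shifted h" "shifted f"])

text \<open>The bound that makes \<open>p - z\<close> invertible: \<open>\<langle>f, Bf\<rangle> = \<parallel>(p - E)f\<parallel>\<^sup>2 + \<eta>\<^sup>2\<parallel>f\<parallel>\<^sup>2\<close>.\<close>

lemma quad_coercive:
  assumes "f \<in> ell2 X"
  shows "\<eta>\<^sup>2 * (ell2_norm X f)\<^sup>2 \<le> Re (ell2_inner X f (quad f))"
  unfolding quad_inner[OF assms assms] by (simp add: ell2_inner_self)

lemma perm_op_quad_elt:
  assumes "\<And>x. x \<notin> X \<Longrightarrow> f x = 0" shows "\<pi> (quad_elt G p E \<eta>) f = quad f"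
proof -
  let ?d = "\<lambda>g. p g - of_real E * delta \<one> g"
  have dga: "?d \<in> group_algebra G"
    by (intro group_algebra_diff group_algebra_scale delta_group_algebra p one_closed)
  have d: "\<pi> ?d h = shifted h" if h: "\<And>x. x \<notin> X \<Longrightarrow> h x = 0" for h
    using perm_op_diff[OF p group_algebra_scale[OF delta_group_algebra[OF one_closed]], of "of_real E" h]
      perm_op_scale[OF delta_group_algebra[OF one_closed], of "of_real E" h] perm_op_delta_one[OF h]
    by (simp add: shifted_def)
  have "\<pi> (quad_elt G p E \<eta>) f
      = (\<lambda>x. \<pi> (left_regular G ?d ?d) f x + \<pi> (\<lambda>g. of_real (\<eta>\<^sup>2) * delta \<one> g) f x)"
    unfolding quad_elt_def Let_def
    by (intro perm_op_add left_regular_group_algebra group_algebra_scale delta_group_algebra dga one_closed)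
  also have "\<pi> (left_regular G ?d ?d) f = shifted (shifted f)"
    using perm_op_mult[OF dga dga, of f] d[OF assms] d[of "shifted f"] assms
    by (simp add: shifted_def perm_op_outside)
  also have "\<pi> (\<lambda>g. of_real (\<eta>\<^sup>2) * delta \<one> g) f = (\<lambda>x. of_real (\<eta>\<^sup>2) * f x)"
    using perm_op_scale[OF delta_group_algebra[OF one_closed], of "of_real (\<eta>\<^sup>2)" f]
      perm_op_delta_one[OF assms] by simp
  finally show ?thesis by (simp add: quad_def)
qed

lemma perm_op_neumann_elt:
  assumes "\<And>x. x \<notin> X \<Longrightarrow> f x = 0"
  shows "\<pi> (neumann_elt G p E \<eta> M) f = (\<lambda>x. f x - of_real (1 / M) * quad f x)"
proof -
  have "\<pi> (neumann_elt G p E \<eta> M) f = (\<lambda>x. \<pi> (delta \<one>) f x - \<pi> (\<lambda>g. of_real (1 / M) * quad_elt G p E \<eta> g) f x)"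
    unfolding neumann_elt_def
    by (intro perm_op_diff group_algebra_scale delta_group_algebra quad_elt_group_algebra p one_closed)
  then show ?thesis
    using perm_op_scale[OF quad_elt_group_algebra[OF p, of E \<eta>], of "of_real (1 / M)" f] 
      perm_op_quad_elt[OF assms] perm_op_delta_one[OF assms] by simp
qed

end

text \<open>The constant \<open>\<beta>\<close> bounds the \<open>\<ell>\<^sup>1\<close> norm of the quadratic element, hence its operator norm in every
  permutation representation.  One Neumann series with one rate of convergence is then valid in all
  of them at once.\<close>

locale neumann = self_adjoint_action +
  fixes \<beta> :: real
  assumes \<beta>_norm: "(\<Sum>g\<in>supp (quad_elt G p E \<eta>). cmod (quad_elt G p E \<eta> g)) \<le> \<beta>"
    and \<beta>_gt: "\<eta>\<^sup>2 < \<beta>"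
begin

definition "M = \<beta>\<^sup>2 / \<eta>\<^sup>2"
definition "r = sqrt (1 - \<eta> ^ 4 / \<beta>\<^sup>2)"
abbreviation "step \<equiv> \<pi> (neumann_elt G p E \<eta> M)"

lemma \<beta>_pos: "0 < \<beta>" using \<beta>_gt zero_le_power2[of \<eta>] by linarith
lemma M_pos: "0 < M" using \<beta>_pos \<eta> by (simp add: M_def)

lemma ratio: "0 < \<eta> ^ 4 / \<beta>\<^sup>2" "\<eta> ^ 4 / \<beta>\<^sup>2 < 1"
proof -
  show "0 < \<eta> ^ 4 / \<beta>\<^sup>2" using \<eta> \<beta>_pos by simp
  have "(\<eta>\<^sup>2)\<^sup>2 < \<beta>\<^sup>2" using \<beta>_gt by (intro power_strict_mono) auto
  then show "\<eta> ^ 4 / \<beta>\<^sup>2 < 1" using \<beta>_pos by (simp add: power_mult[symmetric])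
qed

lemma r_bounds: "0 < r" "r < 1" "r\<^sup>2 = 1 - \<eta> ^ 4 / \<beta>\<^sup>2"
  using ratio by (auto simp: r_def)

lemma quad_norm: "f \<in> ell2 X \<Longrightarrow> ell2_norm X (quad f) \<le> \<beta> * ell2_norm X f"
  using perm_op_norm[OF quad_elt_group_algebra[OF p, of E \<eta>], of f] perm_op_quad_elt[of f]
    mult_right_mono[OF \<beta>_norm ell2_norm_nonneg[of X f]]
  by (simp add: ell2_outside) 

lemma step_ell2: "f \<in> ell2 X \<Longrightarrow> step f \<in> ell2 X"
  by (intro perm_op_ell2 neumann_elt_group_algebra p)

lemma step_eq: "f \<in> ell2 X \<Longrightarrow> step f = (\<lambda>x. f x - of_real (1 / M) * quad f x)"
  by (rule perm_op_neumann_elt) (simp add: ell2_outside)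

text \<open>Instead of a spectral bound for \<open>1 - B/M\<close>, expand \<open>\<parallel>f - Bf/M\<parallel>\<^sup>2\<close>: the cross term is at least
  \<open>2\<eta>\<^sup>2\<parallel>f\<parallel>\<^sup>2/M\<close> by coercivity and the last term at most \<open>\<beta>\<^sup>2\<parallel>f\<parallel>\<^sup>2/M\<^sup>2\<close>.  The value \<open>M = \<beta>\<^sup>2/\<eta>\<^sup>2\<close> minimises
  the resulting factor.\<close>

lemma step_norm:
  assumes "f \<in> ell2 X" shows "ell2_norm X (step f) \<le> r * ell2_norm X f"
proof -
  let ?n = "ell2_norm X f"
  have "(ell2_norm X (step f))\<^sup>2 = ?n\<^sup>2 - 2 / M * Re (ell2_inner X f (quad f))
      + (ell2_norm X (quad f))\<^sup>2 / M\<^sup>2"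
    unfolding step_eq[OF assms] ell2_norm_diff_sq[OF assms ell2_scale[OF quad_ell2[OF assms]]]
      ell2_norm_scale ell2_inner_scale_right using M_pos by (simp add: norm_divide power_divide)
  also have "\<dots> \<le> ?n\<^sup>2 - 2 / M * (\<eta>\<^sup>2 * ?n\<^sup>2) + (\<beta> * ?n)\<^sup>2 / M\<^sup>2"
    using quad_coercive[OF assms] quad_norm[OF assms] M_pos
    by (intro add_mono diff_mono mult_left_mono divide_right_mono power_mono) auto
  also have "\<dots> = r\<^sup>2 * ?n\<^sup>2"
    unfolding r_bounds M_def using \<eta> \<beta>_pos by (simp add: field_simps eval_nat_numeral)
  finally have "(ell2_norm X (step f))\<^sup>2 \<le> (r * ?n)\<^sup>2" by (simp add: power_mult_distrib)
  then show ?thesis using r_bounds by (auto intro: power2_le_imp_le)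
qed

definition iter :: "('c \<Rightarrow> complex) \<Rightarrow> nat \<Rightarrow> 'c \<Rightarrow> complex" where
  "iter f k = (step ^^ k) f"

definition inverse_quad :: "'c operator" where
  "inverse_quad f = (\<lambda>x. of_real (1 / M) * (\<Sum>k. iter f k x))"

lemma iter_ell2: "f \<in> ell2 X \<Longrightarrow> iter f k \<in> ell2 X"
  unfolding iter_def by (induction k) (auto intro: step_ell2)

lemma iter_norm: "f \<in> ell2 X \<Longrightarrow> ell2_norm X (iter f k) \<le> r ^ k * ell2_norm X f"
proof (induction k)
  case (Suc k)
  have "ell2_norm X (iter f (Suc k)) \<le> r * ell2_norm X (iter f k)"
    unfolding iter_def funpow.simps o_def
    by (rule step_norm) (use iter_ell2[OF Suc.prems] iter_def in auto)
  also have "\<dots> \<le> r * (r ^ k * ell2_norm X f)"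
    using Suc r_bounds by (intro mult_left_mono) auto
  finally show ?case by (simp add: mult_ac)
qed (simp add: iter_def)

lemma summable_r: "summable (\<lambda>k. r ^ k * c)"
  using r_bounds by (intro summable_mult2 summable_geometric) auto

lemma iter_series:
  assumes "f \<in> ell2 X"
  shows "inverse_quad f \<in> ell2 X" "summable (\<lambda>k. iter f k x)"
    and "ell2_norm X (\<lambda>x. inverse_quad f x - of_real (1 / M) * (\<Sum>k<n. iter f k x))
      \<le> ell2_norm X f / (M * (1 - r)) * r ^ n"
proof -
  note series = ell2_absolutely_convergent_series[of "iter f" X "\<lambda>k. r ^ k * ell2_norm X f",
      OF iter_ell2[OF assms] iter_norm[OF assms] summable_r]
  show "inverse_quad f \<in> ell2 X" unfolding inverse_quad_def by (rule ell2_scale[OF series(1)])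
  show "summable (\<lambda>k. iter f k x)" by (rule series(2))
  have "(\<Sum>k. r ^ (k + n) * ell2_norm X f) = (\<Sum>k. r ^ k * (r ^ n * ell2_norm X f))"
    by (simp add: power_add mult_ac)
  also have "\<dots> = (1 / (1 - r)) * (r ^ n * ell2_norm X f)"
    using r_bounds by (subst suminf_mult2[symmetric]) (auto simp: suminf_geometric)
  finally have tail: "ell2_norm X (\<lambda>x. (\<Sum>k. iter f k x) - (\<Sum>k<n. iter f k x))
      \<le> (1 / (1 - r)) * (r ^ n * ell2_norm X f)" using series(3)[of n] by simp
  have "ell2_norm X (\<lambda>x. inverse_quad f x - of_real (1 / M) * (\<Sum>k<n. iter f k x))
      = (1 / M) * ell2_norm X (\<lambda>x. (\<Sum>k. iter f k x) - (\<Sum>k<n. iter f k x))"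
    using M_pos ell2_norm_scale[of X "of_real (1 / M)" "\<lambda>x. (\<Sum>k. iter f k x) - (\<Sum>k<n. iter f k x)"]
    by (simp add: inverse_quad_def right_diff_distrib norm_divide)
  also have "\<dots> \<le> (1 / M) * ((1 / (1 - r)) * (r ^ n * ell2_norm X f))"
    by (rule mult_left_mono[OF tail]) (use M_pos in auto)
  finally show "ell2_norm X (\<lambda>x. inverse_quad f x - of_real (1 / M) * (\<Sum>k<n. iter f k x))
      \<le> ell2_norm X f / (M * (1 - r)) * r ^ n" by (simp add: mult_ac)
qed

text \<open>The operator \<open>B\<close> is a finite combination of translations, so it may be applied term by term; the
  series then telescopes.\<close>

lemma quad_inverse_quad:
  assumes "f \<in> ell2 X" shows "quad (inverse_quad f) = f"
proof
  fix x
  let ?U = "inverse_quad f" and ?b = "quad_elt G p E \<eta>"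
  note fin = group_algebraD(1)[OF quad_elt_group_algebra[OF p, of E \<eta>]]
  have qe: "quad h = \<pi> ?b h" if "h \<in> ell2 X" for h
    by (rule perm_op_quad_elt[symmetric]) (use that in \<open>simp add: ell2_outside\<close>)
  show "quad ?U x = f x"
  proof (cases "x \<in> X")
    case True
    have sm: "(\<lambda>k. iter f k y) sums (\<Sum>k. iter f k y)" for y
      using iter_series(2)[OF assms] by (rule summable_sums)
    have "(\<lambda>k. \<Sum>g\<in>supp ?b. ?b g * (of_real (1 / M) * iter f k (act (inv g) x)))
        sums (\<Sum>g\<in>supp ?b. ?b g * ?U (act (inv g) x))"
      unfolding inverse_quad_def by (intro sums_sum sums_mult sm)
    then have 1: "(\<lambda>k. of_real (1 / M) * quad (iter f k) x) sums quad ?U x"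
      using True by (simp add: qe iter_ell2 assms iter_series perm_op_def sum_distrib_left mult_ac)
    have "of_real (1 / M) * quad (iter f k) x = iter f k x - iter f (Suc k) x" for k
      using step_eq[OF iter_ell2[OF assms, of k]] by (simp add: iter_def)
    then have 2: "(\<lambda>k. iter f k x - iter f (Suc k) x) sums quad ?U x" using 1 by simp
    have "(\<lambda>k. iter f k x - iter f (Suc k) x) sums (iter f 0 x - 0)"
      by (rule telescope_sums') (rule summable_LIMSEQ_zero[OF iter_series(2)[OF assms]])
    from sums_unique2[OF 2 this] show ?thesis by (simp add: iter_def)
  qed (simp add: ell2_outside[OF assms] ell2_outside[OF quad_ell2[OF iter_series(1)[OF assms]]])
qed

lemma shifted_eq_zero:
  assumes f: "f \<in> ell2 X" and zero: "(\<lambda>x. \<pi> p f x - Complex E s * f x) = (\<lambda>x. 0)" and "s \<noteq> 0"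
  shows "f = (\<lambda>x. 0)"
proof -
  have "ell2_inner X f (\<lambda>x. \<pi> p f x - Complex E s * f x)
     = ell2_inner X f (\<pi> p f) - Complex E s * ell2_inner X f f"
    by (simp add: ell2_inner_diff_right f perm_op_ell2 p ell2_scale ell2_inner_scale_right)
  then have "ell2_inner X f (\<pi> p f) = Complex E s * ell2_inner X f f"
    unfolding zero by (simp add: ell2_inner_def)
  moreover have "Im (ell2_inner X f (\<pi> p f)) = 0"
    using ell2_inner_commute[of X "\<pi> p f" f] p_self_adjoint[OF f f]
    by (metis cnj.simps(2) neg_equal_zero)
  ultimately have "s * (ell2_norm X f)\<^sup>2 = 0" by (simp add: ell2_inner_self)
  then show ?thesis using assms(3) ell2_norm_eq_0[OF f] by simp
qed

lemma shifted_product: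
  assumes "f \<in> ell2 X" "s = \<eta> \<or> s = - \<eta>"
  shows "(\<lambda>x. \<pi> p (\<lambda>x. \<pi> p f x - Complex E (- s) * f x) x
      - Complex E s * (\<pi> p f x - Complex E (- s) * f x)) = quad f"
proof
  fix x
  have sq: "Complex E s * Complex E (- s) = of_real (E\<^sup>2 + \<eta>\<^sup>2)" "Complex E (- s) + Complex E s = of_real (2 * E)"
    using assms(2) by (auto simp: complex_eq_iff power2_eq_square)
  have "\<pi> p (\<lambda>x. \<pi> p f x - Complex E (- s) * f x) x - Complex E s * (\<pi> p f x - Complex E (- s) * f x)
    = \<pi> p (\<pi> p f) x - (Complex E (- s) + Complex E s) * \<pi> p f x + (Complex E s * Complex E (- s)) * f x"
    unfolding perm_op_diff_right perm_op_scale_right by (simp add: algebra_simps)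
  also have "\<dots> = quad f x"
    unfolding sq quad_def shifted_def perm_op_diff_right perm_op_scale_right
    by (simp add: algebra_simps power2_eq_square)
  finally show "\<pi> p (\<lambda>x. \<pi> p f x - Complex E (- s) * f x) x
      - Complex E s * (\<pi> p f x - Complex E (- s) * f x) = quad f x" .
qed

text \<open>From \<open>(P - z)(P - \<bar>z\<bar>) = B\<close> one gets \<open>R\<^sup>z = (P - \<bar>z\<bar>)B\<^sup>-\<^sup>1\<close>.  Both signs of the imaginary part are treated,
  because the adjoint of \<open>R\<^sup>z\<close> is the resolvent at \<open>\<bar>z\<bar>\<close>.\<close>

lemma resolvent_eq:
  assumes f: "f \<in> ell2 X" and s: "s = \<eta> \<or> s = - \<eta>"
  shows "resolvent X (\<pi> p) (Complex E s) f
      = (\<lambda>x. \<pi> p (inverse_quad f) x - Complex E (- s) * inverse_quad f x)" (is "_ = ?R f")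
proof -
  let ?A = "\<lambda>f x. \<pi> p f x - Complex E s * f x"
  have R: "?R f \<in> ell2 X" using f by (intro ell2_diff ell2_scale perm_op_ell2 p iter_series)
  have "?A (?R f) = f"
    using shifted_product[OF iter_series(1)[OF f] s] quad_inverse_quad[OF f] by simp
  moreover have "inj_on ?A (ell2 X)"
  proof (rule inj_onI)
    fix u v assume u: "u \<in> ell2 X" and v: "v \<in> ell2 X" and eq: "?A u = ?A v"
    have "(\<lambda>x. \<pi> p (\<lambda>x. u x - v x) x - Complex E s * (u x - v x)) = (\<lambda>x. 0)"
      using fun_cong[OF eq] by (auto simp: perm_op_diff_right algebra_simps)
    then have "(\<lambda>x. u x - v x) = (\<lambda>x. 0)"
      by (rule shifted_eq_zero[OF ell2_diff[OF u v]]) (use s \<eta> in auto)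
    then show "u = v" by (auto simp: fun_eq_iff)
  qed
  ultimately show ?thesis
    unfolding resolvent_def using inv_into_f_f[OF _ R, of ?A] by metis
qed

lemma resolvent_ell2:
  assumes "f \<in> ell2 X" "s = \<eta> \<or> s = - \<eta>" shows "resolvent X (\<pi> p) (Complex E s) f \<in> ell2 X"
  unfolding resolvent_eq[OF assms] using assms by (intro ell2_diff ell2_scale perm_op_ell2 p iter_series)

lemma resolvent_right_inverse:
  assumes "f \<in> ell2 X" "s = \<eta> \<or> s = - \<eta>"
  shows "(\<lambda>x. \<pi> p (resolvent X (\<pi> p) (Complex E s) f) x - Complex E s * resolvent X (\<pi> p) (Complex E s) f x) = f"
  unfolding resolvent_eq[OF assms]
  using shifted_product[OF iter_series(1)[OF assms(1)] assms(2)] quad_inverse_quad[OF assms(1)] by simp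

lemma resolvent_adjoint:
  assumes f: "f \<in> ell2 X"
  shows "op_adjoint X (resolvent X (\<pi> p) (Complex E \<eta>)) f = resolvent X (\<pi> p) (Complex E (- \<eta>)) f"
proof -
  let ?R = "resolvent X (\<pi> p) (Complex E \<eta>)" and ?u = "resolvent X (\<pi> p) (Complex E (- \<eta>)) f"
  have u: "?u \<in> ell2 X" by (rule resolvent_ell2[OF f]) simp
  have adj: "ell2_inner X ?u k = ell2_inner X f (?R k)" if k: "k \<in> ell2 X" for k
  proof -
    let ?w = "?R k"
    have w: "?w \<in> ell2 X" by (rule resolvent_ell2[OF k]) simp
    have "ell2_inner X ?u k = ell2_inner X ?u (\<lambda>x. \<pi> p ?w x - Complex E \<eta> * ?w x)"
      using resolvent_right_inverse[OF k, of \<eta>] by simp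
    also have "\<dots> = ell2_inner X (\<lambda>x. \<pi> p ?u x - Complex E (- \<eta>) * ?u x) ?w"
    proof -
      have "cnj (Complex E (- \<eta>)) = Complex E \<eta>" by (simp add: complex_eq_iff)
      then show ?thesis
        by (simp add: ell2_inner_diff_right ell2_inner_diff_left u w perm_op_ell2 p ell2_scale
            ell2_inner_scale_right ell2_inner_scale_left p_self_adjoint)
    qed
    also have "\<dots> = ell2_inner X f ?w" using resolvent_right_inverse[OF f, of "- \<eta>"] by simp
    finally show ?thesis .
  qed
  show ?thesis unfolding op_adjoint_def
  proof (rule the_equality)
    show "?u \<in> ell2 X \<and> (\<forall>k\<in>ell2 X. ell2_inner X ?u k = ell2_inner X f (?R k))" using u adj by blast
    fix h assume h: "h \<in> ell2 X \<and> (\<forall>k\<in>ell2 X. ell2_inner X h k = ell2_inner X f (?R k))"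
    show "h = ?u"
    proof
      fix x show "h x = ?u x"
      proof (cases "x \<in> X")
        case True
        then have "ell2_inner X h (delta x) = ell2_inner X ?u (delta x)" using h adj by simp
        then have "cnj (ell2_inner X (delta x) h) = cnj (ell2_inner X (delta x) ?u)"
          using ell2_inner_commute by metis
        then show ?thesis using True by (simp add: ell2_inner_delta)
      qed (use h u ell2_outside in metis)
    qed
  qed
qed

text \<open>The difference of the two resolvents is \<open>2i\<eta> B\<^sup>-\<^sup>1\<close>; so the imaginary part is \<open>\<eta>/((P - E)\<^sup>2 + \<eta>\<^sup>2)\<close>, the
  Lorentzian of \<open>P\<close>.\<close>

lemma op_Im_resolvent:
  assumes f: "f \<in> ell2 X"
  shows "op_Im X (resolvent X (\<pi> p) (Complex E \<eta>)) f = (\<lambda>x. of_real \<eta> * inverse_quad f x)"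
proof -
  have "Complex E \<eta> - Complex E (- \<eta>) = 2 * \<i> * of_real \<eta>" by (simp add: complex_eq_iff)
  then show ?thesis
    unfolding op_Im_def resolvent_adjoint[OF f]
    by (simp add: resolvent_eq[OF f] left_diff_distrib[symmetric])
qed

lemma op_coeff_Im_resolvent:
  assumes "x \<in> X" "y \<in> X"
  shows "op_coeff X (op_Im X (resolvent X (\<pi> p) (Complex E \<eta>))) x y
      = of_real \<eta> * cnj (inverse_quad (delta x) y)"
proof -
  let ?U = "inverse_quad (delta x)" and ?V = "inverse_quad (delta y)"
  have U: "?U \<in> ell2 X" "?V \<in> ell2 X" using assms by (auto intro: iter_series)
  have "?V x = ell2_inner X (quad ?U) ?V" using assms by (simp add: quad_inverse_quad ell2_inner_delta)
  also have "\<dots> = ell2_inner X ?U (delta y)" 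
    using quad_self_adjoint[OF U] assms by (simp add: quad_inverse_quad)
  also have "\<dots> = cnj (?U y)" using assms by (subst ell2_inner_commute) (simp add: ell2_inner_delta)
  finally show ?thesis
    using assms by (simp add: op_coeff_def op_Im_resolvent ell2_inner_delta)
qed

lemma Im_resolvent_diagonal:
  assumes "x \<in> X"
  shows "Im (op_coeff X (op_Im X (resolvent X (\<pi> p) (Complex E \<eta>))) x x) = 0"
proof -
  let ?U = "inverse_quad (delta x)"
  have U: "?U \<in> ell2 X" using assms by (auto intro: iter_series)
  have "?U x = ell2_inner X ?U (quad ?U)"
    using assms quad_self_adjoint[OF U U] by (simp add: quad_inverse_quad flip: ell2_inner_delta[OF assms])
  also have "\<dots> = of_real ((ell2_norm X (shifted ?U))\<^sup>2 + \<eta>\<^sup>2 * (ell2_norm X ?U)\<^sup>2)"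
    by (simp add: quad_inner[OF U U] ell2_inner_self)
  finally have "Im (?U x) = 0" by (metis Im_complex_of_real)
  then show ?thesis using assms by (simp add: op_coeff_Im_resolvent)
qed

end

text \<open>The same Neumann sums inside the group algebra.  They are polynomials in \<open>p\<close>, so they can be evaluated
  in every permutation representation; on an eigenvector they act as \<open>neumann_scalar\<close>.\<close>

definition neumann_iter ::
  "('a, 'b) monoid_scheme \<Rightarrow> ('a \<Rightarrow> complex) \<Rightarrow> real \<Rightarrow> real \<Rightarrow> real \<Rightarrow> nat \<Rightarrow> 'a \<Rightarrow> complex" where
  "neumann_iter G p E \<eta> M k = (left_regular G (neumann_elt G p E \<eta> M) ^^ k) (delta \<one>\<^bsub>G\<^esub>)"

definition neumann_sum ::
  "('a, 'b) monoid_scheme \<Rightarrow> ('a \<Rightarrow> complex) \<Rightarrow> real \<Rightarrow> real \<Rightarrow> real \<Rightarrow> nat \<Rightarrow> 'a \<Rightarrow> complex" where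
  "neumann_sum G p E \<eta> M n = (\<lambda>g. of_real (\<eta> / M) * (\<Sum>k<n. neumann_iter G p E \<eta> M k g))"

definition neumann_scalar :: "real \<Rightarrow> real \<Rightarrow> real \<Rightarrow> nat \<Rightarrow> real \<Rightarrow> real" where
  "neumann_scalar E \<eta> M n x = \<eta> / M * (\<Sum>k<n. (1 - ((x - E)\<^sup>2 + \<eta>\<^sup>2) / M) ^ k)"

lemma (in group) neumann_iter_group_algebra:
  "p \<in> group_algebra G \<Longrightarrow> neumann_iter G p E \<eta> M k \<in> group_algebra G"
  unfolding neumann_iter_def
  by (induction k) (auto intro: left_regular_group_algebra neumann_elt_group_algebra delta_group_algebra)

lemma (in group) neumann_sum_group_algebra:
  "p \<in> group_algebra G \<Longrightarrow> neumann_sum G p E \<eta> M n \<in> group_algebra G"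
  unfolding neumann_sum_def
  by (intro group_algebra_scale group_algebra_sum neumann_iter_group_algebra) auto

lemma (in finitely_generated) wl_supp_bound:
  assumes "q \<in> group_algebra G" obtains D where "\<And>g. g \<in> supp q \<Longrightarrow> wl g \<le> D"
proof
  show "wl g \<le> Max (wl ` supp q)" if "g \<in> supp q" for g
    using that group_algebraD(1)[OF assms] by auto
qed

lemma (in finitely_generated) neumann_iter_wl:
  assumes p: "p \<in> group_algebra G" and D: "\<And>g. g \<in> supp (neumann_elt G p E \<eta> M) \<Longrightarrow> wl g \<le> D"
  shows "g \<in> supp (neumann_iter G p E \<eta> M k) \<Longrightarrow> wl g \<le> D * k"
proof (induction k arbitrary: g)
  case 0
  then show ?case by (simp add: neumann_iter_def supp_def delta_def split: if_splits)
next
  case (Suc k)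
  have "neumann_iter G p E \<eta> M (Suc k)
      = left_regular G (neumann_elt G p E \<eta> M) (neumann_iter G p E \<eta> M k)"
    by (simp add: neumann_iter_def)
  with Suc.prems supp_left_regular[OF neumann_elt_group_algebra[OF p] neumann_iter_group_algebra[OF p]]
  obtain a b where ab: "g = a \<otimes> b" "a \<in> supp (neumann_elt G p E \<eta> M)" "b \<in> supp (neumann_iter G p E \<eta> M k)"
    by fastforce
  have "wl g \<le> wl a + wl b"
    using ab group_algebraD(2)[OF neumann_elt_group_algebra[OF p]]
      group_algebraD(2)[OF neumann_iter_group_algebra[OF p]] by (auto intro: wl_mult)
  then show ?case using D[OF ab(2)] Suc.IH[OF ab(3)] by simp
qed

context neumann
begin

lemma perm_op_neumann_iter: "f \<in> ell2 X \<Longrightarrow> \<pi> (neumann_iter G p E \<eta> M k) f = iter f k"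
proof (induction k)
  case 0
  then show ?case by (simp add: neumann_iter_def iter_def perm_op_delta_one ell2_outside)
next
  case (Suc k)
  have "\<pi> (neumann_iter G p E \<eta> M (Suc k)) f = step (\<pi> (neumann_iter G p E \<eta> M k) f)"
    using perm_op_mult[OF neumann_elt_group_algebra[OF p] neumann_iter_group_algebra[OF p]]
    by (simp add: neumann_iter_def)
  then show ?case using Suc by (simp add: iter_def)
qed

lemma perm_op_neumann_sum:
  assumes "f \<in> ell2 X"
  shows "\<pi> (neumann_sum G p E \<eta> M n) f = (\<lambda>x. of_real (\<eta> / M) * (\<Sum>k<n. iter f k x))"
proof -
  have "\<pi> (neumann_sum G p E \<eta> M n) f
      = (\<lambda>x. of_real (\<eta> / M) * \<pi> (\<lambda>g. \<Sum>k<n. neumann_iter G p E \<eta> M k g) f x)"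
    unfolding neumann_sum_def
    by (rule perm_op_scale) (intro group_algebra_sum neumann_iter_group_algebra p finite_lessThan)
  also have "\<pi> (\<lambda>g. \<Sum>k<n. neumann_iter G p E \<eta> M k g) f = (\<lambda>x. \<Sum>k<n. \<pi> (neumann_iter G p E \<eta> M k) f x)"
    by (rule perm_op_sum) (auto intro: neumann_iter_group_algebra p)
  finally show ?thesis using perm_op_neumann_iter[OF assms] by simp
qed

text \<open>The norm bound \<open>\<beta>\<close>, applied to the eigenvector itself, places \<open>1 - b/M\<close> in \<open>[0, r]\<close>, where
  \<open>b = (l - E)\<^sup>2 + \<eta>\<^sup>2\<close>; the truncated geometric series is then the Lorentzian times \<open>1 - (1 - b/M)\<^sup>n\<close>.\<close>

lemma eigenvector:
  assumes \<phi>: "\<phi> \<in> ell2 X" "\<phi> \<noteq> (\<lambda>x. 0)" and eig: "\<pi> p \<phi> = (\<lambda>x. of_real l * \<phi> x)"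
  shows "\<pi> (neumann_sum G p E \<eta> M n) \<phi> = (\<lambda>x. of_real (neumann_scalar E \<eta> M n l) * \<phi> x)"
    and "neumann_scalar E \<eta> M n l \<le> \<eta> / ((l - E)\<^sup>2 + \<eta>\<^sup>2)"
    and "\<eta> / ((l - E)\<^sup>2 + \<eta>\<^sup>2) * (1 - r ^ n) \<le> neumann_scalar E \<eta> M n l"
proof -
  let ?b = "(l - E)\<^sup>2 + \<eta>\<^sup>2"
  have "shifted \<phi> = (\<lambda>x. of_real (l - E) * \<phi> x)"
    by (simp add: shifted_def eig algebra_simps)
  then have sh: "shifted (shifted \<phi>) = (\<lambda>x. of_real (l - E) * (of_real (l - E) * \<phi> x))"
    unfolding shifted_def by (simp only: perm_op_scale_right eig) (simp add: algebra_simps)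
  have quad: "quad \<phi> = (\<lambda>x. of_real ?b * \<phi> x)"
    unfolding quad_def sh by (simp add: algebra_simps power2_eq_square)
  have aux: "of_real c * (y - of_real (1 / M) * (of_real B * y)) = of_real ((1 - B / M) * c) * y"
    for c B and y :: complex by (simp add: algebra_simps)
  have it: "iter \<phi> k = (\<lambda>x. of_real ((1 - ?b / M) ^ k) * \<phi> x)" for k
  proof (induction k)
    case (Suc k)
    have "iter \<phi> (Suc k) = step (\<lambda>x. of_real ((1 - ?b / M) ^ k) * \<phi> x)"
      using Suc by (simp add: iter_def)
    also have "\<dots> = (\<lambda>x. of_real ((1 - ?b / M) ^ k) * step \<phi> x)" by (rule perm_op_scale_right)
    also have "\<dots> = (\<lambda>x. of_real ((1 - ?b / M) ^ Suc k) * \<phi> x)"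
      unfolding step_eq[OF \<phi>(1)] quad power_Suc aux ..
    finally show ?case .
  qed (simp add: iter_def)
  show "\<pi> (neumann_sum G p E \<eta> M n) \<phi> = (\<lambda>x. of_real (neumann_scalar E \<eta> M n l) * \<phi> x)"
    unfolding perm_op_neumann_sum[OF \<phi>(1)] it neumann_scalar_def
    by (simp add: sum_distrib_right sum_distrib_left mult_ac)
  have b0: "0 < ?b" using \<eta> by (simp add: add_nonneg_pos)
  have norm: "ell2_norm X \<phi> > 0"
    using ell2_norm_eq_0[OF \<phi>(1)] \<phi>(2) ell2_norm_nonneg[of X \<phi>] by linarith
  have "?b * ell2_norm X \<phi> \<le> \<beta> * ell2_norm X \<phi>"
    using quad_norm[OF \<phi>(1)] b0 unfolding quad ell2_norm_scale norm_of_real by simp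
  then have b\<beta>: "?b \<le> \<beta>" using norm by simp
  have low: "\<eta> ^ 4 / \<beta>\<^sup>2 \<le> ?b / M"
  proof -
    have "\<eta>\<^sup>2 / M \<le> ?b / M" using M_pos by (intro divide_right_mono) auto
    moreover have "\<eta>\<^sup>2 / M = \<eta> ^ 4 / \<beta>\<^sup>2"
      using \<eta> \<beta>_pos by (simp add: M_def field_simps eval_nat_numeral)
    ultimately show ?thesis by simp
  qed
  have up: "?b / M \<le> 1"
  proof -
    have "?b * \<eta>\<^sup>2 \<le> \<beta> * \<beta>" using b\<beta> \<beta>_gt b0 \<eta> by (intro mult_mono) auto
    then show ?thesis using \<eta> \<beta>_pos by (simp add: M_def field_simps power2_eq_square)
  qed
  let ?c = "1 - ?b / M"
  have c: "0 \<le> ?c" "?c \<noteq> 1" using up b0 M_pos by auto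
  have "?c \<le> 1 - \<eta> ^ 4 / \<beta>\<^sup>2" using low by simp
  also have "\<dots> = r * r" using r_bounds(3) by (simp add: power2_eq_square)
  also have "\<dots> \<le> r" using r_bounds mult_left_le[of r r] by simp
  finally have cr: "?c ^ n \<le> r ^ n" using c by (intro power_mono) auto
  have eq: "neumann_scalar E \<eta> M n l = \<eta> / ?b * (1 - ?c ^ n)"
    unfolding neumann_scalar_def sum_gp_strict using c(2) b0 M_pos by (simp add: field_simps)
  show "neumann_scalar E \<eta> M n l \<le> \<eta> / ?b"
    unfolding eq using c b0 \<eta> by (intro mult_left_le) auto
  show "\<eta> / ?b * (1 - r ^ n) \<le> neumann_scalar E \<eta> M n l"
    unfolding eq using cr b0 \<eta> by (intro mult_left_mono) auto
qed

end

text \<open>The interface between the resolvent on \<open>\<ell>\<^sup>2(\<Gamma>)\<close> and the matrices \<open>\<rho>\<^sub>N(p)\<close>.  The error is measured in \<open>\<ell>\<^sup>2\<close> and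
  decays exponentially, while supports grow only linearly in word length; hence the error stays
  small after multiplication by any power of the length.\<close>

lemma (in finitely_generated) resolvent_approximation:
  assumes p: "p \<in> group_algebra G" and p_star: "p = ga_star G p" and \<eta>: "0 < \<eta>"
  obtains q :: "nat \<Rightarrow> 'a \<Rightarrow> complex" and qs :: "nat \<Rightarrow> real \<Rightarrow> real" and r L :: real and D :: nat
  where "0 < r" "r < 1" "0 \<le> L"
    and "\<And>n. q n \<in> group_algebra G"
    and "\<And>n F. finite F \<Longrightarrow> F \<subseteq> carrier G \<Longrightarrow>
        L2_set (\<lambda>g. cmod (q n g - cnj (ImR G p (Complex E \<eta>) \<one> g))) F \<le> L * r ^ n"
    and "\<And>n g. g \<in> supp (q n) \<Longrightarrow> wl g \<le> D * n"
    and "\<And>n (X :: nat set) act \<phi> l. perm_action G X act \<Longrightarrow> \<phi> \<in> ell2 X \<Longrightarrow> \<phi> \<noteq> (\<lambda>x. 0) \<Longrightarrow>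
        perm_op G X act p \<phi> = (\<lambda>x. of_real l * \<phi> x) \<Longrightarrow>
        perm_op G X act (q n) \<phi> = (\<lambda>x. of_real (qs n l) * \<phi> x) \<and>
        qs n l \<le> \<eta> / ((l - E)\<^sup>2 + \<eta>\<^sup>2) \<and> \<eta> / ((l - E)\<^sup>2 + \<eta>\<^sup>2) * (1 - r ^ n) \<le> qs n l"
    and "Im (ImR G p (Complex E \<eta>) \<one> \<one>) = 0"
proof -
  define \<beta> where "\<beta> = (\<Sum>g\<in>supp (quad_elt G p E \<eta>). cmod (quad_elt G p E \<eta> g)) + \<eta>\<^sup>2 + 1"
  have \<beta>: "(\<Sum>g\<in>supp (quad_elt G p E \<eta>). cmod (quad_elt G p E \<eta> g)) \<le> \<beta>" "\<eta>\<^sup>2 < \<beta>"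
    using sum_nonneg[of "supp (quad_elt G p E \<eta>)" "\<lambda>g. cmod (quad_elt G p E \<eta> g)"]
    by (auto simp: \<beta>_def add_nonneg_pos)
  have neumann: "neumann G X act p E \<eta> \<beta>" if "perm_action G X act" for X :: "'z set" and act
    using that p p_star \<eta> \<beta>
    by (simp add: neumann_def self_adjoint_action_def self_adjoint_action_axioms_def neumann_axioms_def)
  interpret reg: neumann G "carrier G" "mult G" p E \<eta> \<beta> by (rule neumann[OF regular_action])
  have op: "perm_op G (carrier G) (mult G) = left_regular G"
    by (intro ext) (simp add: left_regular_eq_perm_op)
  have im: "ImR G p (Complex E \<eta>) \<one> g = of_real \<eta> * cnj (reg.inverse_quad (delta \<one>) g)"
    if "g \<in> carrier G" for g
    using reg.op_coeff_Im_resolvent[OF one_closed that] by (simp add: ImR_def op)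
  let ?q = "neumann_sum G p E \<eta> reg.M"
  obtain D where D: "\<And>g. g \<in> supp (neumann_elt G p E \<eta> reg.M) \<Longrightarrow> wl g \<le> D"
    using wl_supp_bound[OF neumann_elt_group_algebra[OF p]] by metis
  show thesis
  proof
    show "0 < reg.r" "reg.r < 1" by (rule reg.r_bounds)+
    show "0 \<le> \<eta> * (1 / (reg.M * (1 - reg.r)))" using \<eta> reg.M_pos reg.r_bounds by simp
    show "?q n \<in> group_algebra G" for n by (rule neumann_sum_group_algebra[OF p])
    show "L2_set (\<lambda>g. cmod (?q n g - cnj (ImR G p (Complex E \<eta>) \<one> g))) F
        \<le> \<eta> * (1 / (reg.M * (1 - reg.r))) * reg.r ^ n"
      if F: "finite F" "F \<subseteq> carrier G" for n F
    proof -
      let ?err = "\<lambda>x. reg.inverse_quad (delta \<one>) x - of_real (1 / reg.M) * (\<Sum>k<n. reg.iter (delta \<one>) k x)"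
      have it: "neumann_iter G p E \<eta> reg.M k = reg.iter (delta \<one>) k" for k
        by (simp add: neumann_iter_def reg.iter_def op)
      have "cmod (?q n g - cnj (ImR G p (Complex E \<eta>) \<one> g)) = \<eta> * cmod (?err g)" if "g \<in> F" for g
      proof -
        have "?q n g - cnj (ImR G p (Complex E \<eta>) \<one> g) = of_real (- \<eta>) * ?err g"
          using im[of g] that F by (auto simp: neumann_sum_def it algebra_simps)
        then show ?thesis using \<eta> by (simp only: norm_mult norm_of_real abs_minus_cancel abs_of_pos)
      qed
      then have "L2_set (\<lambda>g. cmod (?q n g - cnj (ImR G p (Complex E \<eta>) \<one> g))) F
          = L2_set (\<lambda>g. \<eta> * cmod (?err g)) F" by (intro L2_set_cong) auto
      also have "\<dots> = \<eta> * L2_set (\<lambda>g. cmod (?err g)) F"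
        using \<eta> by (simp add: L2_set_right_distrib)
      also have "\<dots> \<le> \<eta> * ell2_norm (carrier G) ?err"
        using F \<eta> by (intro mult_left_mono L2_set_le_ell2_norm ell2_diff ell2_scale ell2_sum)
          (auto intro: reg.iter_series reg.iter_ell2)
      also have "\<dots> \<le> \<eta> * (1 / (reg.M * (1 - reg.r)) * reg.r ^ n)"
        using reg.iter_series(3)[of "delta \<one>" n] \<eta> by (intro mult_left_mono) (auto simp: ell2_norm_delta)
      finally show ?thesis by simp
    qed
    show "wl g \<le> D * n" if g: "g \<in> supp (?q n)" for n g
    proof -
      from g have "(\<Sum>k<n. neumann_iter G p E \<eta> reg.M k g) \<noteq> 0" by (auto simp: supp_def neumann_sum_def)
      then obtain k where "k < n" "neumann_iter G p E \<eta> reg.M k g \<noteq> 0"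
        by (rule sum.not_neutral_contains_not_neutral) (simp only: lessThan_iff)
      then have "wl g \<le> D * k" using neumann_iter_wl[OF p D] by (simp add: supp_def)
      also have "\<dots> \<le> D * n" using \<open>k < n\<close> by simp
      finally show ?thesis .
    qed
    show "perm_op G X act (?q n) \<phi> = (\<lambda>x. of_real (neumann_scalar E \<eta> reg.M n l) * \<phi> x) \<and>
        neumann_scalar E \<eta> reg.M n l \<le> \<eta> / ((l - E)\<^sup>2 + \<eta>\<^sup>2) \<and>
        \<eta> / ((l - E)\<^sup>2 + \<eta>\<^sup>2) * (1 - reg.r ^ n) \<le> neumann_scalar E \<eta> reg.M n l"
      if "perm_action G X act" "\<phi> \<in> ell2 X" "\<phi> \<noteq> (\<lambda>x. 0)" "perm_op G X act p \<phi> = (\<lambda>x. of_real l * \<phi> x)"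
      for n and X :: "nat set" and act \<phi> l
    proof -
      interpret neumann G X act p E \<eta> \<beta> by (rule neumann[OF that(1)])
      have "M = reg.M" "r = reg.r" by (simp_all add: M_def reg.M_def r_def reg.r_def)
      then show ?thesis using eigenvector[OF that(2-4)] by simp
    qed
    show "Im (ImR G p (Complex E \<eta>) \<one> \<one>) = 0"
      using reg.Im_resolvent_diagonal[OF one_closed] by (simp add: ImR_def op)
  qed
qed

section \<open>Rapid decay\<close>

context group
begin

abbreviation "cayley S \<equiv> cayley_edges G S \<union> (cayley_edges G S)\<inverse>"

lemma cayley_path_generate:
  assumes "S \<subseteq> carrier G" "s \<in> generate G S"
  shows "\<exists>m. \<forall>g\<in>carrier G. (g, s \<otimes> g) \<in> cayley S ^^ m"
  using assms(2)
proof induction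
  case one
  show ?case by (rule exI[of _ 0]) auto
next
  case (incl h)
  then show ?case by (intro exI[of _ "Suc 0"]) (auto simp: cayley_edges_def)
next
  case (inv h)
  have "(inv h \<otimes> g, g) \<in> cayley_edges G S" if "g \<in> carrier G" for g
  proof -
    have "h \<in> carrier G" using assms(1) inv by blast
    then have "inv h \<otimes> g \<in> carrier G" "g = h \<otimes> (inv h \<otimes> g)" using that by (auto simp: m_assoc[symmetric])
    then show ?thesis using inv unfolding cayley_edges_def by blast
  qed
  then show ?case by (intro exI[of _ "Suc 0"]) auto
next
  case (eng h1 h2)
  then obtain m1 m2 where m: "\<forall>g\<in>carrier G. (g, h1 \<otimes> g) \<in> cayley S ^^ m1"
    "\<forall>g\<in>carrier G. (g, h2 \<otimes> g) \<in> cayley S ^^ m2" by blast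
  have h: "h1 \<in> carrier G" "h2 \<in> carrier G" using eng assms(1) generate_in_carrier by auto
  have "(g, h1 \<otimes> h2 \<otimes> g) \<in> cayley S ^^ (m2 + m1)" if "g \<in> carrier G" for g
    unfolding relpow_add using m h that by (auto simp: m_assoc intro!: relcompI[of _ "h2 \<otimes> g"])
  then show ?case by blast
qed

end

context finitely_generated
begin

text \<open>A word in \<open>S\<close> is rewritten in \<open>S'\<close> letter by letter, each letter costing at most \<open>\<kappa>\<close> edges.  This matters because
  rapid decay and the condition on the resolvent may refer to different generating sets.\<close>

lemma cayley_dist_le:
  assumes "finite_generating_set G S'"
  obtains \<kappa> :: nat where "1 \<le> \<kappa>"
    "\<And>g h. g \<in> carrier G \<Longrightarrow> h \<in> carrier G \<Longrightarrow> cayley_dist G S' g h \<le> \<kappa> * (wl g + wl h)"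
proof -
  have S': "S' \<subseteq> carrier G" "generate G S' = carrier G"
    using assms by (auto simp: finite_generating_set_def)
  have "\<forall>s\<in>letters. \<exists>m. \<forall>g\<in>carrier G. (g, s \<otimes> g) \<in> cayley S' ^^ m"
    using cayley_path_generate[OF S'(1)] S'(2) letters_carrier by blast
  then obtain m where m: "\<And>s g. s \<in> letters \<Longrightarrow> g \<in> carrier G \<Longrightarrow> (g, s \<otimes> g) \<in> cayley S' ^^ m s"
    by metis
  define \<kappa> where "\<kappa> = Suc (\<Sum>s\<in>letters. m s)"
  have fin: "finite letters" using gen by (auto simp: finite_generating_set_def)
  have m_le: "m s \<le> \<kappa>" if "s \<in> letters" for s
    using member_le_sum[OF that _ fin, of m] by (simp add: \<kappa>_def)
  have word: "\<exists>n\<le>\<kappa> * length ws. \<forall>g\<in>carrier G. (g, word_prod ws \<otimes> g) \<in> cayley S' ^^ n"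
    if "set ws \<subseteq> letters" for ws
    using that
  proof (induction ws)
    case Nil
    then show ?case by (intro exI[of _ 0]) auto
  next
    case (Cons a ws)
    then obtain n where n: "n \<le> \<kappa> * length ws" "\<forall>g\<in>carrier G. (g, word_prod ws \<otimes> g) \<in> cayley S' ^^ n"
      by auto
    have ws: "word_prod ws \<in> carrier G" "a \<in> carrier G" "a \<in> letters"
      using Cons.prems word_prod_closed letters_carrier by auto
    have "(g, word_prod (a # ws) \<otimes> g) \<in> cayley S' ^^ (n + m a)" if "g \<in> carrier G" for g
      unfolding relpow_add using n(2) m[OF ws(3), of "word_prod ws \<otimes> g"] ws that
      by (auto simp: m_assoc intro!: relcompI[of _ "word_prod ws \<otimes> g"])
    then show ?case using n(1) m_le[OF ws(3)] by (intro exI[of _ "n + m a"]) auto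
  qed
  show thesis
  proof
    show "1 \<le> \<kappa>" by (simp add: \<kappa>_def)
    fix g h assume g: "g \<in> carrier G" and h: "h \<in> carrier G"
    have hg: "h \<otimes> inv g \<in> carrier G" using g h by simp
    obtain ws where ws: "length ws = wl (h \<otimes> inv g)" "set ws \<subseteq> letters" "word_prod ws = h \<otimes> inv g"
      by (rule wl_word[OF hg])
    obtain n where n: "n \<le> \<kappa> * length ws" "(g, h \<otimes> inv g \<otimes> g) \<in> cayley S' ^^ n"
      using word[OF ws(2)] ws(3) g by auto
    then have "(g, h) \<in> cayley S' ^^ n" using g h by (simp add: m_assoc)
    then have "cayley_dist G S' g h \<le> n" unfolding cayley_dist_def by (rule Least_le)
    also have "\<dots> \<le> \<kappa> * (wl g + wl h)"
      using n(1) ws(1) wl_mult[of h "inv g"] g h order_trans[OF n(1) mult_le_mono2] by (simp add: add.commute)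
    finally show "cayley_dist G S' g h \<le> \<kappa> * (wl g + wl h)" .
  qed
qed

lemma rapid_decay_ball:
  assumes "rapid_decay G C\<^sub>1"
  obtains K where "0 < K" "0 < C\<^sub>1"
    "\<And>q f k. q \<in> group_algebra G \<Longrightarrow> f \<in> ell2 (carrier G) \<Longrightarrow> (\<And>g. g \<in> supp q \<Longrightarrow> wl g \<le> k) \<Longrightarrow>
      ell2_norm (carrier G) (left_regular G q f)
        \<le> K * (1 + real k) powr C\<^sub>1 * ell2_norm (carrier G) q * ell2_norm (carrier G) f"
proof -
  obtain S' C where S': "finite_generating_set G S'" and C: "C > 0" "C\<^sub>1 > 0" and
    rd: "\<And>q. q \<in> group_algebra G \<Longrightarrow> op_norm (carrier G) (left_regular G q)
             \<le> ennreal (C * real (ga_diam G S' q) powr C\<^sub>1 * ell2_norm (carrier G) q)"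
    using assms unfolding rapid_decay_def by blast
  obtain \<kappa> where \<kappa>: "1 \<le> \<kappa>"
    "\<And>g h. g \<in> carrier G \<Longrightarrow> h \<in> carrier G \<Longrightarrow> cayley_dist G S' g h \<le> \<kappa> * (wl g + wl h)"
    using cayley_dist_le[OF S'] by metis
  show thesis
  proof
    show "0 < C * (2 * real \<kappa>) powr C\<^sub>1" using C \<kappa> by simp
    show "0 < C\<^sub>1" by fact
    fix q f k
    assume q: "q \<in> group_algebra G" and f: "f \<in> ell2 (carrier G)" and k: "\<And>g. g \<in> supp q \<Longrightarrow> wl g \<le> k"
    have "ga_diam G S' q \<le> 2 * \<kappa> * (1 + k)"
      unfolding ga_diam_def
    proof (rule Max.boundedI)
      have "{cayley_dist G S' g h | g h. g \<in> supp q \<and> h \<in> supp q}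
          = (\<lambda>(g, h). cayley_dist G S' g h) ` (supp q \<times> supp q)" by auto
      then show "finite (insert 1 {cayley_dist G S' g h | g h. g \<in> supp q \<and> h \<in> supp q})"
        using group_algebraD(1)[OF q] by simp
      fix a assume "a \<in> insert 1 {cayley_dist G S' g h | g h. g \<in> supp q \<and> h \<in> supp q}"
      then consider "a = 1" | g h where "a = cayley_dist G S' g h" "g \<in> supp q" "h \<in> supp q" by blast
      then show "a \<le> 2 * \<kappa> * (1 + k)"
      proof cases
        case 1
        then show ?thesis using \<kappa>(1) by (simp add: Suc_le_eq)
      next
        case 2
        then have "a \<le> \<kappa> * (wl g + wl h)" using \<kappa>(2) group_algebraD(2)[OF q] by blast
        also have "\<dots> \<le> \<kappa> * (k + k)" using k 2 by (intro mult_le_mono2 add_mono) auto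
        finally show ?thesis by (simp add: algebra_simps)
      qed
    qed simp
    then have "real (ga_diam G S' q) \<le> real (2 * \<kappa> * (1 + k))" by (rule of_nat_mono)
    then have "real (ga_diam G S' q) \<le> 2 * real \<kappa> * (1 + real k)" by (simp add: distrib_left)
    then have "real (ga_diam G S' q) powr C\<^sub>1 \<le> (2 * real \<kappa>) powr C\<^sub>1 * (1 + real k) powr C\<^sub>1"
      using C(2) by (subst powr_mult[symmetric]) (auto intro: powr_mono2)
    then have diam: "C * real (ga_diam G S' q) powr C\<^sub>1 * ell2_norm (carrier G) q
        \<le> C * ((2 * real \<kappa>) powr C\<^sub>1 * (1 + real k) powr C\<^sub>1) * ell2_norm (carrier G) q"
      using C(1) by (intro mult_right_mono mult_left_mono) auto
    have "ell2_norm (carrier G) (left_regular G q f)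
        \<le> C * real (ga_diam G S' q) powr C\<^sub>1 * ell2_norm (carrier G) q * ell2_norm (carrier G) f"
    proof (rule op_norm_bound[OF rd[OF q]])
      show "0 \<le> C * real (ga_diam G S' q) powr C\<^sub>1 * ell2_norm (carrier G) q" using C by simp
      show "left_regular G q (\<lambda>x. a * f x) = (\<lambda>x. a * left_regular G q f x)" for a f
        unfolding left_regular_eq_perm_op
        by (rule perm_action.perm_op_scale_right[OF regular_action])
    qed (rule f)
    also have "\<dots> \<le> C * ((2 * real \<kappa>) powr C\<^sub>1 * (1 + real k) powr C\<^sub>1) * ell2_norm (carrier G) q * ell2_norm (carrier G) f"
      by (rule mult_right_mono[OF diam]) simp
    finally show "ell2_norm (carrier G) (left_regular G q f)
        \<le> C * (2 * real \<kappa>) powr C\<^sub>1 * (1 + real k) powr C\<^sub>1 * ell2_norm (carrier G) q * ell2_norm (carrier G) f"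
      by (simp add: mult_ac)
  qed
qed

text \<open>Cut \<open>A\<close> into spheres of the word length, apply rapid decay to each, and sum by Cauchy-Schwarz against
  \<open>(1 + k)\<close> to the power \<open>2C\<^sub>1 - c\<close>, which is summable exactly when \<open>c > 2C\<^sub>1 + 1\<close>.\<close>

lemma rapid_decay_weighted:
  assumes rd: "rapid_decay G C\<^sub>1" and c: "2 * C\<^sub>1 + 1 < c"
  obtains K where "0 < K"
    "\<And>A f. A \<in> group_algebra G \<Longrightarrow> f \<in> ell2 (carrier G) \<Longrightarrow>
      ell2_norm (carrier G) (left_regular G A f)
        \<le> K * sqrt (\<Sum>g\<in>supp A. (1 + real (wl g)) powr c * (cmod (A g))\<^sup>2) * ell2_norm (carrier G) f"
proof -
  obtain K where K: "0 < K" "0 < C\<^sub>1" and ball: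
    "\<And>q f k. q \<in> group_algebra G \<Longrightarrow> f \<in> ell2 (carrier G) \<Longrightarrow> (\<And>g. g \<in> supp q \<Longrightarrow> wl g \<le> k) \<Longrightarrow>
      ell2_norm (carrier G) (left_regular G q f)
        \<le> K * (1 + real k) powr C\<^sub>1 * ell2_norm (carrier G) q * ell2_norm (carrier G) f"
    using rapid_decay_ball[OF rd] by metis
  define a where "a k = (1 + real k) powr (C\<^sub>1 - c / 2)" for k
  have a2: "(a k)\<^sup>2 = real (Suc k) powr (2 * C\<^sub>1 - c)" for k
  proof -
    have "C\<^sub>1 - c / 2 + (C\<^sub>1 - c / 2) = 2 * C\<^sub>1 - c" by simp
    then show ?thesis unfolding a_def power2_eq_square powr_add[symmetric] by simp
  qed
  have sm: "summable (\<lambda>k. (a k)\<^sup>2)"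
    unfolding a2 by (subst summable_Suc_iff) (use c in \<open>simp add: summable_real_powr_iff\<close>)
  define Z where "Z = sqrt (\<Sum>k. (a k)\<^sup>2)"
  have Z: "0 < Z"
    unfolding Z_def real_sqrt_gt_0_iff by (rule suminf_pos[OF sm]) (simp add: a_def)
  have L2a: "L2_set a F \<le> Z" if "finite F" for F
    unfolding L2_set_def Z_def by (intro real_sqrt_le_mono sum_le_suminf[OF sm that]) auto
  show thesis
  proof
    show "0 < K * Z" using K Z by simp
    fix A f assume A: "A \<in> group_algebra G" and f: "f \<in> ell2 (carrier G)"
    let ?N = "ell2_norm (carrier G)"
    define ks where "ks = wl ` supp A"
    define sl where "sl k = (\<lambda>g. if wl g = k then A g else 0)" for k
    note finA = group_algebraD(1)[OF A]
    have fin: "finite ks" using finA by (simp add: ks_def)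
    have sl: "sl k \<in> group_algebra G" for k
      by (rule group_algebraI[of "supp A"]) (use A in \<open>auto simp: sl_def group_algebra_def supp_def\<close>)
    have sl_norm: "(?N (sl k))\<^sup>2 = (\<Sum>g\<in>supp A. if wl g = k then (cmod (A g))\<^sup>2 else 0)" for k
      by (subst ell2_norm_group_algebra[of "supp A"])
        (use A in \<open>auto simp: sl_def group_algebra_def supp_def intro!: sum.cong\<close>)
    have A_eq: "A = (\<lambda>g. \<Sum>k\<in>ks. sl k g)"
    proof
      fix g show "A g = (\<Sum>k\<in>ks. sl k g)"
        using fin by (cases "g \<in> supp A") (auto simp: sl_def ks_def supp_def)
    qed
    have "left_regular G A f = (\<lambda>x. \<Sum>k\<in>ks. left_regular G (sl k) f x)"
      unfolding left_regular_eq_perm_op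
      by (subst A_eq, rule perm_action.perm_op_sum[OF regular_action fin sl])
    then have "?N (left_regular G A f) \<le> (\<Sum>k\<in>ks. ?N (left_regular G (sl k) f))"
      using ell2_norm_sum[OF fin, of "\<lambda>k. left_regular G (sl k) f"] left_regular_ell2[OF sl f] by simp
    also have "\<dots> \<le> (\<Sum>k\<in>ks. K * (1 + real k) powr C\<^sub>1 * ?N (sl k) * ?N f)"
      by (intro sum_mono ball sl f) (auto simp: sl_def supp_def split: if_splits)
    also have "\<dots> = K * (\<Sum>k\<in>ks. (1 + real k) powr C\<^sub>1 * ?N (sl k)) * ?N f"
      by (simp add: sum_distrib_left sum_distrib_right mult_ac)
    also have "(\<Sum>k\<in>ks. (1 + real k) powr C\<^sub>1 * ?N (sl k))
        = (\<Sum>k\<in>ks. \<bar>a k\<bar> * \<bar>(1 + real k) powr (c / 2) * ?N (sl k)\<bar>)"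
      by (intro sum.cong refl) (simp add: a_def abs_mult mult.assoc[symmetric] powr_add[symmetric])
    also have "\<dots> \<le> L2_set a ks * L2_set (\<lambda>k. (1 + real k) powr (c / 2) * ?N (sl k)) ks"
      by (rule L2_set_mult_ineq)
    also have "L2_set (\<lambda>k. (1 + real k) powr (c / 2) * ?N (sl k)) ks
        = sqrt (\<Sum>g\<in>supp A. (1 + real (wl g)) powr c * (cmod (A g))\<^sup>2)"
    proof -
      have "(\<Sum>k\<in>ks. ((1 + real k) powr (c / 2) * ?N (sl k))\<^sup>2)
          = (\<Sum>k\<in>ks. \<Sum>g\<in>supp A. if wl g = k then (1 + real k) powr c * (cmod (A g))\<^sup>2 else 0)"
      proof (rule sum.cong[OF refl])
        fix k
        have "((1 + real k) powr (c / 2))\<^sup>2 = (1 + real k) powr c"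
          by (simp add: power2_eq_square powr_add[symmetric])
        then show "((1 + real k) powr (c / 2) * ?N (sl k))\<^sup>2
            = (\<Sum>g\<in>supp A. if wl g = k then (1 + real k) powr c * (cmod (A g))\<^sup>2 else 0)"
          unfolding power_mult_distrib sl_norm by (auto simp: sum_distrib_left intro!: sum.cong)
      qed
      also have "\<dots> = (\<Sum>g\<in>supp A. \<Sum>k\<in>ks. if wl g = k then (1 + real k) powr c * (cmod (A g))\<^sup>2 else 0)"
        by (rule sum.swap)
      also have "\<dots> = (\<Sum>g\<in>supp A. (1 + real (wl g)) powr c * (cmod (A g))\<^sup>2)"
        by (intro sum.cong refl) (use fin in \<open>auto simp: ks_def\<close>)
      finally show ?thesis by (simp add: L2_set_def)
    qed
    also have "L2_set a ks * sqrt (\<Sum>g\<in>supp A. (1 + real (wl g)) powr c * (cmod (A g))\<^sup>2)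
        \<le> Z * sqrt (\<Sum>g\<in>supp A. (1 + real (wl g)) powr c * (cmod (A g))\<^sup>2)"
      by (intro mult_right_mono L2a fin) (auto intro: sum_nonneg)
    finally show "?N (left_regular G A f)
        \<le> K * Z * sqrt (\<Sum>g\<in>supp A. (1 + real (wl g)) powr c * (cmod (A g))\<^sup>2) * ?N f"
      using K by (simp add: mult_left_mono mult_right_mono mult.assoc)
  qed
qed

section \<open>The kernel of the variance and polynomial approximants\<close>

definition weight4 :: "real \<Rightarrow> ('a \<Rightarrow> complex) \<Rightarrow> real" where
  "weight4 c q = (\<Sum>g\<in>supp q. (1 + real (wl g)) powr c * cmod (q g) ^ 4)"

text \<open>The element \<open>A\<close> for which the trace of \<open>\<rho>(q\<^sub>2)\<rho>(t)D\<rho>(q\<^sub>1)D\<^sup>*\<rho>(t)\<^sup>-\<^sup>1\<close>, with \<open>D\<close> the diagonal matrix of \<open>v\<close>, is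
  \<open>\<langle>v, \<rho>(A)v\<rangle>\<close> up to the contribution of fixed points of nontrivial elements.\<close>

definition kernel :: "'a \<Rightarrow> ('a \<Rightarrow> complex) \<Rightarrow> ('a \<Rightarrow> complex) \<Rightarrow> 'a \<Rightarrow> complex" where
  "kernel t q\<^sub>1 q\<^sub>2 = (\<lambda>h. if h \<in> carrier G then q\<^sub>1 (inv h) * q\<^sub>2 (t \<otimes> h \<otimes> inv t) else 0)"

lemma kernel_group_algebra:
  assumes "q\<^sub>1 \<in> group_algebra G" shows "kernel t q\<^sub>1 q\<^sub>2 \<in> group_algebra G"
proof (rule group_algebraI[of "m_inv G ` supp q\<^sub>1"])
  show "kernel t q\<^sub>1 q\<^sub>2 g = 0" if "g \<notin> m_inv G ` supp q\<^sub>1" for g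
  proof (cases "g \<in> carrier G")
    case True
    then have "q\<^sub>1 (inv g) = 0" using that by (force simp: supp_def image_iff)
    then show ?thesis by (simp add: kernel_def)
  qed (simp add: kernel_def)
qed (use group_algebraD[OF assms] in auto)

lemma weight4_reindex:
  assumes q: "q \<in> group_algebra G" and F: "finite F" and inj: "inj_on \<tau> F"
    and mem: "\<And>h. h \<in> F \<Longrightarrow> \<tau> h \<in> supp q"
    and w: "\<And>h. h \<in> F \<Longrightarrow> 1 + real (wl h) \<le> a * (1 + real (wl (\<tau> h)))" and "0 \<le> c" "0 \<le> a"
  shows "(\<Sum>h\<in>F. (1 + real (wl h)) powr c * cmod (q (\<tau> h)) ^ 4) \<le> a powr c * weight4 c q"
proof -
  have "(\<Sum>h\<in>F. (1 + real (wl h)) powr c * cmod (q (\<tau> h)) ^ 4)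
      \<le> (\<Sum>h\<in>F. a powr c * ((1 + real (wl (\<tau> h))) powr c * cmod (q (\<tau> h)) ^ 4))"
  proof (intro sum_mono)
    fix h assume h: "h \<in> F"
    have "(1 + real (wl h)) powr c \<le> (a * (1 + real (wl (\<tau> h)))) powr c"
      using w[OF h] assms(6) by (intro powr_mono2) auto
    also have "\<dots> = a powr c * (1 + real (wl (\<tau> h))) powr c" by (rule powr_mult)
    finally show "(1 + real (wl h)) powr c * cmod (q (\<tau> h)) ^ 4
        \<le> a powr c * ((1 + real (wl (\<tau> h))) powr c * cmod (q (\<tau> h)) ^ 4)"
      by (simp add: mult_right_mono mult.assoc[symmetric])
  qed
  also have "\<dots> = a powr c * (\<Sum>g\<in>\<tau> ` F. (1 + real (wl g)) powr c * cmod (q g) ^ 4)"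
    by (simp add: sum_distrib_left sum.reindex[OF inj])
  also have "\<dots> \<le> a powr c * weight4 c q"
    unfolding weight4_def by (intro mult_left_mono sum_mono2) (use group_algebraD(1)[OF q] mem in auto)
  finally show ?thesis .
qed

text \<open>The inequality \<open>(xy)\<^sup>2 \<le> x\<^sup>4 + y\<^sup>4\<close> decouples the two factors, and inversion and conjugation by \<open>t\<close> distort
  word lengths by a bounded factor.  This is where fourth powers of resolvent entries arise.\<close>

lemma kernel_weight:
  assumes q1: "q\<^sub>1 \<in> group_algebra G" and q2: "q\<^sub>2 \<in> group_algebra G" and t: "t \<in> carrier G" and c: "0 \<le> c"
  shows "(\<Sum>h\<in>supp (kernel t q\<^sub>1 q\<^sub>2). (1 + real (wl h)) powr c * (cmod (kernel t q\<^sub>1 q\<^sub>2 h))\<^sup>2)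
    \<le> weight4 c q\<^sub>1 + (1 + 2 * real (wl t)) powr c * weight4 c q\<^sub>2"
proof -
  let ?F = "supp (kernel t q\<^sub>1 q\<^sub>2)"
  note fin = group_algebraD(1)[OF kernel_group_algebra[OF q1, of t q\<^sub>2]]
  note carr = group_algebraD(2)[OF kernel_group_algebra[OF q1, of t q\<^sub>2]]
  have nz: "inv h \<in> supp q\<^sub>1" "t \<otimes> h \<otimes> inv t \<in> supp q\<^sub>2" if "h \<in> ?F" for h
    using that by (auto simp: supp_def kernel_def split: if_splits)
  have A: "(\<Sum>h\<in>?F. (1 + real (wl h)) powr c * cmod (q\<^sub>1 (inv h)) ^ 4) \<le> 1 powr c * weight4 c q\<^sub>1"
    by (rule weight4_reindex[OF q1 fin]) (use nz carr c in \<open>auto intro!: inj_onI dest: arg_cong[of _ _ "m_inv G"]\<close>)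
  have B: "(\<Sum>h\<in>?F. (1 + real (wl h)) powr c * cmod (q\<^sub>2 (t \<otimes> h \<otimes> inv t)) ^ 4)
      \<le> (1 + 2 * real (wl t)) powr c * weight4 c q\<^sub>2"
  proof (rule weight4_reindex[OF q2 fin])
    show "inj_on (\<lambda>h. t \<otimes> h \<otimes> inv t) ?F" using carr t by (auto intro!: inj_onI)
    fix h assume h: "h \<in> ?F"
    have hc: "h \<in> carrier G" using carr[OF h] .
    have "h = inv t \<otimes> (t \<otimes> h \<otimes> inv t) \<otimes> t" using hc t by (simp add: m_assoc inv_solve_left)
    then have "wl h \<le> wl (inv t \<otimes> (t \<otimes> h \<otimes> inv t)) + wl t"
      using hc t wl_mult[of "inv t \<otimes> (t \<otimes> h \<otimes> inv t)" t] by simp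
    also have "\<dots> \<le> wl t + wl (t \<otimes> h \<otimes> inv t) + wl t"
      using hc t wl_mult[of "inv t" "t \<otimes> h \<otimes> inv t"] by simp
    finally have "real (wl h) \<le> 2 * real (wl t) + real (wl (t \<otimes> h \<otimes> inv t))" by linarith
    moreover have "0 \<le> 2 * (real (wl t) * real (wl (t \<otimes> h \<otimes> inv t)))" by simp
    ultimately show "1 + real (wl h) \<le> (1 + 2 * real (wl t)) * (1 + real (wl (t \<otimes> h \<otimes> inv t)))"
      by (simp only: algebra_simps)
  qed (use nz c in auto)
  have "(\<Sum>h\<in>?F. (1 + real (wl h)) powr c * (cmod (kernel t q\<^sub>1 q\<^sub>2 h))\<^sup>2)
      \<le> (\<Sum>h\<in>?F. (1 + real (wl h)) powr c * cmod (q\<^sub>1 (inv h)) ^ 4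
            + (1 + real (wl h)) powr c * cmod (q\<^sub>2 (t \<otimes> h \<otimes> inv t)) ^ 4)"
  proof (intro sum_mono)
    fix h assume h: "h \<in> ?F"
    have am: "(x * y)\<^sup>2 \<le> x ^ 4 + y ^ 4" for x y :: real
    proof -
      have "2 * (x\<^sup>2 * y\<^sup>2) \<le> x ^ 4 + y ^ 4" using sum_squares_bound[of "x\<^sup>2" "y\<^sup>2"] by simp
      moreover have "0 \<le> x\<^sup>2 * y\<^sup>2" by simp
      ultimately show ?thesis unfolding power_mult_distrib by linarith
    qed
    have "(cmod (kernel t q\<^sub>1 q\<^sub>2 h))\<^sup>2 \<le> cmod (q\<^sub>1 (inv h)) ^ 4 + cmod (q\<^sub>2 (t \<otimes> h \<otimes> inv t)) ^ 4"
      using carr[OF h] am by (simp add: kernel_def norm_mult)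
    then show "(1 + real (wl h)) powr c * (cmod (kernel t q\<^sub>1 q\<^sub>2 h))\<^sup>2
      \<le> (1 + real (wl h)) powr c * cmod (q\<^sub>1 (inv h)) ^ 4
            + (1 + real (wl h)) powr c * cmod (q\<^sub>2 (t \<otimes> h \<otimes> inv t)) ^ 4"
      unfolding distrib_left[symmetric] by (intro mult_left_mono) auto
  qed
  then show ?thesis using A B by (simp add: sum.distrib)
qed

text \<open>The truncation order is chosen so large that the eigenvalue bound holds with factor \<open>1/2\<close>, the bounds on
  the value at the identity are lost only by a factor \<open>2\<close>, and the weighted fourth powers of the error sum to at most \<open>1\<close>.
  The identity is treated apart in the weight, since its length, and hence its weight in the fourth-power
  condition, is \<open>0\<close>.\<close>

lemma polynomial_approximant:
  assumes p: "p \<in> group_algebra G" "p = ga_star G p" and \<eta>: "0 < \<eta>" and C0: "1 \<le> C\<^sub>0" and c: "0 < c"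
    and ac: "1 / C\<^sub>0 \<le> Re (ImR G p (Complex E \<eta>) \<one> \<one>)" "Re (ImR G p (Complex E \<eta>) \<one> \<one>) \<le> C\<^sub>0"
    and r4: "\<And>F. finite F \<Longrightarrow> F \<subseteq> carrier G \<Longrightarrow>
      (\<Sum>g\<in>F. \<eta>\<^sup>2 * cmod (ImR G p (Complex E \<eta>) \<one> g) ^ 4 * real (wl g) powr c) \<le> \<delta>"
  obtains q qs where "q \<in> group_algebra G"
    "1 / (2 * C\<^sub>0) \<le> Re (q \<one>)" "Re (q \<one>) \<le> 2 * C\<^sub>0"
    "weight4 c q \<le> 8 * (C\<^sub>0 ^ 4 + 2 powr c * \<delta> / \<eta>\<^sup>2 + 1)"
    "\<And>(X :: nat set) act \<phi> l. perm_action G X act \<Longrightarrow> \<phi> \<in> ell2 X \<Longrightarrow> \<phi> \<noteq> (\<lambda>x. 0) \<Longrightarrow>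
        perm_op G X act p \<phi> = (\<lambda>x. of_real l * \<phi> x) \<Longrightarrow>
        perm_op G X act q \<phi> = (\<lambda>x. of_real (qs l) * \<phi> x) \<and>
        qs l \<le> \<eta> / ((l - E)\<^sup>2 + \<eta>\<^sup>2) \<and> \<eta> / ((l - E)\<^sup>2 + \<eta>\<^sup>2) / 2 \<le> qs l"
proof -
  obtain q :: "nat \<Rightarrow> 'a \<Rightarrow> complex" and qs :: "nat \<Rightarrow> real \<Rightarrow> real" and r L :: real and D :: nat
  where rL: "0 < r" "r < 1" "0 \<le> L"
    and q: "\<And>n. q n \<in> group_algebra G"
    and err: "\<And>n F. finite F \<Longrightarrow> F \<subseteq> carrier G \<Longrightarrow>
        L2_set (\<lambda>g. cmod (q n g - cnj (ImR G p (Complex E \<eta>) \<one> g))) F \<le> L * r ^ n"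
    and wlq: "\<And>n g. g \<in> supp (q n) \<Longrightarrow> wl g \<le> D * n"
    and eig: "\<And>n (X :: nat set) act \<phi> l. perm_action G X act \<Longrightarrow> \<phi> \<in> ell2 X \<Longrightarrow> \<phi> \<noteq> (\<lambda>x. 0) \<Longrightarrow>
        perm_op G X act p \<phi> = (\<lambda>x. of_real l * \<phi> x) \<Longrightarrow>
        perm_op G X act (q n) \<phi> = (\<lambda>x. of_real (qs n l) * \<phi> x) \<and>
        qs n l \<le> \<eta> / ((l - E)\<^sup>2 + \<eta>\<^sup>2) \<and> \<eta> / ((l - E)\<^sup>2 + \<eta>\<^sup>2) * (1 - r ^ n) \<le> qs n l"
    and im: "Im (ImR G p (Complex E \<eta>) \<one> \<one>) = 0"
    by (rule resolvent_approximation[where E=E, OF p \<eta>]) blast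
  \<comment> \<open>Exponential decay against a weight that is polynomial on a support of linear radius.\<close>
  have r0: "(\<lambda>n. r ^ n) \<longlonglongrightarrow> 0" using rL by (intro LIMSEQ_power_zero) auto
  have l1: "\<forall>\<^sub>F n in sequentially. r ^ n < 1 / 2" using order_tendstoD(2)[OF r0, of "1/2"] by simp
  have "(\<lambda>n. L * r ^ n) \<longlonglongrightarrow> L * 0" by (intro tendsto_intros r0)
  then have l2: "\<forall>\<^sub>F n in sequentially. L * r ^ n < 1 / (2 * C\<^sub>0)"
    using C0 by (intro order_tendstoD(2)) auto
  have "(\<lambda>n. (1 + real D * real n) powr c * (L * r ^ n) ^ 4) \<longlonglongrightarrow> 0"
  proof (cases "L = 0")
    case False
    then have "0 < L" using rL by simp
    then show ?thesis using rL c by (cases "D = 0") (simp, real_asymp, real_asymp)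
  qed simp
  then have l3: "\<forall>\<^sub>F n in sequentially. (1 + real D * real n) powr c * (L * r ^ n) ^ 4 < 1"
    by (intro order_tendstoD(2)) auto
  obtain n where n: "r ^ n < 1 / 2" "L * r ^ n < 1 / (2 * C\<^sub>0)" "(1 + real D * real n) powr c * (L * r ^ n) ^ 4 < 1"
    using eventually_happens[OF eventually_conj[OF l1 eventually_conj[OF l2 l3]]] by auto
  let ?f = "\<lambda>g. cnj (ImR G p (Complex E \<eta>) \<one> g)"
  show thesis
  proof
    show "q n \<in> group_algebra G" by (rule q)
    have "cmod (q n \<one> - ?f \<one>) < 1 / (2 * C\<^sub>0)" using err[of "{\<one>}" n] n(2) by simp
    then have "\<bar>Re (q n \<one>) - Re (?f \<one>)\<bar> < 1 / (2 * C\<^sub>0)"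
      using abs_Re_le_cmod[of "q n \<one> - ?f \<one>"] by simp
    moreover have "1 / C\<^sub>0 = 1 / (2 * C\<^sub>0) + 1 / (2 * C\<^sub>0)" "1 / (2 * C\<^sub>0) \<le> C\<^sub>0" using C0
      by (auto simp: field_simps) (smt (verit) mult_le_cancel_right1 one_le_power power2_eq_square)
    ultimately show "1 / (2 * C\<^sub>0) \<le> Re (q n \<one>)" "Re (q n \<one>) \<le> 2 * C\<^sub>0"
      using ac by (auto simp: abs_less_iff) 
    show "weight4 c (q n) \<le> 8 * (C\<^sub>0 ^ 4 + 2 powr c * \<delta> / \<eta>\<^sup>2 + 1)"
    proof -
      let ?F = "supp (q n)" and ?w = "\<lambda>g. (1 + real (wl g)) powr c"
      note F = group_algebraD(1,2)[OF q[of n]]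
      have sub: "?F \<subseteq> carrier G" using F by blast
      have main: "(\<Sum>g\<in>?F. ?w g * cmod (?f g) ^ 4) \<le> C\<^sub>0 ^ 4 + 2 powr c * \<delta> / \<eta>\<^sup>2"
      proof -
        have "(\<Sum>g\<in>?F. ?w g * cmod (?f g) ^ 4) \<le> (\<Sum>g\<in>?F. (if g = \<one> then C\<^sub>0 ^ 4 else 0)
            + 2 powr c / \<eta>\<^sup>2 * (\<eta>\<^sup>2 * cmod (ImR G p (Complex E \<eta>) \<one> g) ^ 4 * real (wl g) powr c))"
        proof (rule sum_mono)
          fix g assume g: "g \<in> ?F"
          show "?w g * cmod (?f g) ^ 4 \<le> (if g = \<one> then C\<^sub>0 ^ 4 else 0)
            + 2 powr c / \<eta>\<^sup>2 * (\<eta>\<^sup>2 * cmod (ImR G p (Complex E \<eta>) \<one> g) ^ 4 * real (wl g) powr c)"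
          proof (cases "g = \<one>")
            case True
            have "cmod (?f \<one>) = \<bar>Re (ImR G p (Complex E \<eta>) \<one> \<one>)\<bar>" using im by (simp add: cmod_def)
            also have "\<dots> \<le> C\<^sub>0" using ac C0 by (smt (verit) zero_le_divide_1_iff)
            finally have "cmod (?f \<one>) ^ 4 \<le> C\<^sub>0 ^ 4" by (intro power_mono) auto
            then show ?thesis using True by (simp add: powr_one_eq_one)
          next
            case False
            then have "1 \<le> wl g" using wl_eq_0[of g] F(2)[OF g] by (metis One_nat_def Suc_leI neq0_conv)
            then have "?w g \<le> (2 * real (wl g)) powr c" using c by (intro powr_mono2) auto
            also have "\<dots> = 2 powr c * real (wl g) powr c" by (rule powr_mult)
            finally have "?w g * cmod (?f g) ^ 4 \<le> (2 powr c * real (wl g) powr c) * cmod (?f g) ^ 4"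
              by (rule mult_right_mono) simp
            then show ?thesis using False \<eta> by (simp add: mult_ac)
          qed
        qed
        also have "\<dots> = (\<Sum>g\<in>?F. if g = \<one> then C\<^sub>0 ^ 4 else 0) + 2 powr c / \<eta>\<^sup>2 *
            (\<Sum>g\<in>?F. \<eta>\<^sup>2 * cmod (ImR G p (Complex E \<eta>) \<one> g) ^ 4 * real (wl g) powr c)"
          by (simp only: sum.distrib sum_distrib_left)
        also have "\<dots> \<le> C\<^sub>0 ^ 4 + 2 powr c / \<eta>\<^sup>2 * \<delta>"
          by (intro add_mono mult_left_mono r4 F(1) sub) (use F(1) C0 in auto)
        finally show ?thesis by simp
      qed
      have rest: "(\<Sum>g\<in>?F. ?w g * cmod (q n g - ?f g) ^ 4) \<le> 1"
      proof -
        let ?e = "\<lambda>g. cmod (q n g - ?f g)"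
        have "(\<Sum>g\<in>?F. ?w g * ?e g ^ 4) \<le> (\<Sum>g\<in>?F. (1 + real D * real n) powr c * ?e g ^ 4)"
        proof (intro sum_mono mult_right_mono powr_mono2)
          fix g assume "g \<in> ?F"
          then show "1 + real (wl g) \<le> 1 + real D * real n"
            using wlq[of g n] by (metis add_le_cancel_left of_nat_le_iff of_nat_mult)
        qed (use c in auto)
        also have "\<dots> = (1 + real D * real n) powr c * (\<Sum>g\<in>?F. ?e g ^ 4)" by (simp add: sum_distrib_left)
        also have "(\<Sum>g\<in>?F. ?e g ^ 4) \<le> (L * r ^ n) ^ 4"
        proof -
          have "L2_set (\<lambda>g. (?e g)\<^sup>2) ?F \<le> (\<Sum>g\<in>?F. (?e g)\<^sup>2)" by (rule L2_set_le_sum) auto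
          also have "\<dots> = (L2_set ?e ?F)\<^sup>2" by (simp add: L2_set_def sum_nonneg)
          also have "\<dots> \<le> (L * r ^ n)\<^sup>2" by (intro power_mono err F(1) sub) (simp add: L2_set_nonneg)
          finally have "(L2_set (\<lambda>g. (?e g)\<^sup>2) ?F)\<^sup>2 \<le> ((L * r ^ n)\<^sup>2)\<^sup>2"
            by (intro power_mono) (auto simp: L2_set_nonneg)
          then show ?thesis by (simp add: L2_set_def sum_nonneg)
        qed
        finally show ?thesis using n(3) by (simp add: mult_left_mono)
      qed
      have "weight4 c (q n) \<le> (\<Sum>g\<in>?F. 8 * (?w g * cmod (?f g) ^ 4) + 8 * (?w g * cmod (q n g - ?f g) ^ 4))"
        unfolding weight4_def
      proof (rule sum_mono)
        fix g
        have "cmod (q n g) \<le> cmod (?f g) + cmod (q n g - ?f g)"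
          using norm_triangle_ineq[of "?f g" "q n g - ?f g"] by simp
        then have "cmod (q n g) ^ 4 \<le> (cmod (?f g) + cmod (q n g - ?f g)) ^ 4" by (intro power_mono) auto
        also have "\<dots> \<le> 8 * cmod (?f g) ^ 4 + 8 * cmod (q n g - ?f g) ^ 4"
        proof -
          have sq: "(x + y)\<^sup>2 \<le> 2 * x\<^sup>2 + 2 * y\<^sup>2" for x y :: real
            using sum_squares_bound[of x y] by (simp add: power2_sum)
          have "(x + y) ^ 4 \<le> 8 * x ^ 4 + 8 * y ^ 4" for x y :: real
          proof -
            have "((x + y)\<^sup>2)\<^sup>2 \<le> (2 * x\<^sup>2 + 2 * y\<^sup>2)\<^sup>2" using sq by (intro power_mono) auto
            also have "\<dots> \<le> 2 * (2 * x\<^sup>2)\<^sup>2 + 2 * (2 * y\<^sup>2)\<^sup>2" by (rule sq)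
            finally show ?thesis by (simp add: power_mult_distrib)
          qed
          then show ?thesis .
        qed
        finally have "?w g * cmod (q n g) ^ 4 \<le> ?w g * (8 * cmod (?f g) ^ 4 + 8 * cmod (q n g - ?f g) ^ 4)"
          by (rule mult_left_mono) simp
        then show "?w g * cmod (q n g) ^ 4 \<le> 8 * (?w g * cmod (?f g) ^ 4) + 8 * (?w g * cmod (q n g - ?f g) ^ 4)"
          by (simp only: distrib_left mult.left_commute)
      qed
      also have "\<dots> = 8 * (\<Sum>g\<in>?F. ?w g * cmod (?f g) ^ 4) + 8 * (\<Sum>g\<in>?F. ?w g * cmod (q n g - ?f g) ^ 4)"
        by (simp only: sum.distrib sum_distrib_left)
      finally show ?thesis using main rest by simp
    qed
    fix X :: "nat set" and act \<phi> l
    assume A: "perm_action G X act" "\<phi> \<in> ell2 X" "\<phi> \<noteq> (\<lambda>x. 0)" "perm_op G X act p \<phi> = (\<lambda>x. of_real l * \<phi> x)"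
    have "\<eta> / ((l - E)\<^sup>2 + \<eta>\<^sup>2) * (1 / 2) \<le> \<eta> / ((l - E)\<^sup>2 + \<eta>\<^sup>2) * (1 - r ^ n)"
      using n(1) \<eta> by (intro mult_left_mono) auto
    then show "perm_op G X act (q n) \<phi> = (\<lambda>x. of_real (qs n l) * \<phi> x) \<and>
        qs n l \<le> \<eta> / ((l - E)\<^sup>2 + \<eta>\<^sup>2) \<and> \<eta> / ((l - E)\<^sup>2 + \<eta>\<^sup>2) / 2 \<le> qs n l"
      using eig[OF A, of n] by auto
  qed
qed

end

section \<open>Traces and exceptional subspaces of small dimension\<close>

lemma Bessel_inequality:
  assumes B: "finite B" "B \<subseteq> ell2 X" and w: "w \<in> ell2 X"
    and orth: "\<And>u v. u \<in> B \<Longrightarrow> v \<in> B \<Longrightarrow> ell2_inner X u v = (if u = v then 1 else 0)"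
  shows "(\<Sum>u\<in>B. (cmod (ell2_inner X u w))\<^sup>2) \<le> (ell2_norm X w)\<^sup>2"
proof -
  define y where "y = (\<lambda>x. \<Sum>u\<in>B. ell2_inner X u w * u x)"
  let ?s = "\<Sum>u\<in>B. (cmod (ell2_inner X u w))\<^sup>2"
  have y: "y \<in> ell2 X" unfolding y_def using B by (intro ell2_sum ell2_scale) auto
  have uy: "ell2_inner X u y = ell2_inner X u w" if "u \<in> B" for u
  proof -
    have "ell2_inner X u y = (\<Sum>v\<in>B. ell2_inner X v w * ell2_inner X u v)"
      unfolding y_def by (rule ell2_inner_sum_right) (use B that in auto)
    also have "\<dots> = (\<Sum>v\<in>B. if v = u then ell2_inner X v w else 0)"
      by (rule sum.cong) (use orth that in auto)
    finally show ?thesis using that B(1) by simp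
  qed
  have sq: "cnj z * z = of_real ((cmod z)\<^sup>2)" for z by (metis complex_norm_square mult.commute)
  have yw: "ell2_inner X y h = (\<Sum>u\<in>B. cnj (ell2_inner X u w) * ell2_inner X u h)" if "h \<in> ell2 X" for h
    unfolding y_def by (rule ell2_inner_sum_left) (use B that in auto)
  have "ell2_inner X y w = of_real ?s" "ell2_inner X y y = of_real ?s"
    using uy by (simp_all add: yw[OF w] yw[OF y] sq)
  then have "Re (ell2_inner X w y) = ?s" "(ell2_norm X y)\<^sup>2 = ?s"
    using ell2_inner_commute[of X w y] by (simp, metis ell2_inner_self of_real_eq_iff)
  then show ?thesis
    using ell2_norm_diff_sq[OF w y] zero_le_power2[of "ell2_norm X (\<lambda>x. w x - y x)"] by linarith
qed

context perm_action
begin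

lemma perm_op_adjoint_right:
  assumes "q \<in> group_algebra G" "f \<in> ell2 X" "h \<in> ell2 X"
  shows "ell2_inner X f (\<pi> (ga_star G q) h) = ell2_inner X (\<pi> q f) h"
  using perm_op_adjoint[OF assms(1,3,2)] ell2_inner_commute by metis

text \<open>The row of \<open>\<rho>(w)\<close> at \<open>x\<close> is the conjugate of \<open>\<rho>(w\<^sup>*)\<delta>\<^sub>x\<close>; Bessel's inequality is applied row by row, and the squared
  norms of the rows add up to the trace of \<open>\<rho>(w w\<^sup>*)\<close>.\<close>

lemma Hilbert_Schmidt_trace:
  assumes X: "finite X" and w: "w \<in> group_algebra G" and B: "finite B" "B \<subseteq> ell2 X"
    and orth: "\<And>u v. u \<in> B \<Longrightarrow> v \<in> B \<Longrightarrow> ell2_inner X u v = (if u = v then 1 else 0)"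
  shows "(\<Sum>u\<in>B. (ell2_norm X (\<pi> w u))\<^sup>2) \<le> (\<Sum>x\<in>X. Re (\<pi> (left_regular G w (ga_star G w)) (delta x) x))"
proof -
  note ws = ga_star_group_algebra[OF w]
  have nsq: "(ell2_norm X f)\<^sup>2 = (\<Sum>x\<in>X. (cmod (f x))\<^sup>2)" for f
    using X by (simp add: ell2_norm_def sum_nonneg)
  have "(\<Sum>u\<in>B. (ell2_norm X (\<pi> w u))\<^sup>2) = (\<Sum>x\<in>X. \<Sum>u\<in>B. (cmod (\<pi> w u x))\<^sup>2)"
    unfolding nsq by (rule sum.swap)
  also have "\<dots> \<le> (\<Sum>x\<in>X. Re (\<pi> (left_regular G w (ga_star G w)) (delta x) x))"
  proof (rule sum_mono)
    fix x assume x: "x \<in> X"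
    have d: "delta x \<in> ell2 X" using x by simp
    let ?r = "\<pi> (ga_star G w) (delta x)"
    have r: "?r \<in> ell2 X" by (intro perm_op_ell2 ws d)
    have "\<pi> w u x = cnj (ell2_inner X u ?r)" if "u \<in> B" for u
    proof -
      have "\<pi> w u x = ell2_inner X (delta x) (\<pi> w u)" using x by (simp add: ell2_inner_delta)
      also have "\<dots> = ell2_inner X ?r u" using perm_op_adjoint[OF w d, of u] that B by auto
      finally show ?thesis by (simp add: ell2_inner_commute[of X ?r u])
    qed
    then have "(\<Sum>u\<in>B. (cmod (\<pi> w u x))\<^sup>2) = (\<Sum>u\<in>B. (cmod (ell2_inner X u ?r))\<^sup>2)" by simp
    also have "\<dots> \<le> (ell2_norm X ?r)\<^sup>2" by (rule Bessel_inequality[OF B r orth])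
    also have "\<dots> = Re (ell2_inner X ?r ?r)" by (simp add: ell2_inner_self)
    also have "ell2_inner X ?r ?r = \<pi> (left_regular G w (ga_star G w)) (delta x) x"
      using perm_op_adjoint[OF w d r] x by (simp add: perm_op_mult[OF w ws] ell2_inner_delta)
    finally show "(\<Sum>u\<in>B. (cmod (\<pi> w u x))\<^sup>2) \<le> Re (\<pi> (left_regular G w (ga_star G w)) (delta x) x)" .
  qed
  finally show ?thesis .
qed

end

text \<open>Repeated squaring \<open>W \<mapsto> W\<^sup>*W\<close>.  It turns a moment of high order into a Hilbert-Schmidt norm while needing
  only Cauchy-Schwarz, in place of the spectral theorem, for the comparison of moments of a vector.\<close>

fun doubling :: "('a, 'b) monoid_scheme \<Rightarrow> ('a \<Rightarrow> complex) \<Rightarrow> nat \<Rightarrow> 'a \<Rightarrow> complex" where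
  "doubling G A 0 = A"
| "doubling G A (Suc j) = left_regular G (ga_star G (doubling G A j)) (doubling G A j)"

lemma (in group) doubling_group_algebra: "A \<in> group_algebra G \<Longrightarrow> doubling G A j \<in> group_algebra G"
  by (induction j) (auto intro: left_regular_group_algebra ga_star_group_algebra)

text \<open>By Cauchy-Schwarz, \<open>\<parallel>W\<^sup>*Wu\<parallel> \<ge> \<langle>u, W\<^sup>*Wu\<rangle> = \<parallel>Wu\<parallel>\<^sup>2\<close> for a unit vector \<open>u\<close>.\<close>

lemma (in perm_action) doubling_lower:
  assumes A: "A \<in> group_algebra G" and u: "u \<in> ell2 X" "ell2_norm X u = 1"
    and s: "0 \<le> s" "s \<le> ell2_norm X (\<pi> A u)"
  shows "s ^ 2 ^ j \<le> ell2_norm X (\<pi> (doubling G A j) u)"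
proof (induction j)
  case (Suc j)
  let ?W = "doubling G A j"
  note W = doubling_group_algebra[OF A, of j]
  have Wu: "\<pi> ?W u \<in> ell2 X" by (intro perm_op_ell2 W u)
  have mult: "\<pi> (doubling G A (Suc j)) u = \<pi> (ga_star G ?W) (\<pi> ?W u)"
    by (simp add: perm_op_mult ga_star_group_algebra W)
  have "s ^ 2 ^ Suc j = (s ^ 2 ^ j)\<^sup>2" by (simp add: power_mult[symmetric] mult.commute)
  also have "\<dots> \<le> (ell2_norm X (\<pi> ?W u))\<^sup>2" using Suc s by (intro power_mono) auto
  also have "\<dots> = cmod (ell2_inner X (\<pi> ?W u) (\<pi> ?W u))" by (simp add: ell2_inner_self norm_power)
  also have "\<dots> = cmod (ell2_inner X u (\<pi> (doubling G A (Suc j)) u))"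
    unfolding mult by (simp add: perm_op_adjoint_right[OF W u(1) Wu])
  also have "\<dots> \<le> ell2_norm X u * ell2_norm X (\<pi> (doubling G A (Suc j)) u)"
    by (intro ell2_Cauchy_Schwarz u perm_op_ell2 doubling_group_algebra A)
  finally show ?case using u by simp
qed (use s in simp)

lemma (in group) doubling_upper:
  assumes A: "A \<in> group_algebra G" and "0 \<le> \<theta>"
    and bound: "\<And>f. f \<in> ell2 (carrier G) \<Longrightarrow> ell2_norm (carrier G) (left_regular G A f) \<le> \<theta> * ell2_norm (carrier G) f"
    and f: "f \<in> ell2 (carrier G)"
  shows "ell2_norm (carrier G) (left_regular G (doubling G A j) f) \<le> \<theta> ^ 2 ^ j * ell2_norm (carrier G) f"
  using f
proof (induction j arbitrary: f)
  case 0
  then show ?case using bound by simp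
next
  case (Suc j)
  let ?W = "doubling G A j" and ?N = "ell2_norm (carrier G)"
  note W = doubling_group_algebra[OF A, of j]
  have Wf: "left_regular G ?W f \<in> ell2 (carrier G)" by (intro left_regular_ell2 W Suc)
  have "?N (left_regular G (doubling G A (Suc j)) f) = ?N (left_regular G (ga_star G ?W) (left_regular G ?W f))"
    by (simp add: left_regular_mult ga_star_group_algebra W)
  also have "\<dots> \<le> \<theta> ^ 2 ^ j * ?N (left_regular G ?W f)"
    by (rule left_regular_adjoint_norm[OF W Wf]) (use assms(2) Suc.IH in auto)
  also have "\<dots> \<le> \<theta> ^ 2 ^ j * (\<theta> ^ 2 ^ j * ?N f)"
    using assms(2) Suc by (intro mult_left_mono) auto
  finally show ?case by (simp add: power_add[symmetric] mult.assoc[symmetric] mult_2)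
qed

lemma eventually_along: "eventually P (along \<N>) \<longleftrightarrow> (\<exists>n0. \<forall>N\<ge>n0. N \<in> \<N> \<longrightarrow> P N)"
  by (simp add: along_def eventually_inf_principal eventually_sequentially)

locale permutation_sequence = group G for G (structure) +
  fixes \<N> :: "nat set" and \<rho> :: "nat \<Rightarrow> 'a \<Rightarrow> nat \<Rightarrow> nat"
  assumes zero: "0 \<notin> \<N>" and hom: "N \<in> \<N> \<Longrightarrow> \<rho> N \<in> hom G (sym_group N)"
    and conv: "converges_to_regular G \<N> \<rho>"
begin

lemma action: "N \<in> \<N> \<Longrightarrow> perm_action G {1..N} (\<rho> N)"
  by (rule sym_group_action[OF group_axioms hom])

abbreviation "\<pi>\<^sub>N N \<equiv> perm_op G {1..N} (\<rho> N)"

definition fixed :: "nat \<Rightarrow> 'a \<Rightarrow> nat set" where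
  "fixed N g = {x \<in> {1..N}. \<rho> N g x = x}"

definition negligible :: "(nat \<Rightarrow> real) \<Rightarrow> bool" where
  "negligible f \<longleftrightarrow> ((\<lambda>N. f N / real N) \<longlongrightarrow> 0) (along \<N>)"

lemma eventually_pos: "\<forall>\<^sub>F N in along \<N>. N \<in> \<N> \<and> 0 < N"
  unfolding eventually_along using zero by (metis gr0I)

lemma negligible_0: "negligible (\<lambda>N. 0)"
  by (simp add: negligible_def)

lemma negligible_add: "negligible f \<Longrightarrow> negligible h \<Longrightarrow> negligible (\<lambda>N. f N + h N)"
  unfolding negligible_def add_divide_distrib by (rule tendsto_add_zero)

lemma negligible_cmult: "negligible f \<Longrightarrow> negligible (\<lambda>N. c * f N)"
  unfolding negligible_def times_divide_eq_right[symmetric] by (rule tendsto_mult_right_zero)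

lemma negligible_sum: "(\<And>i. i \<in> A \<Longrightarrow> negligible (f i)) \<Longrightarrow> negligible (\<lambda>N. \<Sum>i\<in>A. f i N)"
  by (induction A rule: infinite_finite_induct) (auto intro: negligible_0 negligible_add)

lemma negligible_le:
  assumes "negligible f" "0 < \<epsilon>" shows "\<forall>\<^sub>F N in along \<N>. f N \<le> \<epsilon> * real N"
proof -
  have "\<forall>\<^sub>F N in along \<N>. f N / real N < \<epsilon>"
    using assms unfolding negligible_def by (rule order_tendstoD(2))
  with eventually_pos show ?thesis
    by eventually_elim (simp add: pos_divide_less_eq)
qed

lemma negligible_mono:
  assumes "negligible f" "\<forall>\<^sub>F N in along \<N>. 0 \<le> h N \<and> h N \<le> f N" shows "negligible h"
  unfolding negligible_def
proof (rule tendsto_sandwich[OF _ _ tendsto_const assms(1)[unfolded negligible_def]])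
  show "\<forall>\<^sub>F N in along \<N>. 0 \<le> h N / real N" using assms(2) by eventually_elim simp
  show "\<forall>\<^sub>F N in along \<N>. h N / real N \<le> f N / real N" 
    using assms(2) by eventually_elim (simp add: divide_right_mono)
qed

text \<open>Each \<open>B k\<close> is small only from some \<open>N\<close> on, and not uniformly in \<open>k\<close>.  At stage \<open>N\<close> the union takes
  those \<open>B k N\<close> whose relative size has already dropped below \<open>2\<^sup>-\<^sup>k\<close>: each \<open>k\<close> is eventually taken,
  and the geometric budget makes the tail uniformly small while any head is a finite sum of
  negligible terms.\<close>

lemma diagonal_union:
  fixes B :: "nat \<Rightarrow> nat \<Rightarrow> 'z set"
  assumes fin: "\<And>k N. finite (B k N)" and neg: "\<And>k. negligible (\<lambda>N. real (card (B k N)))"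
  obtains D where "\<And>N. finite (D N)" "\<And>N. D N \<subseteq> (\<Union>k. B k N)" "negligible (\<lambda>N. real (card (D N)))"
    "\<And>k. \<forall>\<^sub>F N in along \<N>. B k N \<subseteq> D N"
proof -
  define J where "J N = {k. k \<le> N \<and> real (card (B k N)) \<le> (1 / 2) ^ k * real N}" for N
  define D where "D N = (\<Union>k\<in>J N. B k N)" for N
  have finJ: "finite (J N)" for N by (rule finite_subset[of _ "{..N}"]) (auto simp: J_def)
  show thesis
  proof
    show "finite (D N)" for N unfolding D_def using finJ fin by auto
    show "D N \<subseteq> (\<Union>k. B k N)" for N unfolding D_def by auto
    show "\<forall>\<^sub>F N in along \<N>. B k N \<subseteq> D N" for k
    proof -
      have "\<forall>\<^sub>F N in along \<N>. k \<le> N" unfolding eventually_along by auto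
      moreover have "\<forall>\<^sub>F N in along \<N>. real (card (B k N)) \<le> (1 / 2) ^ k * real N"
        by (rule negligible_le[OF neg]) simp
      ultimately show ?thesis
        by eventually_elim (auto simp: D_def J_def)
    qed
    show "negligible (\<lambda>N. real (card (D N)))"
      unfolding negligible_def
    proof (rule tendstoI)
      fix \<epsilon> :: real assume \<epsilon>: "0 < \<epsilon>"
      obtain m where m: "(1 / 2) ^ m < \<epsilon> / 4" using real_arch_pow_inv[of "\<epsilon> / 4" "1 / 2"] \<epsilon> by auto
      have "\<forall>\<^sub>F N in along \<N>. (\<Sum>k<m. real (card (B k N))) \<le> \<epsilon> / 4 * real N"
        by (intro negligible_le negligible_sum neg) (use \<epsilon> in auto)
      with eventually_pos show "\<forall>\<^sub>F N in along \<N>. dist (real (card (D N)) / real N) 0 < \<epsilon>"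
      proof eventually_elim
        case (elim N)
        then have N: "0 < real N" by simp
        have "real (card (D N)) \<le> (\<Sum>k\<in>J N. real (card (B k N)))"
          unfolding D_def using card_UN_le[OF finJ, of "\<lambda>k. B k N" N] by (metis of_nat_le_iff of_nat_sum)
        also have "\<dots> = (\<Sum>k\<in>J N \<inter> {..<m}. real (card (B k N))) + (\<Sum>k\<in>J N - {..<m}. real (card (B k N)))"
          by (rule sum.Int_Diff[OF finJ])
        also have "\<dots> \<le> (\<Sum>k<m. real (card (B k N))) + (\<Sum>k\<in>J N - {..<m}. (1 / 2) ^ k * real N)"
          by (intro add_mono sum_mono2 sum_mono) (auto simp: J_def)
        also have "(\<Sum>k\<in>J N - {..<m}. (1 / 2) ^ k * real N) \<le> (\<Sum>k\<in>{m..m+N}. (1 / 2) ^ k * real N)"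
          by (intro sum_mono2) (auto simp: J_def)
        also have "(\<Sum>k\<in>{m..m+N}. (1 / 2) ^ k * real N) \<le> 2 * (1 / 2) ^ m * real N"
        proof -
          have "(\<Sum>k\<in>{m..m+N}. (1 / 2 :: real) ^ k) \<le> 2 * (1 / 2) ^ m"
            unfolding sum_gp by simp
          then show ?thesis unfolding sum_distrib_right[symmetric] by (rule mult_right_mono) simp
        qed
        also have "2 * (1 / 2) ^ m * real N \<le> 2 * (\<epsilon> / 4) * real N"
          using m N by (intro mult_right_mono mult_left_mono) auto
        finally have "real (card (D N)) \<le> 3 / 4 * \<epsilon> * real N" using elim by (simp add: algebra_simps)
        also have "\<dots> < \<epsilon> * real N" using \<epsilon> N by simp
        finally show ?case using N by (simp add: pos_divide_less_eq)
      qed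
    qed
  qed
qed

lemma fixed_negligible:
  assumes "g \<in> carrier G" "g \<noteq> \<one>" shows "negligible (\<lambda>N. real (card (fixed N g)))"
proof -
  have "mtrace N (perm_matrix (\<rho> N g)) = of_nat (card (fixed N g))" for N
  proof -
    have "mtrace N (perm_matrix (\<rho> N g)) = (\<Sum>x\<in>{1..N}. if \<rho> N g x = x then 1 else 0)"
      unfolding mtrace_def perm_matrix_def by (intro sum.cong) auto
    also have "\<dots> = of_nat (card (fixed N g))"
      by (subst sum.If_cases) (auto simp: fixed_def Int_def)
    finally show ?thesis .
  qed
  moreover have "((\<lambda>N. 1 / of_nat N * mtrace N (perm_matrix (\<rho> N g))) \<longlongrightarrow> 0) (along \<N>)"
    using conv assms unfolding converges_to_regular_def by blast
  ultimately have "((\<lambda>N. 1 / of_nat N * of_nat (card (fixed N g))) \<longlongrightarrow> (0 :: complex)) (along \<N>)"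
    by simp
  from tendsto_norm[OF this] show ?thesis
    unfolding negligible_def by (simp add: norm_mult norm_divide)
qed

text \<open>The trace counts fixed points, and only the identity fixes a positive proportion of the points.\<close>

lemma trace_limit:
  assumes w: "w \<in> group_algebra G"
  shows "((\<lambda>N. (\<Sum>x\<in>{1..N}. \<pi>\<^sub>N N w (delta x) x) / of_nat N) \<longlongrightarrow> w \<one>) (along \<N>)"
proof -
  have lim: "((\<lambda>N. w g * of_real (real (card (fixed N (inv g))) / real N))
      \<longlongrightarrow> (if g = \<one> then w g else 0)) (along \<N>)" if g: "g \<in> supp w" for g
  proof (cases "g = \<one>")
    case True
    have "\<forall>\<^sub>F N in along \<N>. w g * of_real (real (card (fixed N (inv g))) / real N) = w g"
      using eventually_pos
    proof eventually_elim
      case (elim N)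
      interpret perm_action G "{1..N}" "\<rho> N" using elim action by blast
      have "fixed N (inv g) = {1..N}" using True act_one by (auto simp: fixed_def)
      then show ?case using elim by simp
    qed
    then show ?thesis using True by (simp add: tendsto_eventually)
  next
    case False
    have gc: "g \<in> carrier G" using group_algebraD(2)[OF w g] .
    have "((\<lambda>N. w g * of_real (real (card (fixed N (inv g))) / real N)) \<longlongrightarrow> w g * of_real 0) (along \<N>)"
      using fixed_negligible[of "inv g"] gc False unfolding negligible_def
      by (intro tendsto_intros) auto
    then show ?thesis using False by simp
  qed
  have "((\<lambda>N. \<Sum>g\<in>supp w. w g * of_real (real (card (fixed N (inv g))) / real N))
      \<longlongrightarrow> (\<Sum>g\<in>supp w. if g = \<one> then w g else 0)) (along \<N>)"
    by (intro tendsto_sum lim)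
  moreover have "(\<Sum>g\<in>supp w. if g = \<one> then w g else 0) = w \<one>"
    using group_algebraD(1)[OF w] by (auto simp: supp_def)
  moreover have "(\<Sum>g\<in>supp w. w g * of_real (real (card (fixed N (inv g))) / real N))
      = (\<Sum>x\<in>{1..N}. \<pi>\<^sub>N N w (delta x) x) / of_nat N" for N
  proof -
    have "(\<Sum>x\<in>{1..N}. \<pi>\<^sub>N N w (delta x) x)
        = (\<Sum>x\<in>{1..N}. \<Sum>g\<in>supp w. w g * (if \<rho> N (inv g) x = x then 1 else 0))"
      by (intro sum.cong) (auto simp: perm_op_def delta_def intro!: sum.cong)
    also have "\<dots> = (\<Sum>g\<in>supp w. w g * (\<Sum>x\<in>{1..N}. if \<rho> N (inv g) x = x then 1 else 0))"
      by (subst sum.swap) (simp add: sum_distrib_left)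
    also have "\<dots> = (\<Sum>g\<in>supp w. w g * of_nat (card (fixed N (inv g))))"
      by (intro sum.cong refl arg_cong2[where f="(*)"], subst sum.If_cases) (auto simp: fixed_def Int_def)
    finally show ?thesis by (simp add: sum_divide_distrib)
  qed
  ultimately show ?thesis by simp
qed

text \<open>Orthonormal families on which \<open>\<rho>\<^sub>N(A)\<close> exceeds the norm \<open>s\<close>; a maximal one plays the role of the
  eigenvectors of \<open>\<rho>\<^sub>N(A)\<^sup>*\<rho>\<^sub>N(A)\<close> above \<open>s\<^sup>2\<close>.\<close>

definition large_system :: "nat \<Rightarrow> ('a \<Rightarrow> complex) \<Rightarrow> real \<Rightarrow> (nat \<Rightarrow> complex) set \<Rightarrow> bool" where
  "large_system N A s B \<longleftrightarrow> finite B \<and> B \<subseteq> cvec N \<and>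
     (\<forall>u\<in>B. \<forall>v\<in>B. ell2_inner {1..N} u v = (if u = v then 1 else 0)) \<and>
     (\<forall>u\<in>B. s < ell2_norm {1..N} (\<pi>\<^sub>N N A u))"

lemma large_system_card:
  assumes N: "N \<in> \<N>" and A: "A \<in> group_algebra G" and s: "0 < s" and B: "large_system N A s B"
  shows "real (card B) * s ^ 2 ^ Suc j
    \<le> (\<Sum>x\<in>{1..N}. Re (\<pi>\<^sub>N N (left_regular G (doubling G A j) (ga_star G (doubling G A j))) (delta x) x))"
proof -
  interpret perm_action G "{1..N}" "\<rho> N" by (rule action[OF N])
  have B': "finite B" "B \<subseteq> cvec N"
    "\<And>u v. u \<in> B \<Longrightarrow> v \<in> B \<Longrightarrow> ell2_inner {1..N} u v = (if u = v then 1 else 0)"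
    "\<And>u. u \<in> B \<Longrightarrow> s \<le> ell2_norm {1..N} (\<pi>\<^sub>N N A u)"
    using B by (auto simp: large_system_def less_imp_le simp del: One_nat_def)
  have "real (card B) * s ^ 2 ^ Suc j = (\<Sum>u\<in>B. (s ^ 2 ^ j)\<^sup>2)"
    by (simp add: power_mult[symmetric] mult.commute)
  also have "\<dots> \<le> (\<Sum>u\<in>B. (ell2_norm {1..N} (\<pi>\<^sub>N N (doubling G A j) u))\<^sup>2)"
  proof (intro sum_mono power_mono doubling_lower A)
    fix u assume u: "u \<in> B"
    then have "complex_of_real ((ell2_norm {1..N} u)\<^sup>2) = of_real 1"
      using B'(3)[OF u u] ell2_inner_self[of "{1..N}" u] by simp
    then have "(ell2_norm {1..N} u)\<^sup>2 = 1" using of_real_eq_iff by blast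
    then have "ell2_norm {1..N} u = 1 \<or> ell2_norm {1..N} u = - 1" by (simp only: power2_eq_1_iff)
    then show "ell2_norm {1..N} u = 1" using ell2_norm_nonneg[of "{1..N}" u] by linarith
  qed (use B' s in auto)
  also have "\<dots> \<le> (\<Sum>x\<in>{1..N}. Re (\<pi>\<^sub>N N (left_regular G (doubling G A j) (ga_star G (doubling G A j))) (delta x) x))"
    by (rule Hilbert_Schmidt_trace[OF _ doubling_group_algebra[OF A] B'(1-3)]) auto
  finally show ?thesis .
qed

text \<open>A unit vector orthogonal to a maximal family on which \<open>\<rho>\<^sub>N(A)\<close> were too large would extend it.\<close>

lemma maximal_large_system:
  assumes N: "N \<in> \<N>" and A: "A \<in> group_algebra G" and s: "0 < s"
  obtains B where "large_system N A s B"
    "\<And>v. v \<in> cvec N \<Longrightarrow> (\<And>b. b \<in> B \<Longrightarrow> ell2_inner {1..N} b v = 0) \<Longrightarrow>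
      ell2_norm {1..N} (\<pi>\<^sub>N N A v) \<le> s * ell2_norm {1..N} v"
proof -
  interpret perm_action G "{1..N}" "\<rho> N" by (rule action[OF N])
  let ?\<tau> = "\<Sum>x\<in>{1..N}. Re (\<pi>\<^sub>N N (left_regular G A (ga_star G A)) (delta x) x)"
  have empty: "large_system N A s {}" by (simp add: large_system_def)
  have bounded: "card B \<le> nat \<lceil>?\<tau> / s\<^sup>2\<rceil>" if "large_system N A s B" for B
  proof -
    have "real (card B) \<le> ?\<tau> / s\<^sup>2"
      using large_system_card[OF N A s that, of 0] s by (simp add: pos_le_divide_eq numeral_2_eq_2)
    then show ?thesis by linarith
  qed
  have "\<exists>B. large_system N A s B \<and> (\<forall>B'. large_system N A s B' \<longrightarrow> card B' \<le> card B)"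
    by (rule ex_has_greatest_nat[where k="{}" and b="Suc (nat \<lceil>?\<tau> / s\<^sup>2\<rceil>)"])
      (use empty bounded in \<open>auto simp only: less_Suc_eq_le\<close>)
  then obtain B where B: "large_system N A s B"
    and max: "\<And>B'. large_system N A s B' \<Longrightarrow> card B' \<le> card B"
    by blast
  show thesis
  proof (rule that[OF B], rule ccontr)
    fix v assume v: "v \<in> cvec N" and perp: "\<And>b. b \<in> B \<Longrightarrow> ell2_inner {1..N} b v = 0"
      and "\<not> ell2_norm {1..N} (\<pi>\<^sub>N N A v) \<le> s * ell2_norm {1..N} v"
    then have big: "s * ell2_norm {1..N} v < ell2_norm {1..N} (\<pi>\<^sub>N N A v)" by simp
    have pos: "0 < ell2_norm {1..N} v"
    proof (rule ccontr)
      assume "\<not> 0 < ell2_norm {1..N} v"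
      then have "ell2_norm {1..N} v = 0" using ell2_norm_nonneg[of "{1..N}" v] by linarith
      moreover from this have "v = (\<lambda>x. 0)" by (rule ell2_norm_eq_0[OF v])
      moreover have "\<pi>\<^sub>N N A (\<lambda>x. 0) = (\<lambda>x. 0)" using perm_op_scale_right[of A 0 "\<lambda>x. 0"] by simp
      ultimately show False using big by simp
    qed
    define a where "a = complex_of_real (1 / ell2_norm {1..N} v)"
    have ca: "cmod a = 1 / ell2_norm {1..N} v" using pos by (simp add: a_def norm_divide)
    define u where "u = (\<lambda>x. a * v x)"
    have u: "u \<in> cvec N" unfolding u_def by (rule ell2_scale[OF v])
    have nu: "ell2_norm {1..N} u = 1" unfolding u_def ell2_norm_scale ca using pos by simp
    have Au: "s < ell2_norm {1..N} (\<pi>\<^sub>N N A u)"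
      unfolding u_def perm_op_scale_right ell2_norm_scale ca using big pos by (simp add: field_simps)
    have bu: "ell2_inner {1..N} b u = 0" if "b \<in> B" for b
      using perp[OF that] by (simp add: u_def ell2_inner_scale_right)
    have ub: "ell2_inner {1..N} u b = 0" if "b \<in> B" for b
      using bu[OF that] by (simp add: ell2_inner_commute[of _ u b])
    have uu: "ell2_inner {1..N} u u = 1" using nu by (simp add: ell2_inner_self)
    have "u \<notin> B" using bu uu by force
    moreover have "large_system N A s (insert u B)"
      using B u Au bu ub uu \<open>u \<notin> B\<close> unfolding large_system_def by (auto simp del: One_nat_def)
    ultimately show False using max[of "insert u B"] B by (simp add: large_system_def)
  qed
qed

text \<open>The substitute for strong convergence.  A large system of cardinality \<open>m\<close> contributes at least \<open>m s\<^sup>2\<^sup>k\<close> to a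
  moment of order \<open>2k\<close>, which by convergence in distribution is asymptotically at most \<open>N\<theta>\<^sup>2\<^sup>k\<close>.  So \<open>m/N\<close> is
  asymptotically at most \<open>(\<theta>/s)\<^sup>2\<^sup>k\<close> for every \<open>k\<close> that is a power of two, and \<open>\<theta> < s\<close>.\<close>

theorem exceptional_subspace:
  assumes A: "A \<in> group_algebra G" and \<theta>: "0 \<le> \<theta>" "\<theta> < s"
    and bound: "\<And>f. f \<in> ell2 (carrier G) \<Longrightarrow> ell2_norm (carrier G) (left_regular G A f) \<le> \<theta> * ell2_norm (carrier G) f"
  obtains B :: "nat \<Rightarrow> (nat \<Rightarrow> complex) set" where
    "\<And>N. finite (B N)" "\<And>N. B N \<subseteq> cvec N" "negligible (\<lambda>N. real (card (B N)))"
    "\<And>N v. N \<in> \<N> \<Longrightarrow> v \<in> cvec N \<Longrightarrow> (\<And>b. b \<in> B N \<Longrightarrow> ell2_inner {1..N} b v = 0) \<Longrightarrow>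
      ell2_norm {1..N} (\<pi>\<^sub>N N A v) \<le> s * ell2_norm {1..N} v"
proof -
  have s: "0 < s" using \<theta> by simp
  have "\<exists>B. (N \<in> \<N> \<longrightarrow> large_system N A s B \<and>
      (\<forall>v\<in>cvec N. (\<forall>b\<in>B. ell2_inner {1..N} b v = 0) \<longrightarrow>
        ell2_norm {1..N} (\<pi>\<^sub>N N A v) \<le> s * ell2_norm {1..N} v)) \<and> (N \<notin> \<N> \<longrightarrow> B = {})" for N
  proof (cases "N \<in> \<N>")
    case True
    obtain B where "large_system N A s B"
      "\<And>v. v \<in> cvec N \<Longrightarrow> (\<And>b. b \<in> B \<Longrightarrow> ell2_inner {1..N} b v = 0) \<Longrightarrow>
        ell2_norm {1..N} (\<pi>\<^sub>N N A v) \<le> s * ell2_norm {1..N} v"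
      by (rule maximal_large_system[OF True A s]) blast
    then show ?thesis using True by (intro exI[of _ B]) simp
  qed simp
  then obtain B where B: "\<And>N. N \<in> \<N> \<Longrightarrow> large_system N A s (B N)" "\<And>N. N \<notin> \<N> \<Longrightarrow> B N = {}"
    and perp: "\<And>N v. N \<in> \<N> \<Longrightarrow> v \<in> cvec N \<Longrightarrow> (\<And>b. b \<in> B N \<Longrightarrow> ell2_inner {1..N} b v = 0) \<Longrightarrow>
        ell2_norm {1..N} (\<pi>\<^sub>N N A v) \<le> s * ell2_norm {1..N} v"
    by metis
  show thesis
  proof (rule that[OF _ _ _ perp])
    show "finite (B N)" "B N \<subseteq> cvec N" for N
      using B[of N] by (cases "N \<in> \<N>"; simp add: large_system_def)+
    show "negligible (\<lambda>N. real (card (B N)))"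
      unfolding negligible_def
    proof (rule tendstoI)
      fix \<epsilon> :: real assume \<epsilon>: "0 < \<epsilon>"
      have q: "0 \<le> \<theta> / s" "\<theta> / s < 1" using \<theta> s by auto
      \<comment> \<open>Doubling reaches only powers of two; \<open>2 ^ Suc n\<close> is one beyond \<open>n\<close>.\<close>
      obtain n where n: "(\<theta> / s) ^ n < \<epsilon>" using real_arch_pow_inv[OF \<epsilon> q(2)] by blast
      let ?W = "doubling G A n"
      let ?w = "left_regular G ?W (ga_star G ?W)" and ?Nm = "ell2_norm (carrier G)"
      note W = doubling_group_algebra[OF A, of n]
      have d: "delta \<one> \<in> ell2 (carrier G)" by simp
      have "n \<le> 2 ^ Suc n" using less_exp[of n] unfolding power_Suc by linarith
      then have "(\<theta> / s) ^ 2 ^ Suc n \<le> (\<theta> / s) ^ n" using q by (intro power_decreasing) auto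
      then have "(\<theta> / s) ^ 2 ^ Suc n < \<epsilon>" using n by linarith
      then have small: "\<theta> ^ 2 ^ Suc n < \<epsilon> * s ^ 2 ^ Suc n"
        using s by (simp only: power_divide) (simp add: pos_divide_less_eq)
      have w1: "Re (?w \<one>) \<le> \<theta> ^ 2 ^ Suc n"
      proof -
        let ?r = "left_regular G (ga_star G ?W) (delta \<one>)"
        have r: "?r \<in> ell2 (carrier G)" by (intro left_regular_ell2 ga_star_group_algebra W d)
        have "?w \<one> = left_regular G ?w (delta \<one>) \<one>"
          by (simp add: left_regular_delta_one left_regular_group_algebra ga_star_group_algebra W)
        also have "\<dots> = ell2_inner (carrier G) (delta \<one>) (left_regular G ?W ?r)"
          by (simp add: left_regular_mult ga_star_group_algebra W ell2_inner_delta)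
        also have "\<dots> = ell2_inner (carrier G) ?r ?r"
          by (rule left_regular_adjoint[OF W d r, symmetric])
        finally have "Re (?w \<one>) = (?Nm ?r)\<^sup>2" by (simp add: ell2_inner_self)
        also have "?Nm ?r \<le> \<theta> ^ 2 ^ n * ?Nm (delta \<one>)"
          by (rule left_regular_adjoint_norm[OF W d]) (use \<theta> doubling_upper[OF A \<theta>(1) bound] in auto)
        then have "(?Nm ?r)\<^sup>2 \<le> (\<theta> ^ 2 ^ n)\<^sup>2"
          by (intro power_mono) (auto simp: ell2_norm_delta)
        also have "\<dots> = \<theta> ^ 2 ^ Suc n" by (simp add: power_mult[symmetric] mult.commute)
        finally show ?thesis by simp
      qed
      have "((\<lambda>N. Re ((\<Sum>x\<in>{1..N}. \<pi>\<^sub>N N ?w (delta x) x) / of_nat N)) \<longlongrightarrow> Re (?w \<one>)) (along \<N>)"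
        by (intro tendsto_intros trace_limit left_regular_group_algebra ga_star_group_algebra W)
      then have "\<forall>\<^sub>F N in along \<N>. Re ((\<Sum>x\<in>{1..N}. \<pi>\<^sub>N N ?w (delta x) x) / of_nat N) < \<epsilon> * s ^ 2 ^ Suc n"
        by (rule order_tendstoD(2)) (use w1 small in linarith)
      with eventually_pos show "\<forall>\<^sub>F N in along \<N>. dist (real (card (B N)) / real N) 0 < \<epsilon>"
      proof eventually_elim
        case (elim N)
        then have N: "N \<in> \<N>" "0 < real N" by auto
        have "real (card (B N)) * s ^ 2 ^ Suc n \<le> (\<Sum>x\<in>{1..N}. Re (\<pi>\<^sub>N N ?w (delta x) x))"
          by (rule large_system_card[OF N(1) A s B(1)[OF N(1)]])
        also have "\<dots> = Re (\<Sum>x\<in>{1..N}. \<pi>\<^sub>N N ?w (delta x) x)" by (simp only: Re_sum)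
        also have "\<dots> < \<epsilon> * s ^ 2 ^ Suc n * real N"
          using elim N by (simp add: Re_divide_of_nat pos_divide_less_eq)
        finally have "real (card (B N)) * s ^ 2 ^ Suc n < (\<epsilon> * real N) * s ^ 2 ^ Suc n" by (simp only: mult_ac)
        then have "real (card (B N)) < \<epsilon> * real N"
          using s by (simp only: mult_less_cancel_right_pos zero_less_power)
        then show ?case using N by (simp add: pos_divide_less_eq)
      qed
    qed
  qed
qed

end

section \<open>Spectral sums as traces\<close>

lemma sum_swap3: "(\<Sum>a\<in>A. \<Sum>b\<in>B. \<Sum>c\<in>C. f a b c) = (\<Sum>b\<in>B. \<Sum>c\<in>C. \<Sum>a\<in>A. f a b c)"
  by (rule trans[OF sum.swap], rule sum.cong[OF refl], rule sum.swap)

locale eigen_sequence = permutation_sequence +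
  fixes p :: "'a \<Rightarrow> complex" and ev :: "nat \<Rightarrow> nat \<Rightarrow> real" and \<phi> :: "nat \<Rightarrow> nat \<Rightarrow> nat \<Rightarrow> complex"
  assumes p: "p \<in> group_algebra G"
    and eigenbasis: "N \<in> \<N> \<Longrightarrow> orthonormal_eigenbasis N (rep_matrix (\<rho> N) p) (ev N) (\<phi> N)"
begin

lemma \<phi>_cvec: "N \<in> \<N> \<Longrightarrow> \<alpha> \<in> {1..N} \<Longrightarrow> \<phi> N \<alpha> \<in> cvec N"
  using eigenbasis unfolding orthonormal_eigenbasis_def by blast

lemma \<phi>_orthonormal:
  "N \<in> \<N> \<Longrightarrow> \<alpha> \<in> {1..N} \<Longrightarrow> \<beta> \<in> {1..N} \<Longrightarrow>
    ell2_inner {1..N} (\<phi> N \<alpha>) (\<phi> N \<beta>) = (if \<alpha> = \<beta> then 1 else 0)"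
  using eigenbasis unfolding orthonormal_eigenbasis_def by blast

lemma \<phi>_nonzero:
  assumes "N \<in> \<N>" "\<alpha> \<in> {1..N}" shows "\<phi> N \<alpha> \<noteq> (\<lambda>x. 0)"
proof
  assume "\<phi> N \<alpha> = (\<lambda>x. 0)"
  then show False using \<phi>_orthonormal[OF assms assms(2)] by (simp add: ell2_inner_def)
qed

lemma \<phi>_eigen:
  assumes "N \<in> \<N>" "\<alpha> \<in> {1..N}"
  shows "\<pi>\<^sub>N N p (\<phi> N \<alpha>) = (\<lambda>x. of_real (ev N \<alpha>) * \<phi> N \<alpha> x)"
  using eigenbasis[OF assms(1)] assms(2) unfolding orthonormal_eigenbasis_def
  by (simp only: mat_vec_rep_matrix[OF action[OF assms(1)] p, symmetric])

lemma \<phi>_expansion: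
  assumes "N \<in> \<N>" "w \<in> cvec N"
  shows "w x = (\<Sum>\<alpha>\<in>{1..N}. (\<Sum>y\<in>{1..N}. cnj (\<phi> N \<alpha> y) * w y) * \<phi> N \<alpha> x)"
proof -
  let ?P = "\<lambda>w. \<forall>x. w x = (\<Sum>\<alpha>\<in>{1..N}. (\<Sum>y\<in>{1..N}. cnj (\<phi> N \<alpha> y) * w y) * \<phi> N \<alpha> x)"
  have "w \<in> cseq.span (\<phi> N ` {1..N})"
    using eigenbasis[OF assms(1)] assms(2) unfolding orthonormal_eigenbasis_def by blast
  then have "?P w"
  proof (rule cseq.span_induct)
    show "cseq.subspace (Collect ?P)"
    proof (rule cseq.subspaceI)
      show "0 \<in> Collect ?P" by simp
      fix f h assume f: "f \<in> Collect ?P" and h: "h \<in> Collect ?P"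
      show "f + h \<in> Collect ?P"
      proof (rule CollectI, rule allI)
        fix x
        have "(f + h) x = f x + h x" by simp
        also have "\<dots> = (\<Sum>\<alpha>\<in>{1..N}. (\<Sum>y\<in>{1..N}. cnj (\<phi> N \<alpha> y) * f y) * \<phi> N \<alpha> x)
            + (\<Sum>\<alpha>\<in>{1..N}. (\<Sum>y\<in>{1..N}. cnj (\<phi> N \<alpha> y) * h y) * \<phi> N \<alpha> x)"
          by (intro arg_cong2[where f="(+)"]) (use f h in blast)+
        finally show "(f + h) x = (\<Sum>\<alpha>\<in>{1..N}. (\<Sum>y\<in>{1..N}. cnj (\<phi> N \<alpha> y) * (f + h) y) * \<phi> N \<alpha> x)"
          by (simp add: distrib_left distrib_right sum.distrib)
      qed
      fix c
      show "(\<lambda>x. c * f x) \<in> Collect ?P"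
      proof (rule CollectI, rule allI)
        fix x
        have "c * f x = c * (\<Sum>\<alpha>\<in>{1..N}. (\<Sum>y\<in>{1..N}. cnj (\<phi> N \<alpha> y) * f y) * \<phi> N \<alpha> x)"
          using f by (intro arg_cong[where f="(*) c"]) blast
        also have "\<dots> = (\<Sum>\<alpha>\<in>{1..N}. (\<Sum>y\<in>{1..N}. cnj (\<phi> N \<alpha> y) * (c * f y)) * \<phi> N \<alpha> x)"
          by (simp add: sum_distrib_left sum_distrib_right mult_ac)
        finally show "c * f x = (\<Sum>\<alpha>\<in>{1..N}. (\<Sum>y\<in>{1..N}. cnj (\<phi> N \<alpha> y) * (c * f y)) * \<phi> N \<alpha> x)" .
      qed
    qed
    fix f assume "f \<in> \<phi> N ` {1..N}"
    then obtain \<beta> where \<beta>: "\<beta> \<in> {1..N}" "f = \<phi> N \<beta>" by blast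
    show "?P f"
    proof
      fix x
      have "(\<Sum>\<alpha>\<in>{1..N}. (\<Sum>y\<in>{1..N}. cnj (\<phi> N \<alpha> y) * f y) * \<phi> N \<alpha> x)
          = (\<Sum>\<alpha>\<in>{1..N}. if \<alpha> = \<beta> then \<phi> N \<alpha> x else 0)"
        using \<phi>_orthonormal[OF assms(1) _ \<beta>(1)] \<beta>(2)
        by (intro sum.cong refl) (simp add: ell2_finite(2))
      then show "f x = (\<Sum>\<alpha>\<in>{1..N}. (\<Sum>y\<in>{1..N}. cnj (\<phi> N \<alpha> y) * f y) * \<phi> N \<alpha> x)"
        using \<beta> by (simp del: One_nat_def)
    qed
  qed
  then show ?thesis by blast
qed

lemma \<phi>_complete:
  assumes "N \<in> \<N>" "x \<in> {1..N}" "y \<in> {1..N}"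
  shows "(\<Sum>\<alpha>\<in>{1..N}. cnj (\<phi> N \<alpha> y) * \<phi> N \<alpha> x) = (if x = y then 1 else 0)"
proof -
  have "delta y \<in> cvec N" using assms(3) by simp
  from \<phi>_expansion[OF assms(1) this, of x]
  have "delta y x = (\<Sum>\<alpha>\<in>{1..N}. (\<Sum>z\<in>{1..N}. if z = y then cnj (\<phi> N \<alpha> z) else 0) * \<phi> N \<alpha> x)"
    by (simp only: delta_def if_distrib mult_1_right mult_zero_right cong: if_cong)
  then show ?thesis using assms(3) by (simp add: delta_def del: One_nat_def)
qed

text \<open>Functional calculus through the eigenbasis agrees with evaluating the group algebra element; completeness
  of the basis is what turns one into the other.\<close>

lemma spectral_matrix:
  assumes N: "N \<in> \<N>" and q: "q \<in> group_algebra G"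
    and eig: "\<And>\<alpha>. \<alpha> \<in> {1..N} \<Longrightarrow> \<pi>\<^sub>N N q (\<phi> N \<alpha>) = (\<lambda>x. of_real (qs (ev N \<alpha>)) * \<phi> N \<alpha> x)"
    and x: "x \<in> {1..N}" and y: "y \<in> {1..N}"
  shows "(\<Sum>\<alpha>\<in>{1..N}. of_real (qs (ev N \<alpha>)) * \<phi> N \<alpha> x * cnj (\<phi> N \<alpha> y)) = rep_matrix (\<rho> N) q x y"
proof -
  let ?Q = "rep_matrix (\<rho> N) q"
  have "of_real (qs (ev N \<alpha>)) * \<phi> N \<alpha> x = (\<Sum>z\<in>{1..N}. ?Q x z * \<phi> N \<alpha> z)" if "\<alpha> \<in> {1..N}" for \<alpha>
  proof -
    have "mat_vec N ?Q (\<phi> N \<alpha>) x = of_real (qs (ev N \<alpha>)) * \<phi> N \<alpha> x"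
      using mat_vec_rep_matrix[OF action[OF N] q, of "\<phi> N \<alpha>"] eig[OF that] by simp
    then show ?thesis using x by (simp add: mat_vec_def)
  qed
  then have "(\<Sum>\<alpha>\<in>{1..N}. of_real (qs (ev N \<alpha>)) * \<phi> N \<alpha> x * cnj (\<phi> N \<alpha> y))
      = (\<Sum>\<alpha>\<in>{1..N}. \<Sum>z\<in>{1..N}. ?Q x z * (cnj (\<phi> N \<alpha> y) * \<phi> N \<alpha> z))"
    by (intro sum.cong refl) (simp add: sum_distrib_right sum_distrib_left mult_ac del: One_nat_def)
  also have "\<dots> = (\<Sum>z\<in>{1..N}. ?Q x z * (\<Sum>\<alpha>\<in>{1..N}. cnj (\<phi> N \<alpha> y) * \<phi> N \<alpha> z))"
    by (subst sum.swap) (simp add: sum_distrib_left)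
  also have "\<dots> = (\<Sum>z\<in>{1..N}. if z = y then ?Q x z else 0)"
    by (intro sum.cong refl) (use \<phi>_complete[OF N _ y] in auto)
  also have "\<dots> = ?Q x y" using y by simp
  finally show ?thesis .
qed

lemma rep_matrix_diagonal:
  assumes N: "N \<in> \<N>" and q: "q \<in> group_algebra G" and x: "x \<in> {1..N}"
  shows "\<pi>\<^sub>N N q (delta x) x = rep_matrix (\<rho> N) q x x"
proof -
  have "mat_vec N (rep_matrix (\<rho> N) q) (delta x) x = (\<Sum>y\<in>{1..N}. rep_matrix (\<rho> N) q x y * delta x y)"
    using x unfolding mat_vec_def by (rule if_P)
  also have "\<dots> = (\<Sum>y\<in>{1..N}. if y = x then rep_matrix (\<rho> N) q x y else 0)"
    by (intro sum.cong refl) (simp add: delta_def)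
  also have "\<dots> = rep_matrix (\<rho> N) q x x" using x by simp
  finally show ?thesis by (simp only: mat_vec_rep_matrix[OF action[OF N] q])
qed

lemma spectral_trace:
  assumes N: "N \<in> \<N>" and q: "q \<in> group_algebra G"
    and eig: "\<And>\<alpha>. \<alpha> \<in> {1..N} \<Longrightarrow> \<pi>\<^sub>N N q (\<phi> N \<alpha>) = (\<lambda>x. of_real (qs (ev N \<alpha>)) * \<phi> N \<alpha> x)"
  shows "(\<Sum>x\<in>{1..N}. \<pi>\<^sub>N N q (delta x) x) = of_real (\<Sum>\<alpha>\<in>{1..N}. qs (ev N \<alpha>))"
proof -
  have "(\<Sum>x\<in>{1..N}. \<pi>\<^sub>N N q (delta x) x)
      = (\<Sum>x\<in>{1..N}. \<Sum>\<alpha>\<in>{1..N}. of_real (qs (ev N \<alpha>)) * \<phi> N \<alpha> x * cnj (\<phi> N \<alpha> x))"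
    by (rule sum.cong[OF refl], subst rep_matrix_diagonal[OF N q], assumption,
        subst spectral_matrix[OF N q eig, symmetric], assumption+, rule refl)
  also have "\<dots> = (\<Sum>\<alpha>\<in>{1..N}. of_real (qs (ev N \<alpha>)) * (\<Sum>x\<in>{1..N}. cnj (\<phi> N \<alpha> x) * \<phi> N \<alpha> x))"
    by (subst sum.swap) (simp add: sum_distrib_left mult_ac)
  also have "\<dots> = (\<Sum>\<alpha>\<in>{1..N}. of_real (qs (ev N \<alpha>)))"
    by (intro sum.cong refl) (use \<phi>_orthonormal[OF N] in \<open>simp add: ell2_finite(2)\<close>)
  finally show ?thesis by simp
qed

text \<open>Parseval's identity, in the image of each eigenvector and then along each row of \<open>Z\<close>.\<close>

lemma Hilbert_Schmidt_eigenbasis: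
  assumes N: "N \<in> \<N>"
  shows "(\<Sum>\<alpha>\<in>{1..N}. \<Sum>\<beta>\<in>{1..N}. (cmod (mat_elem N (\<phi> N \<beta>) Z (\<phi> N \<alpha>)))\<^sup>2)
    = (\<Sum>x\<in>{1..N}. \<Sum>y\<in>{1..N}. (cmod (Z x y))\<^sup>2)"
proof -
  have parseval: "(\<Sum>\<alpha>\<in>{1..N}. (cmod (\<Sum>y\<in>{1..N}. cnj (\<phi> N \<alpha> y) * w y))\<^sup>2) = (\<Sum>y\<in>{1..N}. (cmod (w y))\<^sup>2)" for w
  proof -
    have "complex_of_real (\<Sum>\<alpha>\<in>{1..N}. (cmod (\<Sum>y\<in>{1..N}. cnj (\<phi> N \<alpha> y) * w y))\<^sup>2)
        = (\<Sum>\<alpha>\<in>{1..N}. (\<Sum>y\<in>{1..N}. cnj (\<phi> N \<alpha> y) * w y) * (\<Sum>z\<in>{1..N}. \<phi> N \<alpha> z * cnj (w z)))"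
      by (simp add: complex_norm_square del: of_real_power One_nat_def)
    also have "\<dots> = (\<Sum>\<alpha>\<in>{1..N}. \<Sum>y\<in>{1..N}. \<Sum>z\<in>{1..N}. (w y * cnj (w z)) * (cnj (\<phi> N \<alpha> y) * \<phi> N \<alpha> z))"
      unfolding sum_product by (intro sum.cong refl) (simp only: mult_ac)
    also have "\<dots> = (\<Sum>y\<in>{1..N}. \<Sum>z\<in>{1..N}. \<Sum>\<alpha>\<in>{1..N}. (w y * cnj (w z)) * (cnj (\<phi> N \<alpha> y) * \<phi> N \<alpha> z))"
      by (rule sum_swap3)
    also have "\<dots> = (\<Sum>y\<in>{1..N}. \<Sum>z\<in>{1..N}. (w y * cnj (w z)) * (if z = y then 1 else 0))"
      by (intro sum.cong refl) (simp only: sum_distrib_left[symmetric] \<phi>_complete[OF N])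
    also have "\<dots> = of_real (\<Sum>y\<in>{1..N}. (cmod (w y))\<^sup>2)"
      by (simp add: complex_norm_square if_distrib del: of_real_power cong: if_cong)
    finally show ?thesis using of_real_eq_iff by blast
  qed
  have "(\<Sum>\<beta>\<in>{1..N}. (cmod (mat_elem N (\<phi> N \<beta>) Z (\<phi> N \<alpha>)))\<^sup>2)
      = (\<Sum>x\<in>{1..N}. (cmod (\<Sum>y\<in>{1..N}. Z x y * \<phi> N \<alpha> y))\<^sup>2)" for \<alpha>
    using parseval[of "mat_vec N Z (\<phi> N \<alpha>)"]
    by (simp add: mat_elem_def ell2_finite(2) mat_vec_def del: One_nat_def)
  then have "(\<Sum>\<alpha>\<in>{1..N}. \<Sum>\<beta>\<in>{1..N}. (cmod (mat_elem N (\<phi> N \<beta>) Z (\<phi> N \<alpha>)))\<^sup>2)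
     = (\<Sum>x\<in>{1..N}. \<Sum>\<alpha>\<in>{1..N}. (cmod (\<Sum>y\<in>{1..N}. Z x y * \<phi> N \<alpha> y))\<^sup>2)"
    by (simp only:) (rule sum.swap)
  also have "\<dots> = (\<Sum>x\<in>{1..N}. \<Sum>y\<in>{1..N}. (cmod (Z x y))\<^sup>2)"
  proof (rule sum.cong[OF refl])
    fix x
    have "cmod (\<Sum>y\<in>{1..N}. Z x y * \<phi> N \<alpha> y) = cmod (\<Sum>y\<in>{1..N}. cnj (\<phi> N \<alpha> y) * cnj (Z x y))" for \<alpha>
      by (subst complex_mod_cnj[symmetric]) (simp add: mult.commute)
    then show "(\<Sum>\<alpha>\<in>{1..N}. (cmod (\<Sum>y\<in>{1..N}. Z x y * \<phi> N \<alpha> y))\<^sup>2) = (\<Sum>y\<in>{1..N}. (cmod (Z x y))\<^sup>2)"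
      using parseval[of "\<lambda>y. cnj (Z x y)"] by simp
  qed
  finally show ?thesis .
qed

section \<open>The variance of a translated multiplication operator\<close>

text \<open>The matrix element \<open>\<langle>\<phi>\<^sub>\<beta>, \<rho>(t)D\<phi>\<^sub>\<alpha>\<rangle>\<close>, where \<open>D\<close> is multiplication by \<open>v\<close>.\<close>

definition shift_elem :: "nat \<Rightarrow> 'a \<Rightarrow> (nat \<Rightarrow> complex) \<Rightarrow> nat \<Rightarrow> nat \<Rightarrow> complex" where
  "shift_elem N t v \<beta> \<alpha> = (\<Sum>y\<in>{1..N}. cnj (\<phi> N \<beta> (\<rho> N t y)) * v y * \<phi> N \<alpha> y)"

text \<open>The contribution to the trace of the words \<open>t\<^sup>-\<^sup>1gth\<close> that are not trivial in the group, with absolute values.\<close>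

definition remainder :: "'a \<Rightarrow> ('a \<Rightarrow> complex) \<Rightarrow> ('a \<Rightarrow> complex) \<Rightarrow> nat \<Rightarrow> real" where
  "remainder t q\<^sub>1 q\<^sub>2 N = (\<Sum>h\<in>supp q\<^sub>1. \<Sum>g\<in>supp q\<^sub>2. if inv t \<otimes> g \<otimes> t \<otimes> h = \<one> then 0
      else cmod (q\<^sub>1 h) * cmod (q\<^sub>2 g) * real (card (fixed N (inv t \<otimes> g \<otimes> t \<otimes> h))))"

lemma remainder_negligible:
  assumes "t \<in> carrier G" "q\<^sub>1 \<in> group_algebra G" "q\<^sub>2 \<in> group_algebra G"
  shows "negligible (remainder t q\<^sub>1 q\<^sub>2)"
  unfolding remainder_def
proof (intro negligible_sum)
  fix h g assume "h \<in> supp q\<^sub>1" "g \<in> supp q\<^sub>2"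
  then have "h \<in> carrier G" "g \<in> carrier G"
    using group_algebraD(2)[OF assms(2)] group_algebraD(2)[OF assms(3)] by auto
  then have "inv t \<otimes> g \<otimes> t \<otimes> h \<in> carrier G" using assms(1) by simp
  then show "negligible (\<lambda>N. if inv t \<otimes> g \<otimes> t \<otimes> h = \<one> then 0
      else cmod (q\<^sub>1 h) * cmod (q\<^sub>2 g) * real (card (fixed N (inv t \<otimes> g \<otimes> t \<otimes> h))))"
    by (cases "inv t \<otimes> g \<otimes> t \<otimes> h = \<one>") (auto intro: negligible_0 negligible_cmult fixed_negligible)
qed

text \<open>Both sides are the trace of \<open>\<rho>(q\<^sub>2)\<rho>(t)D\<rho>(q\<^sub>1)D\<^sup>*\<rho>(t)\<^sup>-\<^sup>1\<close>: on the left it is computed in the eigenbasis, on the right in the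
  basis of points, where a pair \<open>(h, g)\<close> contributes the fixed points of \<open>t\<^sup>-\<^sup>1gth\<close>.\<close>

lemma variance_as_trace:
  assumes N: "N \<in> \<N>" and q1: "q\<^sub>1 \<in> group_algebra G" and q2: "q\<^sub>2 \<in> group_algebra G" and t: "t \<in> carrier G"
    and eig1: "\<And>\<alpha>. \<alpha> \<in> {1..N} \<Longrightarrow> \<pi>\<^sub>N N q\<^sub>1 (\<phi> N \<alpha>) = (\<lambda>x. of_real (qs\<^sub>1 (ev N \<alpha>)) * \<phi> N \<alpha> x)"
    and eig2: "\<And>\<alpha>. \<alpha> \<in> {1..N} \<Longrightarrow> \<pi>\<^sub>N N q\<^sub>2 (\<phi> N \<alpha>) = (\<lambda>x. of_real (qs\<^sub>2 (ev N \<alpha>)) * \<phi> N \<alpha> x)"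
  shows "complex_of_real (\<Sum>\<alpha>\<in>{1..N}. \<Sum>\<beta>\<in>{1..N}. qs\<^sub>1 (ev N \<alpha>) * qs\<^sub>2 (ev N \<beta>) * (cmod (shift_elem N t v \<beta> \<alpha>))\<^sup>2)
    = (\<Sum>h\<in>supp q\<^sub>1. \<Sum>g\<in>supp q\<^sub>2. q\<^sub>1 h * q\<^sub>2 g *
        (\<Sum>y\<in>{1..N}. if \<rho> N (inv t \<otimes> g \<otimes> t \<otimes> h) y = y then v (\<rho> N h y) * cnj (v y) else 0))"
proof -
  interpret perm_action G "{1..N}" "\<rho> N" by (rule action[OF N])
  let ?X = "{1..N}" and ?Q1 = "rep_matrix (\<rho> N) q\<^sub>1" and ?Q2 = "rep_matrix (\<rho> N) q\<^sub>2"
  let ?\<tau> = "\<rho> N t"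
  have \<tau>: "?\<tau> y \<in> ?X" if "y \<in> ?X" for y using act_closed[OF t that] .
  have sq: "complex_of_real ((cmod (shift_elem N t v \<beta> \<alpha>))\<^sup>2)
      = (\<Sum>y\<in>?X. \<Sum>z\<in>?X. (v y * cnj (v z)) * (\<phi> N \<alpha> y * cnj (\<phi> N \<alpha> z)) * (\<phi> N \<beta> (?\<tau> z) * cnj (\<phi> N \<beta> (?\<tau> y))))" for \<alpha> \<beta>
    unfolding complex_norm_square shift_elem_def cnj_sum sum_product by (simp add: mult_ac)
  have "complex_of_real (\<Sum>\<alpha>\<in>?X. \<Sum>\<beta>\<in>?X. qs\<^sub>1 (ev N \<alpha>) * qs\<^sub>2 (ev N \<beta>) * (cmod (shift_elem N t v \<beta> \<alpha>))\<^sup>2)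
      = (\<Sum>\<alpha>\<in>?X. \<Sum>\<beta>\<in>?X. \<Sum>y\<in>?X. \<Sum>z\<in>?X. (v y * cnj (v z)) *
          ((of_real (qs\<^sub>1 (ev N \<alpha>)) * \<phi> N \<alpha> y * cnj (\<phi> N \<alpha> z)) *
           (of_real (qs\<^sub>2 (ev N \<beta>)) * \<phi> N \<beta> (?\<tau> z) * cnj (\<phi> N \<beta> (?\<tau> y)))))"
    unfolding of_real_sum of_real_mult sq sum_distrib_left by (intro sum.cong refl) (simp only: mult_ac)
  also have "\<dots> = (\<Sum>y\<in>?X. \<Sum>z\<in>?X. \<Sum>\<alpha>\<in>?X. \<Sum>\<beta>\<in>?X. (v y * cnj (v z)) *
          ((of_real (qs\<^sub>1 (ev N \<alpha>)) * \<phi> N \<alpha> y * cnj (\<phi> N \<alpha> z)) *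
           (of_real (qs\<^sub>2 (ev N \<beta>)) * \<phi> N \<beta> (?\<tau> z) * cnj (\<phi> N \<beta> (?\<tau> y)))))"
  proof -
    have swap4: "(\<Sum>\<alpha>\<in>A. \<Sum>\<beta>\<in>A. \<Sum>y\<in>A. \<Sum>z\<in>A. f \<alpha> \<beta> y z) = (\<Sum>y\<in>A. \<Sum>z\<in>A. \<Sum>\<alpha>\<in>A. \<Sum>\<beta>\<in>A. f \<alpha> \<beta> y z)"
      for A and f :: "nat \<Rightarrow> nat \<Rightarrow> nat \<Rightarrow> nat \<Rightarrow> complex"
    proof -
      have "(\<Sum>\<alpha>\<in>A. \<Sum>\<beta>\<in>A. \<Sum>y\<in>A. \<Sum>z\<in>A. f \<alpha> \<beta> y z) = (\<Sum>\<alpha>\<in>A. \<Sum>y\<in>A. \<Sum>z\<in>A. \<Sum>\<beta>\<in>A. f \<alpha> \<beta> y z)"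
        by (rule sum.cong[OF refl], rule sum_swap3)
      also have "\<dots> = (\<Sum>y\<in>A. \<Sum>z\<in>A. \<Sum>\<alpha>\<in>A. \<Sum>\<beta>\<in>A. f \<alpha> \<beta> y z)" by (rule sum_swap3)
      finally show ?thesis .
    qed
    show ?thesis by (rule swap4)
  qed
  also have "\<dots> = (\<Sum>y\<in>?X. \<Sum>z\<in>?X. (v y * cnj (v z)) *
      ((\<Sum>\<alpha>\<in>?X. of_real (qs\<^sub>1 (ev N \<alpha>)) * \<phi> N \<alpha> y * cnj (\<phi> N \<alpha> z)) *
       (\<Sum>\<beta>\<in>?X. of_real (qs\<^sub>2 (ev N \<beta>)) * \<phi> N \<beta> (?\<tau> z) * cnj (\<phi> N \<beta> (?\<tau> y)))))"
    by (intro sum.cong refl) (simp only: sum_product, simp only: sum_distrib_left)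
  also have "\<dots> = (\<Sum>y\<in>?X. \<Sum>z\<in>?X. (v y * cnj (v z)) * (?Q1 y z * ?Q2 (?\<tau> z) (?\<tau> y)))"
    by (intro sum.cong refl) (simp only: spectral_matrix[OF N q1 eig1] spectral_matrix[OF N q2 eig2] \<tau>)
  also have "\<dots> = (\<Sum>z\<in>?X. \<Sum>h\<in>supp q\<^sub>1. \<Sum>y\<in>?X. if y = \<rho> N h z then
      (v y * cnj (v z)) * (q\<^sub>1 h * ?Q2 (?\<tau> z) (?\<tau> y)) else 0)"
  proof -
    have "(v y * cnj (v z)) * (?Q1 y z * ?Q2 (?\<tau> z) (?\<tau> y)) = (\<Sum>h\<in>supp q\<^sub>1. if y = \<rho> N h z then
      (v y * cnj (v z)) * (q\<^sub>1 h * ?Q2 (?\<tau> z) (?\<tau> y)) else 0)" for y z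
      unfolding rep_matrix_def[of "\<rho> N" q\<^sub>1] perm_matrix_def sum_distrib_right sum_distrib_left
      by (intro sum.cong) auto
    then show ?thesis
      by (simp only:) (rule trans[OF sum.swap], rule sum.cong[OF refl], rule sum.swap)
  qed
  also have "\<dots> = (\<Sum>z\<in>?X. \<Sum>h\<in>supp q\<^sub>1. (v (\<rho> N h z) * cnj (v z)) * (q\<^sub>1 h * ?Q2 (?\<tau> z) (?\<tau> (\<rho> N h z))))"
  proof (intro sum.cong refl)
    fix z h assume "z \<in> ?X" "h \<in> supp q\<^sub>1"
    then have "\<rho> N h z \<in> ?X" by (intro act_closed group_algebraD(2)[OF q1])
    then show "(\<Sum>y\<in>?X. if y = \<rho> N h z then (v y * cnj (v z)) * (q\<^sub>1 h * ?Q2 (?\<tau> z) (?\<tau> y)) else 0)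
        = (v (\<rho> N h z) * cnj (v z)) * (q\<^sub>1 h * ?Q2 (?\<tau> z) (?\<tau> (\<rho> N h z)))" by (simp del: One_nat_def)
  qed
  also have "\<dots> = (\<Sum>z\<in>?X. \<Sum>h\<in>supp q\<^sub>1. \<Sum>g\<in>supp q\<^sub>2. q\<^sub>1 h * q\<^sub>2 g *
        (if \<rho> N (inv t \<otimes> g \<otimes> t \<otimes> h) z = z then v (\<rho> N h z) * cnj (v z) else 0))"
  proof (intro sum.cong refl)
    fix z h assume z: "z \<in> ?X" and "h \<in> supp q\<^sub>1"
    then have h: "h \<in> carrier G" "\<rho> N h z \<in> ?X"
      using group_algebraD(2)[OF q1] act_closed[OF group_algebraD(2)[OF q1] z] by blast+
    have "?\<tau> z = \<rho> N g (?\<tau> (\<rho> N h z)) \<longleftrightarrow> \<rho> N (inv t \<otimes> g \<otimes> t \<otimes> h) z = z" if "g \<in> carrier G" for g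
    proof -
      let ?w = "\<rho> N g (?\<tau> (\<rho> N h z))"
      have "\<rho> N (inv t \<otimes> g \<otimes> t \<otimes> h) z = \<rho> N (inv t) ?w"
        using z h t that by (simp add: act_mult act_closed del: One_nat_def atLeastAtMost_iff)
      moreover have "?w = ?\<tau> z \<longleftrightarrow> z = \<rho> N (inv t) ?w"
        by (rule act_eq_iff[OF t act_closed[OF that \<tau>[OF h(2)]] z])
      ultimately show ?thesis by (simp only: eq_commute)
    qed
    then show "(v (\<rho> N h z) * cnj (v z)) * (q\<^sub>1 h * ?Q2 (?\<tau> z) (?\<tau> (\<rho> N h z)))
        = (\<Sum>g\<in>supp q\<^sub>2. q\<^sub>1 h * q\<^sub>2 g * (if \<rho> N (inv t \<otimes> g \<otimes> t \<otimes> h) z = z then v (\<rho> N h z) * cnj (v z) else 0))"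
      unfolding rep_matrix_def perm_matrix_def sum_distrib_left
      using group_algebraD(2)[OF q2] by (intro sum.cong) auto
  qed
  also have "\<dots> = (\<Sum>h\<in>supp q\<^sub>1. \<Sum>g\<in>supp q\<^sub>2. q\<^sub>1 h * q\<^sub>2 g *
        (\<Sum>y\<in>?X. if \<rho> N (inv t \<otimes> g \<otimes> t \<otimes> h) y = y then v (\<rho> N h y) * cnj (v y) else 0))"
    unfolding sum_distrib_left by (rule sum_swap3)
  finally show ?thesis .
qed

end

locale fg_eigen_sequence = eigen_sequence G \<N> \<rho> p ev \<phi> + finitely_generated G S
  for G (structure) and \<N> \<rho> p ev \<phi> S
begin

text \<open>The pairs with \<open>t\<^sup>-\<^sup>1gth = e\<close>, that is \<open>g = th\<^sup>-\<^sup>1t\<^sup>-\<^sup>1\<close>, assemble to \<open>\<langle>v, \<rho>(A)v\<rangle>\<close> with \<open>A\<close> the kernel; every other pair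
  only sees the fixed points of a nontrivial element.\<close>

lemma variance_kernel:
  assumes N: "N \<in> \<N>" and q1: "q\<^sub>1 \<in> group_algebra G" and q2: "q\<^sub>2 \<in> group_algebra G" and t: "t \<in> carrier G"
    and eig1: "\<And>\<alpha>. \<alpha> \<in> {1..N} \<Longrightarrow> \<pi>\<^sub>N N q\<^sub>1 (\<phi> N \<alpha>) = (\<lambda>x. of_real (qs\<^sub>1 (ev N \<alpha>)) * \<phi> N \<alpha> x)"
    and eig2: "\<And>\<alpha>. \<alpha> \<in> {1..N} \<Longrightarrow> \<pi>\<^sub>N N q\<^sub>2 (\<phi> N \<alpha>) = (\<lambda>x. of_real (qs\<^sub>2 (ev N \<alpha>)) * \<phi> N \<alpha> x)"
    and v: "\<And>x. x \<in> {1..N} \<Longrightarrow> cmod (v x) \<le> 1"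
  shows "(\<Sum>\<alpha>\<in>{1..N}. \<Sum>\<beta>\<in>{1..N}. qs\<^sub>1 (ev N \<alpha>) * qs\<^sub>2 (ev N \<beta>) * (cmod (shift_elem N t v \<beta> \<alpha>))\<^sup>2)
    \<le> cmod (ell2_inner {1..N} v (\<pi>\<^sub>N N (kernel t q\<^sub>1 q\<^sub>2) v)) + remainder t q\<^sub>1 q\<^sub>2 N"
proof -
  interpret perm_action G "{1..N}" "\<rho> N" by (rule action[OF N])
  let ?X = "{1..N}"
  let ?s = "\<lambda>h g. \<Sum>y\<in>?X. if \<rho> N (inv t \<otimes> g \<otimes> t \<otimes> h) y = y then v (\<rho> N h y) * cnj (v y) else 0"
  let ?one = "\<lambda>h g. inv t \<otimes> g \<otimes> t \<otimes> h = \<one>"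
  let ?L = "\<Sum>\<alpha>\<in>?X. \<Sum>\<beta>\<in>?X. qs\<^sub>1 (ev N \<alpha>) * qs\<^sub>2 (ev N \<beta>) * (cmod (shift_elem N t v \<beta> \<alpha>))\<^sup>2"
  define main where "main = (\<Sum>h\<in>supp q\<^sub>1. \<Sum>g\<in>supp q\<^sub>2. if ?one h g then q\<^sub>1 h * q\<^sub>2 g * ?s h g else 0)"
  define rest where "rest = (\<Sum>h\<in>supp q\<^sub>1. \<Sum>g\<in>supp q\<^sub>2. if ?one h g then 0 else q\<^sub>1 h * q\<^sub>2 g * ?s h g)"
  have "complex_of_real ?L = (\<Sum>h\<in>supp q\<^sub>1. \<Sum>g\<in>supp q\<^sub>2. q\<^sub>1 h * q\<^sub>2 g * ?s h g)"
    by (rule variance_as_trace[OF N q1 q2 t eig1 eig2])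
  also have "\<dots> = main + rest"
    unfolding main_def rest_def sum.distrib[symmetric] by (intro sum.cong refl) auto
  finally have split: "complex_of_real ?L = main + rest" .
  have main: "main = ell2_inner ?X v (\<pi>\<^sub>N N (kernel t q\<^sub>1 q\<^sub>2) v)"
  proof -
    have "(\<Sum>g\<in>supp q\<^sub>2. if ?one h g then q\<^sub>1 h * q\<^sub>2 g * ?s h g else 0)
        = (\<Sum>y\<in>?X. cnj (v y) * (kernel t q\<^sub>1 q\<^sub>2 (inv h) * v (\<rho> N h y)))" if "h \<in> supp q\<^sub>1" for h
    proof -
      have h: "h \<in> carrier G" using group_algebraD(2)[OF q1 that] .
      let ?g = "t \<otimes> inv h \<otimes> inv t"
      have eq: "?one h g \<longleftrightarrow> g = ?g" if "g \<in> carrier G" for g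
      proof -
        have "?one h g \<longleftrightarrow> inv t \<otimes> g \<otimes> t = inv h"
          using h t that by (metis inv_closed inv_equality inv_inv l_inv m_closed)
        also have "\<dots> \<longleftrightarrow> g \<otimes> t = t \<otimes> inv h" using h t that by (metis inv_closed inv_solve_left m_assoc m_closed)
        also have "\<dots> \<longleftrightarrow> g = ?g" using h t that by (metis inv_closed inv_solve_right m_closed)
        finally show ?thesis .
      qed
      have one: "?one h ?g" using eq[of ?g] h t by simp
      have "(\<Sum>g\<in>supp q\<^sub>2. if ?one h g then q\<^sub>1 h * q\<^sub>2 g * ?s h g else 0)
          = (\<Sum>g\<in>supp q\<^sub>2. if g = ?g then q\<^sub>1 h * q\<^sub>2 g * ?s h g else 0)"
        by (intro sum.cong refl) (simp add: eq group_algebraD(2)[OF q2])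
      also have "\<dots> = q\<^sub>1 h * q\<^sub>2 ?g * ?s h ?g"
        using group_algebraD(1)[OF q2] by (auto simp: supp_def)
      also have "\<dots> = (\<Sum>y\<in>?X. cnj (v y) * (kernel t q\<^sub>1 q\<^sub>2 (inv h) * v (\<rho> N h y)))"
        unfolding one sum_distrib_left
        by (intro sum.cong refl) (use h in \<open>simp add: act_one kernel_def\<close>)
      finally show ?thesis .
    qed
    then have "main = (\<Sum>h\<in>supp q\<^sub>1. \<Sum>y\<in>?X. cnj (v y) * (kernel t q\<^sub>1 q\<^sub>2 (inv h) * v (\<rho> N h y)))"
      unfolding main_def by (intro sum.cong refl) 
    also have "\<dots> = (\<Sum>y\<in>?X. cnj (v y) * (\<Sum>h\<in>supp q\<^sub>1. kernel t q\<^sub>1 q\<^sub>2 (inv h) * v (\<rho> N h y)))"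
      by (subst sum.swap) (simp add: sum_distrib_left)
    also have "\<dots> = (\<Sum>y\<in>?X. cnj (v y) * \<pi>\<^sub>N N (kernel t q\<^sub>1 q\<^sub>2) v y)"
    proof (intro sum.cong refl arg_cong2[where f="(*)"])
      fix y assume y: "y \<in> ?X"
      have inj: "inj_on (m_inv G) (supp q\<^sub>1)"
        by (rule inj_onI) (metis inv_inv group_algebraD(2)[OF q1])
      have "supp (kernel t q\<^sub>1 q\<^sub>2) \<subseteq> m_inv G ` supp q\<^sub>1"
      proof
        fix k assume "k \<in> supp (kernel t q\<^sub>1 q\<^sub>2)"
        then have "k \<in> carrier G" "inv k \<in> supp q\<^sub>1" by (auto simp: supp_def kernel_def split: if_splits)
        then show "k \<in> m_inv G ` supp q\<^sub>1" by (intro image_eqI[of k _ "inv k"]) auto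
      qed
      then have "\<pi>\<^sub>N N (kernel t q\<^sub>1 q\<^sub>2) v y
          = (\<Sum>k\<in>m_inv G ` supp q\<^sub>1. kernel t q\<^sub>1 q\<^sub>2 k * v (\<rho> N (inv k) y))"
        by (intro perm_op_alt) (use group_algebraD(1)[OF q1] y in auto)
      also have "\<dots> = (\<Sum>h\<in>supp q\<^sub>1. kernel t q\<^sub>1 q\<^sub>2 (inv h) * v (\<rho> N h y))"
        unfolding sum.reindex[OF inj] o_def by (intro sum.cong refl) (simp add: group_algebraD(2)[OF q1])
      finally show "(\<Sum>h\<in>supp q\<^sub>1. kernel t q\<^sub>1 q\<^sub>2 (inv h) * v (\<rho> N h y)) = \<pi>\<^sub>N N (kernel t q\<^sub>1 q\<^sub>2) v y" by simp
    qed
    finally show ?thesis by (simp add: ell2_finite(2))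
  qed
  have "cmod rest \<le> remainder t q\<^sub>1 q\<^sub>2 N"
    unfolding rest_def remainder_def
  proof (intro sum_norm_le)
    fix h g assume h: "h \<in> supp q\<^sub>1" and g: "g \<in> supp q\<^sub>2"
    have hc: "h \<in> carrier G" using group_algebraD(2)[OF q1 h] .
    have "cmod (?s h g) \<le> (\<Sum>y\<in>?X. if \<rho> N (inv t \<otimes> g \<otimes> t \<otimes> h) y = y then 1 else 0)"
    proof (rule sum_norm_le)
      fix y assume y: "y \<in> ?X"
      have "cmod (v (\<rho> N h y) * cnj (v y)) \<le> 1 * 1"
        unfolding norm_mult complex_mod_cnj using v y act_closed[OF hc y] by (intro mult_mono) auto
      then show "cmod (if \<rho> N (inv t \<otimes> g \<otimes> t \<otimes> h) y = y then v (\<rho> N h y) * cnj (v y) else 0)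
        \<le> (if \<rho> N (inv t \<otimes> g \<otimes> t \<otimes> h) y = y then 1 else 0)" by simp
    qed
    also have "\<dots> = real (card (fixed N (inv t \<otimes> g \<otimes> t \<otimes> h)))"
      by (subst sum.If_cases) (auto simp: fixed_def Int_def)
    finally show "cmod (if ?one h g then 0 else q\<^sub>1 h * q\<^sub>2 g * ?s h g) \<le> (if ?one h g then 0
        else cmod (q\<^sub>1 h) * cmod (q\<^sub>2 g) * real (card (fixed N (inv t \<otimes> g \<otimes> t \<otimes> h))))"
      by (simp add: norm_mult mult_left_mono)
  qed
  moreover have "?L \<le> cmod (complex_of_real ?L)" by (simp only: norm_of_real abs_ge_self)
  moreover have "cmod (complex_of_real ?L) \<le> cmod main + cmod rest" unfolding split by (rule norm_triangle_ineq)
  ultimately show ?thesis unfolding main by linarith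
qed

end

section \<open>Eigenvalue counts and variances in a spectral window\<close>

text \<open>The hypotheses on \<open>\<Gamma>\<close> and \<open>p\<close> in the form in which they are used: rapid decay as a bound by weighted \<open>\<ell>\<^sup>2\<close> norms, and
  the fourth-power condition as a bound \<open>\<delta>(\<eta>)\<close> on finite sums, uniform in the energy, for all \<open>\<eta>\<close> below a
  threshold \<open>\<eta>\<^sub>0\<close>.\<close>

locale quantum_setting = fg_eigen_sequence +
  fixes I\<^sub>0 :: "real set" and C\<^sub>0 c C\<^sub>2 \<eta>\<^sub>0 :: real and \<delta> :: "real \<Rightarrow> real"
  assumes p_star: "p = ga_star G p" and C0: "1 \<le> C\<^sub>0" and c: "0 < c" and C\<^sub>2: "0 < C\<^sub>2"
    and \<eta>0: "0 < \<eta>\<^sub>0" "\<eta>\<^sub>0 \<le> 1"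
    and AC: "\<And>E \<eta>. E \<in> I\<^sub>0 \<Longrightarrow> 0 < \<eta> \<Longrightarrow> \<eta> \<le> 1 \<Longrightarrow>
      1 / C\<^sub>0 \<le> Re (ImR G p (Complex E \<eta>) \<one> \<one>) \<and> Re (ImR G p (Complex E \<eta>) \<one> \<one>) \<le> C\<^sub>0"
    and R4: "\<And>E \<eta> F. E \<in> I\<^sub>0 \<Longrightarrow> 0 < \<eta> \<Longrightarrow> \<eta> < \<eta>\<^sub>0 \<Longrightarrow> finite F \<Longrightarrow> F \<subseteq> carrier G \<Longrightarrow>
      (\<Sum>g\<in>F. \<eta>\<^sup>2 * cmod (ImR G p (Complex E \<eta>) \<one> g) ^ 4 * real (wl g) powr c) \<le> \<delta> \<eta>"
    and \<delta>_lim: "(\<delta> \<longlongrightarrow> 0) (at_right 0)"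
    and RD: "\<And>A f. A \<in> group_algebra G \<Longrightarrow> f \<in> ell2 (carrier G) \<Longrightarrow>
      ell2_norm (carrier G) (left_regular G A f)
        \<le> C\<^sub>2 * sqrt (\<Sum>g\<in>supp A. (1 + real (wl g)) powr c * (cmod (A g))\<^sup>2) * ell2_norm (carrier G) f"
begin

definition window :: "nat \<Rightarrow> real \<Rightarrow> real \<Rightarrow> nat set" where
  "window N E \<eta> = spec_indices N (ev N) {E - \<eta>..E + \<eta>}"

lemma window_finite [simp]: "finite (window N E \<eta>)"
  and window_subset: "window N E \<eta> \<subseteq> {1..N}"
  by (auto simp: window_def spec_indices_def)

abbreviation "lorentz E \<eta> x \<equiv> \<eta> / ((x - E)\<^sup>2 + \<eta>\<^sup>2)"

lemma window_approximant:
  assumes E: "E \<in> I\<^sub>0" and \<eta>: "0 < \<eta>" "\<eta> < \<eta>\<^sub>0"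
  obtains q qs where "q \<in> group_algebra G"
    "1 / (2 * C\<^sub>0) \<le> Re (q \<one>)" "Re (q \<one>) \<le> 2 * C\<^sub>0"
    "weight4 c q \<le> 8 * (C\<^sub>0 ^ 4 + 2 powr c * \<delta> \<eta> / \<eta>\<^sup>2 + 1)"
    "\<And>N \<alpha>. N \<in> \<N> \<Longrightarrow> \<alpha> \<in> {1..N} \<Longrightarrow> \<pi>\<^sub>N N q (\<phi> N \<alpha>) = (\<lambda>x. of_real (qs (ev N \<alpha>)) * \<phi> N \<alpha> x)"
    "\<And>N \<alpha>. N \<in> \<N> \<Longrightarrow> \<alpha> \<in> {1..N} \<Longrightarrow> qs (ev N \<alpha>) \<le> lorentz E \<eta> (ev N \<alpha>)"
    "\<And>N \<alpha>. N \<in> \<N> \<Longrightarrow> \<alpha> \<in> {1..N} \<Longrightarrow> lorentz E \<eta> (ev N \<alpha>) / 2 \<le> qs (ev N \<alpha>)"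
proof -
  have ac: "1 / C\<^sub>0 \<le> Re (ImR G p (Complex E \<eta>) \<one> \<one>)" "Re (ImR G p (Complex E \<eta>) \<one> \<one>) \<le> C\<^sub>0"
    using AC[OF E \<eta>(1)] \<eta> \<eta>0 by auto
  obtain q qs where q: "q \<in> group_algebra G"
    "1 / (2 * C\<^sub>0) \<le> Re (q \<one>)" "Re (q \<one>) \<le> 2 * C\<^sub>0"
    "weight4 c q \<le> 8 * (C\<^sub>0 ^ 4 + 2 powr c * \<delta> \<eta> / \<eta>\<^sup>2 + 1)"
    and eig: "\<And>(X :: nat set) act \<phi> l. perm_action G X act \<Longrightarrow> \<phi> \<in> ell2 X \<Longrightarrow> \<phi> \<noteq> (\<lambda>x. 0) \<Longrightarrow>
        perm_op G X act p \<phi> = (\<lambda>x. of_real l * \<phi> x) \<Longrightarrow>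
        perm_op G X act q \<phi> = (\<lambda>x. of_real (qs l) * \<phi> x) \<and>
        qs l \<le> \<eta> / ((l - E)\<^sup>2 + \<eta>\<^sup>2) \<and> \<eta> / ((l - E)\<^sup>2 + \<eta>\<^sup>2) / 2 \<le> qs l"
    by (rule polynomial_approximant[where \<delta>="\<delta> \<eta>", OF p p_star \<eta>(1) C0 c ac R4[OF E \<eta>]]) blast+
  note e = eig[OF action \<phi>_cvec \<phi>_nonzero \<phi>_eigen]
  show thesis
  proof (rule that[OF q])
    fix N \<alpha> assume N: "N \<in> \<N>" "\<alpha> \<in> {1..N}"
    show "\<pi>\<^sub>N N q (\<phi> N \<alpha>) = (\<lambda>x. of_real (qs (ev N \<alpha>)) * \<phi> N \<alpha> x)"
      "qs (ev N \<alpha>) \<le> lorentz E \<eta> (ev N \<alpha>)" "lorentz E \<eta> (ev N \<alpha>) / 2 \<le> qs (ev N \<alpha>)"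
      using e[OF N(1) N N N] by auto
  qed
qed

lemma spectral_average:
  assumes q: "q \<in> group_algebra G"
    and eig: "\<And>N \<alpha>. N \<in> \<N> \<Longrightarrow> \<alpha> \<in> {1..N} \<Longrightarrow> \<pi>\<^sub>N N q (\<phi> N \<alpha>) = (\<lambda>x. of_real (qs (ev N \<alpha>)) * \<phi> N \<alpha> x)"
  shows "((\<lambda>N. (\<Sum>\<alpha>\<in>{1..N}. qs (ev N \<alpha>)) / real N) \<longlongrightarrow> Re (q \<one>)) (along \<N>)"
proof -
  have "((\<lambda>N. Re ((\<Sum>x\<in>{1..N}. \<pi>\<^sub>N N q (delta x) x) / of_nat N)) \<longlongrightarrow> Re (q \<one>)) (along \<N>)"
    by (intro tendsto_intros trace_limit q)
  moreover have "\<forall>\<^sub>F N in along \<N>. Re ((\<Sum>x\<in>{1..N}. \<pi>\<^sub>N N q (delta x) x) / of_nat N)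
      = (\<Sum>\<alpha>\<in>{1..N}. qs (ev N \<alpha>)) / real N"
    using eventually_pos
  proof eventually_elim
    case (elim N)
    then have "(\<Sum>x\<in>{1..N}. \<pi>\<^sub>N N q (delta x) x) = of_real (\<Sum>\<alpha>\<in>{1..N}. qs (ev N \<alpha>))"
      by (intro spectral_trace q eig) auto
    then show ?case by (simp only: Re_divide_of_nat Re_complex_of_real)
  qed
  ultimately show ?thesis by (rule Lim_transform_eventually)
qed

text \<open>By the bounds on the density of states, the average of a Lorentzian over the spectrum of \<open>\<rho>\<^sub>N(p)\<close> lies between two
  constants at every scale.  The Lorentzian of the much smaller width \<open>\<epsilon>\<eta>\<close> is at most \<open>1/(\<epsilon>\<eta>)\<close>, and outside the
  window it is dominated by \<open>2\<epsilon>\<close> times the Lorentzian of width \<open>\<eta>\<close>; so a definite part of its average must come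
  from eigenvalues inside the window.\<close>

lemma count_lower:
  obtains \<kappa> where "0 < \<kappa>"
    "\<And>E \<eta>. E \<in> I\<^sub>0 \<Longrightarrow> 0 < \<eta> \<Longrightarrow> \<eta> < \<eta>\<^sub>0 \<Longrightarrow>
      \<forall>\<^sub>F N in along \<N>. \<kappa> * \<eta> * real N \<le> real (card (window N E \<eta>))"
proof
  \<comment> \<open>With averages at least \<open>1/(3C\<^sub>0)\<close> and at most \<open>3C\<^sub>0\<close>, this makes the part outside the window,
    \<open>4\<epsilon> \<cdot> 3C\<^sub>0\<close>, half of the total.\<close>
  define \<epsilon> where "\<epsilon> = 1 / (72 * C\<^sub>0\<^sup>2)"
  have "1 \<le> C\<^sub>0\<^sup>2" using C0 by (simp add: one_le_power)
  then have "1 < 72 * C\<^sub>0\<^sup>2" by linarith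
  then have \<epsilon>: "0 < \<epsilon>" "\<epsilon> < 1" using C0 by (auto simp: \<epsilon>_def)
  show "0 < \<epsilon> / (6 * C\<^sub>0)" using \<epsilon> C0 by simp
  fix E \<eta> assume E: "E \<in> I\<^sub>0" and \<eta>: "0 < \<eta>" "\<eta> < \<eta>\<^sub>0"
  let ?\<eta>' = "\<epsilon> * \<eta>"
  have "?\<eta>' < 1 * \<eta>" by (rule mult_strict_right_mono) (use \<epsilon> \<eta> in auto)
  then have "?\<eta>' < \<eta>\<^sub>0" using \<eta>(2) by linarith
  then have \<eta>': "0 < ?\<eta>'" "?\<eta>' < \<eta>\<^sub>0" using \<epsilon>(1) \<eta>(1) by simp_all
  obtain q qs where q: "q \<in> group_algebra G" "Re (q \<one>) \<le> 2 * C\<^sub>0"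
    "\<And>N \<alpha>. N \<in> \<N> \<Longrightarrow> \<alpha> \<in> {1..N} \<Longrightarrow> \<pi>\<^sub>N N q (\<phi> N \<alpha>) = (\<lambda>x. of_real (qs (ev N \<alpha>)) * \<phi> N \<alpha> x)"
    "\<And>N \<alpha>. N \<in> \<N> \<Longrightarrow> \<alpha> \<in> {1..N} \<Longrightarrow> lorentz E \<eta> (ev N \<alpha>) / 2 \<le> qs (ev N \<alpha>)"
    by (rule window_approximant[OF E \<eta>]) blast
  obtain r rs where r: "r \<in> group_algebra G" "1 / (2 * C\<^sub>0) \<le> Re (r \<one>)"
    "\<And>N \<alpha>. N \<in> \<N> \<Longrightarrow> \<alpha> \<in> {1..N} \<Longrightarrow> \<pi>\<^sub>N N r (\<phi> N \<alpha>) = (\<lambda>x. of_real (rs (ev N \<alpha>)) * \<phi> N \<alpha> x)"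
    "\<And>N \<alpha>. N \<in> \<N> \<Longrightarrow> \<alpha> \<in> {1..N} \<Longrightarrow> rs (ev N \<alpha>) \<le> lorentz E ?\<eta>' (ev N \<alpha>)"
    by (rule window_approximant[OF E \<eta>']) blast
  have "\<forall>\<^sub>F N in along \<N>. (\<Sum>\<alpha>\<in>{1..N}. qs (ev N \<alpha>)) / real N < 3 * C\<^sub>0"
    by (rule order_tendstoD(2)[OF spectral_average[OF q(1,3)]]) (use q(2) C0 in auto)
  moreover have "\<forall>\<^sub>F N in along \<N>. 1 / (3 * C\<^sub>0) < (\<Sum>\<alpha>\<in>{1..N}. rs (ev N \<alpha>)) / real N"
  proof (rule order_tendstoD(1)[OF spectral_average[OF r(1,3)]])
    have "1 / (3 * C\<^sub>0) < 1 / (2 * C\<^sub>0)" using C0 by (intro divide_strict_left_mono) auto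
    then show "1 / (3 * C\<^sub>0) < Re (r \<one>)" using r(2) by simp
  qed
  ultimately show "\<forall>\<^sub>F N in along \<N>. \<epsilon> / (6 * C\<^sub>0) * \<eta> * real N \<le> real (card (window N E \<eta>))"
    using eventually_pos
  proof eventually_elim
    case (elim N)
    then have N: "N \<in> \<N>" "0 < real N" by auto
    let ?J = "window N E \<eta>"
    have up: "(\<Sum>\<alpha>\<in>{1..N}. qs (ev N \<alpha>)) \<le> 3 * C\<^sub>0 * real N"
      using elim N by (simp add: pos_divide_less_eq)
    have low: "real N / (3 * C\<^sub>0) \<le> (\<Sum>\<alpha>\<in>{1..N}. rs (ev N \<alpha>))"
      using elim N by (simp add: pos_less_divide_eq)
    have qs0: "0 \<le> qs (ev N \<alpha>)" if "\<alpha> \<in> {1..N}" for \<alpha>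
      using q(4)[OF N(1) that] \<eta> by (smt (verit) divide_nonneg_nonneg zero_le_power2)
    have "(\<Sum>\<alpha>\<in>{1..N}. rs (ev N \<alpha>)) \<le> (\<Sum>\<alpha>\<in>{1..N}. (if \<alpha> \<in> ?J then 1 / ?\<eta>' else 0) + 4 * \<epsilon> * qs (ev N \<alpha>))"
    proof (rule sum_mono)
      fix \<alpha> assume \<alpha>: "\<alpha> \<in> {1..N}"
      show "rs (ev N \<alpha>) \<le> (if \<alpha> \<in> ?J then 1 / ?\<eta>' else 0) + 4 * \<epsilon> * qs (ev N \<alpha>)"
      proof (cases "\<alpha> \<in> ?J")
        case True
        have "rs (ev N \<alpha>) \<le> lorentz E ?\<eta>' (ev N \<alpha>)" by (rule r(4)[OF N(1) \<alpha>])
        also have "\<dots> \<le> ?\<eta>' / ?\<eta>'\<^sup>2" using \<epsilon>(1) \<eta>(1) by (intro divide_left_mono mult_pos_pos) (auto intro: add_nonneg_pos)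
        also have "\<dots> = 1 / ?\<eta>'" using \<eta>' by (simp add: power2_eq_square)
        moreover have "0 \<le> 4 * \<epsilon> * qs (ev N \<alpha>)" using \<epsilon> qs0[OF \<alpha>] by simp
        ultimately show ?thesis using True by simp
      next
        case False
        let ?x = "ev N \<alpha> - E"
        have "\<eta> \<le> \<bar>?x\<bar>" using False \<alpha> by (auto simp: window_def spec_indices_def)
        then have "\<eta>\<^sup>2 \<le> ?x\<^sup>2" using \<eta> by (metis abs_le_square_iff abs_of_pos)
        moreover have "u + v \<le> 2 * (u + w)" if "v \<le> u" "0 \<le> w" for u v w :: real using that by simp
        ultimately have "?x\<^sup>2 + \<eta>\<^sup>2 \<le> 2 * (?x\<^sup>2 + ?\<eta>'\<^sup>2)" using zero_le_power2 by blast
        then have "?\<eta>' / (2 * (?x\<^sup>2 + ?\<eta>'\<^sup>2)) \<le> ?\<eta>' / (?x\<^sup>2 + \<eta>\<^sup>2)"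
          using \<eta>(1) \<epsilon>(1) by (intro divide_left_mono mult_pos_pos) (auto intro: add_nonneg_pos)
        moreover have "y / w \<le> 2 * (y / u)" if "y / (2 * w) \<le> y / u" for y w u :: real
        proof -
          have "y / (2 * w) = (y / w) / 2" by simp
          with that show ?thesis by linarith
        qed
        ultimately have "lorentz E ?\<eta>' (ev N \<alpha>) \<le> 2 * (?\<eta>' / (?x\<^sup>2 + \<eta>\<^sup>2))" by blast
        also have "\<dots> = 2 * (\<epsilon> * lorentz E \<eta> (ev N \<alpha>))" by simp
        also have "\<dots> \<le> 2 * (\<epsilon> * (qs (ev N \<alpha>) * 2))"
          by (intro mult_left_mono q(4)[OF N(1) \<alpha>, unfolded divide_le_eq_numeral1(1)]) (use \<epsilon> in auto)
        finally show ?thesis using r(4)[OF N(1) \<alpha>] False by simp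
      qed
    qed
    also have "\<dots> = real (card ?J) / ?\<eta>' + 4 * \<epsilon> * (\<Sum>\<alpha>\<in>{1..N}. qs (ev N \<alpha>))"
      using window_subset[of N E \<eta>]
      by (simp add: sum.distrib sum_distrib_left sum.If_cases Int_absorb1 del: One_nat_def)
    also have "\<dots> \<le> real (card ?J) / ?\<eta>' + 4 * \<epsilon> * (3 * C\<^sub>0 * real N)"
      using up \<epsilon> by (intro add_left_mono mult_left_mono) auto
    also have "4 * \<epsilon> * (3 * C\<^sub>0 * real N) = real N / (6 * C\<^sub>0)"
      using C0 by (simp add: \<epsilon>_def field_simps power2_eq_square)
    finally have "real N / (3 * C\<^sub>0) - real N / (6 * C\<^sub>0) \<le> real (card ?J) / ?\<eta>'" using low by linarith
    then have "real N / (6 * C\<^sub>0) \<le> real (card ?J) / ?\<eta>'" by simp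
    then show ?case using \<eta>' by (simp add: pos_le_divide_eq mult_ac)
  qed
qed

text \<open>The factor \<open>64\<close> is \<open>16 \<cdot> 4\<close>: a factor \<open>4\<eta>\<close> for each of the two Lorentzians, and \<open>4\<close> for doubling the norm of
  the kernel and adding an equal allowance for the fixed points.  The root is \<open>\<eta>\<close> times that of the
  weighted fourth powers of the two approximants.\<close>

definition variance_bound :: "'a \<Rightarrow> real \<Rightarrow> real" where
  "variance_bound t \<eta> = 64 * C\<^sub>2 * sqrt (8 * (1 + (1 + 2 * real (wl t)) powr c)
     * (\<eta>\<^sup>2 * (C\<^sub>0 ^ 4 + 1) + 2 powr c * \<delta> \<eta>))"

lemma variance_bound_limit: "(variance_bound t \<longlongrightarrow> 0) (at_right 0)"
proof -
  have id: "((\<lambda>\<eta>. \<eta>) \<longlongrightarrow> (0 :: real)) (at_right 0)" by (rule tendsto_ident_at)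
  have "(variance_bound t \<longlongrightarrow> 64 * C\<^sub>2 * sqrt (8 * (1 + (1 + 2 * real (wl t)) powr c)
     * (0\<^sup>2 * (C\<^sub>0 ^ 4 + 1) + 2 powr c * 0))) (at_right 0)"
    unfolding variance_bound_def by (intro tendsto_intros \<delta>_lim id)
  then show ?thesis by simp
qed

text \<open>On a window the Lorentzian is at least \<open>1/(2\<eta>)\<close>, so the sum over two windows is at most \<open>16\<eta>\<^sup>2\<close> times a trace,
  which away from the exceptional vectors is controlled by the norm of the kernel on \<open>\<ell>\<^sup>2(\<Gamma>)\<close>.\<close>

lemma window_variance:
  assumes E: "E\<^sub>1 \<in> I\<^sub>0" "E\<^sub>2 \<in> I\<^sub>0" and \<eta>: "0 < \<eta>" "\<eta> < \<eta>\<^sub>0" and t: "t \<in> carrier G"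
  obtains B :: "nat \<Rightarrow> (nat \<Rightarrow> complex) set" where
    "\<And>N. finite (B N)" "\<And>N. B N \<subseteq> cvec N" "negligible (\<lambda>N. real (card (B N)))"
    "\<forall>\<^sub>F N in along \<N>. \<forall>v\<in>cvec N. (\<forall>x\<in>{1..N}. cmod (v x) \<le> 1) \<longrightarrow>
      (\<forall>b\<in>B N. ell2_inner {1..N} b v = 0) \<longrightarrow>
      (\<Sum>\<alpha>\<in>window N E\<^sub>1 \<eta>. \<Sum>\<beta>\<in>window N E\<^sub>2 \<eta>. (cmod (shift_elem N t v \<beta> \<alpha>))\<^sup>2)
        \<le> \<eta> * variance_bound t \<eta> * real N"
proof -
  obtain q\<^sub>1 qs\<^sub>1 where q1: "q\<^sub>1 \<in> group_algebra G" "weight4 c q\<^sub>1 \<le> 8 * (C\<^sub>0 ^ 4 + 2 powr c * \<delta> \<eta> / \<eta>\<^sup>2 + 1)"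
    and eig1: "\<And>N \<alpha>. N \<in> \<N> \<Longrightarrow> \<alpha> \<in> {1..N} \<Longrightarrow> \<pi>\<^sub>N N q\<^sub>1 (\<phi> N \<alpha>) = (\<lambda>x. of_real (qs\<^sub>1 (ev N \<alpha>)) * \<phi> N \<alpha> x)"
    and low1: "\<And>N \<alpha>. N \<in> \<N> \<Longrightarrow> \<alpha> \<in> {1..N} \<Longrightarrow> lorentz E\<^sub>1 \<eta> (ev N \<alpha>) / 2 \<le> qs\<^sub>1 (ev N \<alpha>)"
    by (rule window_approximant[OF E(1) \<eta>]) blast
  obtain q\<^sub>2 qs\<^sub>2 where q2: "q\<^sub>2 \<in> group_algebra G" "weight4 c q\<^sub>2 \<le> 8 * (C\<^sub>0 ^ 4 + 2 powr c * \<delta> \<eta> / \<eta>\<^sup>2 + 1)"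
    and eig2: "\<And>N \<alpha>. N \<in> \<N> \<Longrightarrow> \<alpha> \<in> {1..N} \<Longrightarrow> \<pi>\<^sub>N N q\<^sub>2 (\<phi> N \<alpha>) = (\<lambda>x. of_real (qs\<^sub>2 (ev N \<alpha>)) * \<phi> N \<alpha> x)"
    and low2: "\<And>N \<alpha>. N \<in> \<N> \<Longrightarrow> \<alpha> \<in> {1..N} \<Longrightarrow> lorentz E\<^sub>2 \<eta> (ev N \<alpha>) / 2 \<le> qs\<^sub>2 (ev N \<alpha>)"
    by (rule window_approximant[OF E(2) \<eta>]) blast
  have \<delta>0: "0 \<le> \<delta> \<eta>" using R4[OF E(1) \<eta>, of "{}"] by simp
  define A where "A = kernel t q\<^sub>1 q\<^sub>2"
  have A: "A \<in> group_algebra G" unfolding A_def by (rule kernel_group_algebra[OF q1(1)])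
  define W where "W = 8 * (1 + (1 + 2 * real (wl t)) powr c) * (C\<^sub>0 ^ 4 + 2 powr c * \<delta> \<eta> / \<eta>\<^sup>2 + 1)"
  define \<theta> where "\<theta> = C\<^sub>2 * sqrt W"
  have W: "0 < W" unfolding W_def using C0 \<delta>0 by (intro mult_pos_pos add_pos_nonneg) auto
  have \<theta>: "0 < \<theta>" using W C\<^sub>2 by (simp add: \<theta>_def)
  have bound: "ell2_norm (carrier G) (left_regular G A f) \<le> \<theta> * ell2_norm (carrier G) f"
    if "f \<in> ell2 (carrier G)" for f
  proof -
    have "(\<Sum>g\<in>supp A. (1 + real (wl g)) powr c * (cmod (A g))\<^sup>2)
        \<le> weight4 c q\<^sub>1 + (1 + 2 * real (wl t)) powr c * weight4 c q\<^sub>2"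
      unfolding A_def using c by (intro kernel_weight q1 q2 t) simp
    also have "\<dots> \<le> 8 * (C\<^sub>0 ^ 4 + 2 powr c * \<delta> \<eta> / \<eta>\<^sup>2 + 1)
        + (1 + 2 * real (wl t)) powr c * (8 * (C\<^sub>0 ^ 4 + 2 powr c * \<delta> \<eta> / \<eta>\<^sup>2 + 1))"
      by (intro add_mono mult_left_mono q1 q2) simp
    also have "\<dots> = W" by (simp add: W_def algebra_simps)
    finally have "C\<^sub>2 * sqrt (\<Sum>g\<in>supp A. (1 + real (wl g)) powr c * (cmod (A g))\<^sup>2) \<le> \<theta>"
      unfolding \<theta>_def using C\<^sub>2 by (intro mult_left_mono real_sqrt_le_mono) auto
    then show ?thesis
      using RD[OF A that] mult_right_mono[OF _ ell2_norm_nonneg] order_trans by blast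
  qed
  obtain B :: "nat \<Rightarrow> (nat \<Rightarrow> complex) set" where B: "\<And>N. finite (B N)" "\<And>N. B N \<subseteq> cvec N"
    "negligible (\<lambda>N. real (card (B N)))"
    and perp: "\<And>N v. N \<in> \<N> \<Longrightarrow> v \<in> cvec N \<Longrightarrow> (\<And>b. b \<in> B N \<Longrightarrow> ell2_inner {1..N} b v = 0) \<Longrightarrow>
      ell2_norm {1..N} (\<pi>\<^sub>N N A v) \<le> 2 * \<theta> * ell2_norm {1..N} v"
    by (rule exceptional_subspace[where s="2 * \<theta>", OF A _ _ bound]) (use \<theta> in auto)
  \<comment> \<open>The slack between \<open>\<theta>\<close> and \<open>2\<theta>\<close> is what the exceptional vectors pay for; the remainder gets as much.\<close>
  have rem: "\<forall>\<^sub>F N in along \<N>. remainder t q\<^sub>1 q\<^sub>2 N \<le> 2 * \<theta> * real N"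
    using \<theta> by (intro negligible_le remainder_negligible t q1 q2) simp
  have const: "16 * \<eta>\<^sup>2 * (4 * \<theta>) = \<eta> * variance_bound t \<eta>"
  proof -
    have "\<eta>\<^sup>2 * W = 8 * (1 + (1 + 2 * real (wl t)) powr c) * (\<eta>\<^sup>2 * (C\<^sub>0 ^ 4 + 1) + 2 powr c * \<delta> \<eta>)"
      using \<eta> by (simp add: W_def field_simps)
    then have "variance_bound t \<eta> = 64 * C\<^sub>2 * sqrt (\<eta>\<^sup>2 * W)" by (simp add: variance_bound_def)
    also have "sqrt (\<eta>\<^sup>2 * W) = \<eta> * sqrt W" using \<eta> by (simp add: real_sqrt_mult)
    finally show ?thesis by (simp add: \<theta>_def power2_eq_square)
  qed
  show thesis
  proof (rule that[OF B])
    show "\<forall>\<^sub>F N in along \<N>. \<forall>v\<in>cvec N. (\<forall>x\<in>{1..N}. cmod (v x) \<le> 1) \<longrightarrow>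
      (\<forall>b\<in>B N. ell2_inner {1..N} b v = 0) \<longrightarrow>
      (\<Sum>\<alpha>\<in>window N E\<^sub>1 \<eta>. \<Sum>\<beta>\<in>window N E\<^sub>2 \<eta>. (cmod (shift_elem N t v \<beta> \<alpha>))\<^sup>2)
        \<le> \<eta> * variance_bound t \<eta> * real N"
      using rem eventually_pos
    proof eventually_elim
      case (elim N)
      then have N: "N \<in> \<N>" by blast
      interpret perm_action G "{1..N}" "\<rho> N" by (rule action[OF N])
      show ?case
      proof (intro ballI impI)
        fix v assume v: "v \<in> cvec N" and v1: "\<forall>x\<in>{1..N}. cmod (v x) \<le> 1"
          and vB: "\<forall>b\<in>B N. ell2_inner {1..N} b v = 0"
        let ?s = "\<lambda>\<alpha> \<beta>. (cmod (shift_elem N t v \<beta> \<alpha>))\<^sup>2"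
        have nonneg: "0 \<le> qs\<^sub>1 (ev N \<alpha>)" "0 \<le> qs\<^sub>2 (ev N \<alpha>)" if "\<alpha> \<in> {1..N}" for \<alpha>
          using low1[OF N that] low2[OF N that] \<eta>
          by (smt (verit) divide_nonneg_nonneg zero_le_power2)+
        have win: "1 / (4 * \<eta>) \<le> lorentz E \<eta> (ev N \<alpha>) / 2" if "\<alpha> \<in> window N E \<eta>" for \<alpha> E
        proof -
          have "\<bar>ev N \<alpha> - E\<bar> \<le> \<eta>" using that by (auto simp: window_def spec_indices_def)
          then have "(ev N \<alpha> - E)\<^sup>2 \<le> \<eta>\<^sup>2" using \<eta> by (metis abs_le_square_iff abs_of_pos)
          then have "\<eta> / (2 * \<eta>\<^sup>2) \<le> lorentz E \<eta> (ev N \<alpha>)"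
            using \<eta> by (intro divide_left_mono mult_pos_pos) (auto simp: add_nonneg_pos)
          then have "\<eta> / (2 * \<eta>\<^sup>2) / 2 \<le> lorentz E \<eta> (ev N \<alpha>) / 2" by (rule divide_right_mono) simp
          moreover have "\<eta> / (2 * \<eta>\<^sup>2) / 2 = 1 / (4 * \<eta>)" using \<eta> by (simp add: power2_eq_square)
          ultimately show ?thesis by (simp only:)
        qed
        have "(\<Sum>\<alpha>\<in>window N E\<^sub>1 \<eta>. \<Sum>\<beta>\<in>window N E\<^sub>2 \<eta>. ?s \<alpha> \<beta>)
            \<le> (\<Sum>\<alpha>\<in>window N E\<^sub>1 \<eta>. \<Sum>\<beta>\<in>window N E\<^sub>2 \<eta>. 16 * \<eta>\<^sup>2 * (qs\<^sub>1 (ev N \<alpha>) * qs\<^sub>2 (ev N \<beta>) * ?s \<alpha> \<beta>))"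
        proof (intro sum_mono)
          fix \<alpha> \<beta> assume \<alpha>: "\<alpha> \<in> window N E\<^sub>1 \<eta>" and \<beta>: "\<beta> \<in> window N E\<^sub>2 \<eta>"
          have ab: "\<alpha> \<in> {1..N}" "\<beta> \<in> {1..N}" using \<alpha> \<beta> window_subset by blast+
          have "1 / (4 * \<eta>) * (1 / (4 * \<eta>)) \<le> qs\<^sub>1 (ev N \<alpha>) * qs\<^sub>2 (ev N \<beta>)"
            using order_trans[OF win[OF \<alpha>] low1[OF N ab(1)]] order_trans[OF win[OF \<beta>] low2[OF N ab(2)]] \<eta>
              nonneg[OF ab(1)]
            by (intro mult_mono) auto
          then have "16 * \<eta>\<^sup>2 * (1 / (4 * \<eta>) * (1 / (4 * \<eta>))) \<le> 16 * \<eta>\<^sup>2 * (qs\<^sub>1 (ev N \<alpha>) * qs\<^sub>2 (ev N \<beta>))"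
            by (intro mult_left_mono) auto
          then have "1 \<le> 16 * \<eta>\<^sup>2 * (qs\<^sub>1 (ev N \<alpha>) * qs\<^sub>2 (ev N \<beta>))"
            using \<eta> by (simp add: power2_eq_square)
          from mult_right_mono[OF this, of "?s \<alpha> \<beta>"]
          show "?s \<alpha> \<beta> \<le> 16 * \<eta>\<^sup>2 * (qs\<^sub>1 (ev N \<alpha>) * qs\<^sub>2 (ev N \<beta>) * ?s \<alpha> \<beta>)" by (simp add: mult.assoc)
        qed
        also have "\<dots> \<le> (\<Sum>\<alpha>\<in>{1..N}. \<Sum>\<beta>\<in>{1..N}. 16 * \<eta>\<^sup>2 * (qs\<^sub>1 (ev N \<alpha>) * qs\<^sub>2 (ev N \<beta>) * ?s \<alpha> \<beta>))"
        proof (rule order_trans)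
          show "(\<Sum>\<alpha>\<in>window N E\<^sub>1 \<eta>. \<Sum>\<beta>\<in>window N E\<^sub>2 \<eta>. 16 * \<eta>\<^sup>2 * (qs\<^sub>1 (ev N \<alpha>) * qs\<^sub>2 (ev N \<beta>) * ?s \<alpha> \<beta>))
            \<le> (\<Sum>\<alpha>\<in>window N E\<^sub>1 \<eta>. \<Sum>\<beta>\<in>{1..N}. 16 * \<eta>\<^sup>2 * (qs\<^sub>1 (ev N \<alpha>) * qs\<^sub>2 (ev N \<beta>) * ?s \<alpha> \<beta>))"
            using window_subset[of N E\<^sub>1 \<eta>] window_subset[of N E\<^sub>2 \<eta>] nonneg
            by (intro sum_mono sum_mono2 mult_nonneg_nonneg) auto
          show "(\<Sum>\<alpha>\<in>window N E\<^sub>1 \<eta>. \<Sum>\<beta>\<in>{1..N}. 16 * \<eta>\<^sup>2 * (qs\<^sub>1 (ev N \<alpha>) * qs\<^sub>2 (ev N \<beta>) * ?s \<alpha> \<beta>))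
            \<le> (\<Sum>\<alpha>\<in>{1..N}. \<Sum>\<beta>\<in>{1..N}. 16 * \<eta>\<^sup>2 * (qs\<^sub>1 (ev N \<alpha>) * qs\<^sub>2 (ev N \<beta>) * ?s \<alpha> \<beta>))"
            using window_subset[of N E\<^sub>1 \<eta>] nonneg
            by (intro sum_mono2 sum_nonneg mult_nonneg_nonneg) auto
        qed
        also have "\<dots> = 16 * \<eta>\<^sup>2 * (\<Sum>\<alpha>\<in>{1..N}. \<Sum>\<beta>\<in>{1..N}. qs\<^sub>1 (ev N \<alpha>) * qs\<^sub>2 (ev N \<beta>) * ?s \<alpha> \<beta>)"
          by (simp only: sum_distrib_left)
        also have "\<dots> \<le> 16 * \<eta>\<^sup>2 * (cmod (ell2_inner {1..N} v (\<pi>\<^sub>N N A v)) + remainder t q\<^sub>1 q\<^sub>2 N)"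
          unfolding A_def
          by (intro mult_left_mono variance_kernel N q1 q2 t eig1 eig2) (use v1 in auto)
        also have "\<dots> \<le> 16 * \<eta>\<^sup>2 * (2 * \<theta> * real N + 2 * \<theta> * real N)"
        proof (intro mult_left_mono add_mono)
          have nv: "(ell2_norm {1..N} v)\<^sup>2 \<le> real N"
          proof -
            have "(ell2_norm {1..N} v)\<^sup>2 = (\<Sum>x\<in>{1..N}. (cmod (v x))\<^sup>2)" 
              by (simp add: ell2_norm_def sum_nonneg)
            also have "\<dots> \<le> (\<Sum>x\<in>{1..N}. 1)" using v1 by (intro sum_mono power_le_one) auto
            finally show ?thesis by simp
          qed
          have "cmod (ell2_inner {1..N} v (\<pi>\<^sub>N N A v)) \<le> ell2_norm {1..N} v * ell2_norm {1..N} (\<pi>\<^sub>N N A v)"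
            by (intro ell2_Cauchy_Schwarz v perm_op_ell2 A)
          also have "\<dots> \<le> ell2_norm {1..N} v * (2 * \<theta> * ell2_norm {1..N} v)"
            using perp[OF N v] vB by (intro mult_left_mono) auto
          also have "\<dots> = 2 * \<theta> * (ell2_norm {1..N} v)\<^sup>2" by (simp add: power2_eq_square)
          also have "\<dots> \<le> 2 * \<theta> * real N" using nv \<theta> by (intro mult_left_mono) auto
          finally show "cmod (ell2_inner {1..N} v (\<pi>\<^sub>N N A v)) \<le> 2 * \<theta> * real N" .
        qed (use elim in auto)
        also have "\<dots> = (16 * \<eta>\<^sup>2 * (4 * \<theta>)) * real N" by simp
        also have "\<dots> = \<eta> * variance_bound t \<eta> * real N" unfolding const ..
        finally show "(\<Sum>\<alpha>\<in>window N E\<^sub>1 \<eta>. \<Sum>\<beta>\<in>window N E\<^sub>2 \<eta>. ?s \<alpha> \<beta>) \<le> \<eta> * variance_bound t \<eta> * real N" .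
      qed
    qed
  qed
qed

end

section \<open>Local observables\<close>

context quantum_setting
begin

text \<open>A bound for the squared Hilbert-Schmidt distance between a local matrix and the sum of the operators
  \<open>\<rho>(t)D\<^sub>t\<close>: they differ only in columns \<open>y\<close> at which two elements of \<open>T\<close> act in the same way.\<close>

definition nonfree :: "'a set \<Rightarrow> nat \<Rightarrow> real" where
  "nonfree T N = real (card T) ^ 3 *
     (\<Sum>t\<in>T. \<Sum>s\<in>T. if t = s then 0 else real (card (fixed N (inv t \<otimes> s))))"

lemma nonfree_negligible:
  assumes "T \<subseteq> carrier G" shows "negligible (nonfree T)"
  unfolding nonfree_def
proof (intro negligible_cmult negligible_sum)
  fix t s assume "t \<in> T" "s \<in> T"
  then have ts: "t \<in> carrier G" "s \<in> carrier G" using assms by auto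
  have "inv t \<otimes> s \<noteq> \<one>" if "t \<noteq> s"
  proof
    assume "inv t \<otimes> s = \<one>"
    then have "inv s = inv t" by (rule inv_equality) (use ts in auto)
    then show False using that ts by (metis inv_inv)
  qed
  then show "negligible (\<lambda>N. if t = s then 0 else real (card (fixed N (inv t \<otimes> s))))"
    using ts by (cases "t = s") (auto intro: negligible_0 fixed_negligible)
qed

text \<open>In the sum of the \<open>\<rho>(t)D\<^sub>t\<close>, where \<open>D\<^sub>t\<close> is multiplication by \<open>x \<mapsto> K(t.x, x)\<close>, the entry \<open>K(x, y)\<close> is
  counted \<open>m\<close> times, where \<open>m\<close> is the number of \<open>t\<close> with \<open>t.y = x\<close>.  In a column where distinct
  elements of \<open>T\<close> act differently, \<open>m = 1\<close> wherever \<open>K\<close> does not vanish, so there is no error; the other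
  columns are few, and the entries of the error are bounded by the cardinality of \<open>T\<close>.\<close>

lemma local_decomposition:
  assumes N: "N \<in> \<N>" and T: "finite T" "T \<subseteq> carrier G"
    and loc: "is_local (\<rho> N) T N K" and K1: "\<And>x y. x \<in> {1..N} \<Longrightarrow> y \<in> {1..N} \<Longrightarrow> cmod (K x y) \<le> 1"
    and \<Lambda>: "\<Lambda>\<^sub>1 \<subseteq> {1..N}" "\<Lambda>\<^sub>2 \<subseteq> {1..N}"
  shows "(\<Sum>\<alpha>\<in>\<Lambda>\<^sub>1. \<Sum>\<beta>\<in>\<Lambda>\<^sub>2. (cmod (mat_elem N (\<phi> N \<beta>) K (\<phi> N \<alpha>)))\<^sup>2)
    \<le> 2 * real (card T) * (\<Sum>t\<in>T. \<Sum>\<alpha>\<in>\<Lambda>\<^sub>1. \<Sum>\<beta>\<in>\<Lambda>\<^sub>2.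
        (cmod (shift_elem N t (local_vector (\<rho> N) t N K) \<beta> \<alpha>))\<^sup>2) + 2 * nonfree T N"
proof -
  interpret perm_action G "{1..N}" "\<rho> N" by (rule action[OF N])
  let ?X = "{1..N}" and ?v = "\<lambda>t. local_vector (\<rho> N) t N K"
  define m where "m x y = (\<Sum>t\<in>T. if x = \<rho> N t y then 1 else (0 :: real))" for x y
  define Z where "Z x y = K x y - (\<Sum>t\<in>T. if x = \<rho> N t y then K x y else 0)" for x y
  have Z: "Z x y = of_real (1 - m x y) * K x y" for x y
  proof -
    have "of_real (m x y) * K x y = (\<Sum>t\<in>T. if x = \<rho> N t y then K x y else 0)"
      unfolding m_def of_real_sum sum_distrib_right by (intro sum.cong) auto
    then show ?thesis by (simp add: Z_def left_diff_distrib)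
  qed
  have elem: "mat_elem N (\<phi> N \<beta>) K (\<phi> N \<alpha>)
      = (\<Sum>t\<in>T. shift_elem N t (?v t) \<beta> \<alpha>) + mat_elem N (\<phi> N \<beta>) Z (\<phi> N \<alpha>)" for \<alpha> \<beta>
  proof -
    have me: "mat_elem N (\<phi> N \<beta>) M (\<phi> N \<alpha>) = (\<Sum>x\<in>?X. \<Sum>y\<in>?X. cnj (\<phi> N \<beta> x) * M x y * \<phi> N \<alpha> y)" for M
      by (simp add: mat_elem_def ell2_finite(2) mat_vec_def sum_distrib_left mult.assoc del: One_nat_def)
    have "(\<Sum>x\<in>?X. \<Sum>y\<in>?X. cnj (\<phi> N \<beta> x) * (\<Sum>t\<in>T. if x = \<rho> N t y then K x y else 0) * \<phi> N \<alpha> y)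
        = (\<Sum>x\<in>?X. \<Sum>y\<in>?X. \<Sum>t\<in>T. if x = \<rho> N t y then cnj (\<phi> N \<beta> x) * K x y * \<phi> N \<alpha> y else 0)"
      unfolding sum_distrib_left sum_distrib_right by (intro sum.cong refl) auto
    also have "\<dots> = (\<Sum>y\<in>?X. \<Sum>t\<in>T. \<Sum>x\<in>?X. if x = \<rho> N t y then cnj (\<phi> N \<beta> x) * K x y * \<phi> N \<alpha> y else 0)"
      by (rule sum_swap3)
    also have "\<dots> = (\<Sum>y\<in>?X. \<Sum>t\<in>T. cnj (\<phi> N \<beta> (\<rho> N t y)) * ?v t y * \<phi> N \<alpha> y)"
    proof (intro sum.cong refl)
      fix y t assume y: "y \<in> ?X" and "t \<in> T"
      then have "\<rho> N t y \<in> ?X" using T by (intro act_closed) auto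
      then show "(\<Sum>x\<in>?X. if x = \<rho> N t y then cnj (\<phi> N \<beta> x) * K x y * \<phi> N \<alpha> y else 0)
          = cnj (\<phi> N \<beta> (\<rho> N t y)) * ?v t y * \<phi> N \<alpha> y"
        using y by (simp add: local_vector_def del: One_nat_def)
    qed
    also have "\<dots> = (\<Sum>t\<in>T. shift_elem N t (?v t) \<beta> \<alpha>)" unfolding shift_elem_def by (rule sum.swap)
    finally have "(\<Sum>x\<in>?X. \<Sum>y\<in>?X. cnj (\<phi> N \<beta> x) * (\<Sum>t\<in>T. if x = \<rho> N t y then K x y else 0) * \<phi> N \<alpha> y)
        = (\<Sum>t\<in>T. shift_elem N t (?v t) \<beta> \<alpha>)" .
    then show ?thesis
      unfolding me Z_def by (simp add: algebra_simps sum.distrib sum_subtractf)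
  qed
  have pw: "(cmod (mat_elem N (\<phi> N \<beta>) K (\<phi> N \<alpha>)))\<^sup>2
      \<le> 2 * real (card T) * (\<Sum>t\<in>T. (cmod (shift_elem N t (?v t) \<beta> \<alpha>))\<^sup>2)
        + 2 * (cmod (mat_elem N (\<phi> N \<beta>) Z (\<phi> N \<alpha>)))\<^sup>2" for \<alpha> \<beta>
  proof -
    let ?a = "\<Sum>t\<in>T. cmod (shift_elem N t (?v t) \<beta> \<alpha>)" and ?z = "cmod (mat_elem N (\<phi> N \<beta>) Z (\<phi> N \<alpha>))"
    have "cmod (mat_elem N (\<phi> N \<beta>) K (\<phi> N \<alpha>)) \<le> ?a + ?z"
      unfolding elem by (intro order_trans[OF norm_triangle_ineq] add_right_mono norm_sum)
    then have "(cmod (mat_elem N (\<phi> N \<beta>) K (\<phi> N \<alpha>)))\<^sup>2 \<le> (?a + ?z)\<^sup>2" by (intro power_mono) auto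
    also have "\<dots> \<le> 2 * ?a\<^sup>2 + 2 * ?z\<^sup>2" using sum_squares_bound[of ?a ?z] by (simp add: power2_sum)
    also have "?a\<^sup>2 \<le> (\<Sum>t\<in>T. (cmod (shift_elem N t (?v t) \<beta> \<alpha>))\<^sup>2) * real (card T)"
      by (rule sum_squared_le_sum_of_squares)
    finally show ?thesis by (simp add: mult_ac)
  qed
  have HS: "(\<Sum>\<alpha>\<in>\<Lambda>\<^sub>1. \<Sum>\<beta>\<in>\<Lambda>\<^sub>2. (cmod (mat_elem N (\<phi> N \<beta>) Z (\<phi> N \<alpha>)))\<^sup>2) \<le> nonfree T N"
  proof -
    have "(\<Sum>\<alpha>\<in>\<Lambda>\<^sub>1. \<Sum>\<beta>\<in>\<Lambda>\<^sub>2. (cmod (mat_elem N (\<phi> N \<beta>) Z (\<phi> N \<alpha>)))\<^sup>2)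
        \<le> (\<Sum>\<alpha>\<in>\<Lambda>\<^sub>1. \<Sum>\<beta>\<in>{1..N}. (cmod (mat_elem N (\<phi> N \<beta>) Z (\<phi> N \<alpha>)))\<^sup>2)"
      using \<Lambda> by (intro sum_mono sum_mono2) auto
    also have "\<dots> \<le> (\<Sum>\<alpha>\<in>{1..N}. \<Sum>\<beta>\<in>{1..N}. (cmod (mat_elem N (\<phi> N \<beta>) Z (\<phi> N \<alpha>)))\<^sup>2)"
      using \<Lambda> by (intro sum_mono2 sum_nonneg) auto
    also have "\<dots> = (\<Sum>x\<in>{1..N}. \<Sum>y\<in>{1..N}. (cmod (Z x y))\<^sup>2)" by (rule Hilbert_Schmidt_eigenbasis[OF N])
    also have "\<dots> = (\<Sum>y\<in>{1..N}. \<Sum>x\<in>{1..N}. (cmod (Z x y))\<^sup>2)" by (rule sum.swap)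
    also have "\<dots> \<le> (\<Sum>y\<in>{1..N}. real (card T) ^ 3 *
        (\<Sum>t\<in>T. \<Sum>s\<in>T. if t \<noteq> s \<and> y \<in> fixed N (inv t \<otimes> s) then 1 else 0))"
    proof (rule sum_mono)
      fix y assume y: "y \<in> ?X"
      let ?bad = "\<lambda>t s. t \<noteq> s \<and> y \<in> fixed N (inv t \<otimes> s)"
      have m0: "0 \<le> m x y" "m x y \<le> real (card T)" for x
      proof -
        show "0 \<le> m x y" unfolding m_def by (intro sum_nonneg) auto
        have "m x y \<le> (\<Sum>t\<in>T. 1)" unfolding m_def by (intro sum_mono) auto
        then show "m x y \<le> real (card T)" by simp
      qed
      have m1: "1 \<le> m x y" if x: "x \<in> ?X" and nz: "Z x y \<noteq> 0" for x
      proof -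
        have "K x y \<noteq> 0" using nz by (auto simp: Z)
        then obtain t where t: "t \<in> T" "x = \<rho> N t y"
          using loc x y unfolding is_local_def by blast
        have "(if x = \<rho> N t y then 1 else 0) \<le> m x y"
          unfolding m_def by (rule member_le_sum[OF t(1)]) (use T in auto)
        then show ?thesis using t(2) by simp
      qed
      show "(\<Sum>x\<in>{1..N}. (cmod (Z x y))\<^sup>2) \<le> real (card T) ^ 3 *
          (\<Sum>t\<in>T. \<Sum>s\<in>T. if ?bad t s then 1 else 0)"
      proof (cases "\<exists>t\<in>T. \<exists>s\<in>T. ?bad t s")
        case False
        have "Z x y = 0" if x: "x \<in> ?X" for x
        proof (rule ccontr)
          assume nz: "Z x y \<noteq> 0"
          then have "K x y \<noteq> 0" by (auto simp: Z)
          then obtain t where t: "t \<in> T" "x = \<rho> N t y"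
            using loc x y unfolding is_local_def by blast
          have uniq: "s = t" if s: "s \<in> T" "x = \<rho> N s y" for s
          proof (rule ccontr)
            assume "s \<noteq> t"
            moreover have "\<rho> N (inv t \<otimes> s) y = y"
              using s t T y act_inv(1)[of t y] by (auto simp: act_mult subset_iff simp del: One_nat_def atLeastAtMost_iff)
            ultimately have "?bad t s" using y by (auto simp: fixed_def)
            then show False using False s t by blast
          qed
          have "m x y = (\<Sum>s\<in>T. if s = t then 1 else 0)"
            unfolding m_def using uniq t by (intro sum.cong) auto
          then have "m x y = 1" using t T by simp
          then show False using nz by (simp add: Z)
        qed
        then have "(\<Sum>x\<in>{1..N}. (cmod (Z x y))\<^sup>2) = 0" by (intro sum.neutral) auto
        then show ?thesis by (simp add: sum_nonneg)
      next
        case True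
        then obtain t s where ts: "t \<in> T" "s \<in> T" "?bad t s" by blast
        have cube: "(\<Sum>x\<in>{1..N}. (cmod (Z x y))\<^sup>2) \<le> real (card T) ^ 3 * 1"
        proof -
          have "(\<Sum>x\<in>{1..N}. (cmod (Z x y))\<^sup>2) \<le> (\<Sum>x\<in>{1..N}. (real (card T))\<^sup>2 * m x y)"
          proof (rule sum_mono)
            fix x assume x: "x \<in> ?X"
            show "(cmod (Z x y))\<^sup>2 \<le> (real (card T))\<^sup>2 * m x y"
            proof (cases "Z x y = 0")
              case False
              have "cmod (Z x y) = \<bar>1 - m x y\<bar> * cmod (K x y)" by (simp add: Z norm_mult del: of_real_diff)
              also have "\<dots> \<le> real (card T) * 1"
                using m1[OF x False] m0(2)[of x] K1[OF x y] by (intro mult_mono) auto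
              finally have "(cmod (Z x y))\<^sup>2 \<le> (real (card T))\<^sup>2" by (intro power_mono) auto
              also have "\<dots> \<le> (real (card T))\<^sup>2 * m x y"
                using m1[OF x False] mult_left_mono[of 1 "m x y" "(real (card T))\<^sup>2"] by simp
              finally show ?thesis .
            qed (use m0 in simp)
          qed
          also have "\<dots> = (real (card T))\<^sup>2 * (\<Sum>t\<in>T. \<Sum>x\<in>{1..N}. if x = \<rho> N t y then 1 else 0)"
            unfolding m_def by (subst sum.swap) (simp add: sum_distrib_left)
          also have "\<dots> \<le> (real (card T))\<^sup>2 * (\<Sum>t\<in>T. 1)"
            by (intro mult_left_mono sum_mono) auto
          finally show ?thesis by (simp add: power3_eq_cube power2_eq_square)
        qed
        also have "real (card T) ^ 3 * 1 \<le> real (card T) ^ 3 * (\<Sum>t\<in>T. \<Sum>s\<in>T. if ?bad t s then 1 else 0)"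
        proof (rule mult_left_mono)
          have "(1 :: real) = (if ?bad t s then 1 else 0)" using ts by simp
          also have "\<dots> \<le> (\<Sum>s\<in>T. if ?bad t s then 1 else 0)"
            by (rule member_le_sum[OF ts(2), of "\<lambda>s. if ?bad t s then 1 else 0"]) (use T in auto)
          also have "\<dots> \<le> (\<Sum>t\<in>T. \<Sum>s\<in>T. if ?bad t s then 1 else 0)"
            by (rule member_le_sum[OF ts(1), of "\<lambda>t. \<Sum>s\<in>T. if ?bad t s then 1 else 0"])
              (use T in \<open>auto intro: sum_nonneg\<close>)
          finally show "(1 :: real) \<le> (\<Sum>t\<in>T. \<Sum>s\<in>T. if ?bad t s then 1 else 0)" .
        qed simp
        finally show ?thesis .
      qed
    qed
    also have "\<dots> = real (card T) ^ 3 * (\<Sum>t\<in>T. \<Sum>s\<in>T. \<Sum>y\<in>{1..N}. if t \<noteq> s \<and> y \<in> fixed N (inv t \<otimes> s) then 1 else 0)"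
      unfolding sum_distrib_left[symmetric] by (subst sum_swap3) (rule refl)
    also have "\<dots> = nonfree T N"
      unfolding nonfree_def
    proof (intro arg_cong2[where f="(*)"] sum.cong refl)
      fix t s
      have "(\<Sum>y\<in>{1..N}. if y \<in> fixed N (inv t \<otimes> s) then 1 else 0) = real (card (fixed N (inv t \<otimes> s)))"
        by (subst sum.If_cases) (auto simp: fixed_def Int_def intro!: arg_cong[where f=card])
      then show "(\<Sum>y\<in>{1..N}. if t \<noteq> s \<and> y \<in> fixed N (inv t \<otimes> s) then 1 else 0)
          = (if t = s then 0 else real (card (fixed N (inv t \<otimes> s))))"
        by (cases "t = s") simp_all
    qed
    finally show ?thesis .
  qed
  have "(\<Sum>\<alpha>\<in>\<Lambda>\<^sub>1. \<Sum>\<beta>\<in>\<Lambda>\<^sub>2. (cmod (mat_elem N (\<phi> N \<beta>) K (\<phi> N \<alpha>)))\<^sup>2)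
      \<le> (\<Sum>\<alpha>\<in>\<Lambda>\<^sub>1. \<Sum>\<beta>\<in>\<Lambda>\<^sub>2. 2 * real (card T) * (\<Sum>t\<in>T. (cmod (shift_elem N t (?v t) \<beta> \<alpha>))\<^sup>2)
        + 2 * (cmod (mat_elem N (\<phi> N \<beta>) Z (\<phi> N \<alpha>)))\<^sup>2)"
    by (intro sum_mono pw)
  also have "\<dots> = 2 * real (card T) * (\<Sum>\<alpha>\<in>\<Lambda>\<^sub>1. \<Sum>\<beta>\<in>\<Lambda>\<^sub>2. \<Sum>t\<in>T. (cmod (shift_elem N t (?v t) \<beta> \<alpha>))\<^sup>2)
        + 2 * (\<Sum>\<alpha>\<in>\<Lambda>\<^sub>1. \<Sum>\<beta>\<in>\<Lambda>\<^sub>2. (cmod (mat_elem N (\<phi> N \<beta>) Z (\<phi> N \<alpha>)))\<^sup>2)"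
    by (simp only: sum.distrib sum_distrib_left)
  also have "(\<Sum>\<alpha>\<in>\<Lambda>\<^sub>1. \<Sum>\<beta>\<in>\<Lambda>\<^sub>2. \<Sum>t\<in>T. (cmod (shift_elem N t (?v t) \<beta> \<alpha>))\<^sup>2)
      = (\<Sum>t\<in>T. \<Sum>\<alpha>\<in>\<Lambda>\<^sub>1. \<Sum>\<beta>\<in>\<Lambda>\<^sub>2. (cmod (shift_elem N t (?v t) \<beta> \<alpha>))\<^sup>2)"
    by (rule sum_swap3[symmetric])
  finally show ?thesis using HS by linarith
qed

definition grid :: "real \<Rightarrow> real \<Rightarrow> real \<Rightarrow> real set" where
  "grid a b h = (\<lambda>i. a + real i * h) ` {..nat \<lfloor>(b - a) / h\<rfloor>}"

lemma grid:
  assumes "0 < h" "a \<le> b"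
  shows "finite (grid a b h)" "grid a b h \<subseteq> {a..b}" "real (card (grid a b h)) \<le> (b - a) / h + 1"
    and "\<And>E. E \<in> {a..b} \<Longrightarrow> \<exists>e\<in>grid a b h. \<bar>E - e\<bar> \<le> h"
proof -
  have nn: "0 \<le> (b - a) / h" using assms by simp
  show "finite (grid a b h)" by (simp add: grid_def)
  show "grid a b h \<subseteq> {a..b}"
  proof
    fix e assume "e \<in> grid a b h"
    then obtain i where i: "e = a + real i * h" "i \<le> nat \<lfloor>(b - a) / h\<rfloor>" by (auto simp: grid_def)
    then have "real i \<le> (b - a) / h" using nn by linarith
    then have "real i * h \<le> b - a" using assms by (simp add: pos_le_divide_eq)
    then show "e \<in> {a..b}" using i assms by simp
  qed
  have "card (grid a b h) \<le> Suc (nat \<lfloor>(b - a) / h\<rfloor>)"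
    unfolding grid_def using card_image_le[of "{..nat \<lfloor>(b - a) / h\<rfloor>}"] by (metis card_atMost finite_atMost)
  then show "real (card (grid a b h)) \<le> (b - a) / h + 1" using nn by linarith
  fix E assume E: "E \<in> {a..b}"
  define i where "i = nat \<lfloor>(E - a) / h\<rfloor>"
  have q: "0 \<le> (E - a) / h" "(E - a) / h \<le> (b - a) / h"
    using E assms by (auto intro: divide_right_mono)
  have "i \<le> nat \<lfloor>(b - a) / h\<rfloor>" unfolding i_def using q by (intro nat_mono floor_mono)
  then have mem: "a + real i * h \<in> grid a b h" by (auto simp: grid_def)
  have "real i \<le> (E - a) / h" "(E - a) / h \<le> real i + 1" unfolding i_def using q by linarith+
  then have "real i * h \<le> E - a" "E - a \<le> (real i + 1) * h"
    using assms by (simp_all add: pos_le_divide_eq pos_divide_le_eq)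
  then have "\<bar>E - (a + real i * h)\<bar> \<le> h" by (simp add: algebra_simps abs_le_iff)
  then show "\<exists>e\<in>grid a b h. \<bar>E - e\<bar> \<le> h" using mem by blast
qed

lemma window_mono:
  assumes "\<bar>E - e\<bar> + \<eta> \<le> \<eta>'" shows "window N E \<eta> \<subseteq> window N e \<eta>'"
  using assms by (auto simp: window_def spec_indices_def)

text \<open>A sequence of window sizes.  Only countably many may be used, since a small exceptional set belongs to each.\<close>

definition scale :: "nat \<Rightarrow> real" where "scale k = \<eta>\<^sub>0 / 2 ^ Suc k"

lemma scale: "0 < scale k" "scale k < \<eta>\<^sub>0"
proof -
  show "0 < scale k" using \<eta>0 by (simp add: scale_def)
  have "(1 :: real) < 2 ^ Suc k" by (rule one_less_power) auto
  then show "scale k < \<eta>\<^sub>0" using \<eta>0 by (simp add: scale_def divide_less_eq)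
qed

lemma scale_limit: "filterlim scale (at_right 0) sequentially"
proof -
  have "(\<lambda>k. \<eta>\<^sub>0 * (1 / 2) ^ Suc k) \<longlonglongrightarrow> \<eta>\<^sub>0 * 0"
    by (intro tendsto_intros LIMSEQ_Suc LIMSEQ_power_zero) simp
  then have "scale \<longlonglongrightarrow> 0" by (simp add: scale_def[abs_def] power_divide)
  moreover have "scale k \<noteq> 0" for k using scale(1)[of k] by simp
  ultimately show ?thesis unfolding filterlim_at using scale(1) by simp
qed

definition controls :: "'a set \<Rightarrow> real \<Rightarrow> real \<Rightarrow> nat \<Rightarrow> nat \<Rightarrow> (nat \<Rightarrow> complex) set \<Rightarrow> bool" where
  "controls T a b k N D \<longleftrightarrow> (\<forall>t\<in>T. \<forall>E\<^sub>1\<in>grid a b (scale k / 2). \<forall>E\<^sub>2\<in>grid a b (scale k / 2).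
      \<forall>v\<in>cvec N. (\<forall>x\<in>{1..N}. cmod (v x) \<le> 1) \<longrightarrow> (\<forall>d\<in>D. ell2_inner {1..N} d v = 0) \<longrightarrow>
      (\<Sum>\<alpha>\<in>window N E\<^sub>1 (scale k). \<Sum>\<beta>\<in>window N E\<^sub>2 (scale k). (cmod (shift_elem N t v \<beta> \<alpha>))\<^sup>2)
        \<le> scale k * variance_bound t (scale k) * real N)"

text \<open>At each scale the energies are discretised at half the window size, which leaves finitely many pairs of windows;
  the exceptional sets of all scales are merged by \<open>diagonal_union\<close>.\<close>

lemma exceptional_sets:
  assumes T: "finite T" "T \<subseteq> carrier G" and ab: "a \<le> b" "{a..b} \<subseteq> I\<^sub>0"
  obtains D :: "nat \<Rightarrow> (nat \<Rightarrow> complex) set" where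
    "\<And>N. finite (D N)" "\<And>N. D N \<subseteq> cvec N" "negligible (\<lambda>N. real (card (D N)))"
    "\<And>k. \<forall>\<^sub>F N in along \<N>. controls T a b k N (D N)"
proof -
  let ?P = "\<lambda>k t E\<^sub>1 E\<^sub>2 N B. \<forall>v\<in>cvec N. (\<forall>x\<in>{1..N}. cmod (v x) \<le> 1) \<longrightarrow>
      (\<forall>b\<in>B. ell2_inner {1..N} b v = 0) \<longrightarrow>
      (\<Sum>\<alpha>\<in>window N E\<^sub>1 (scale k). \<Sum>\<beta>\<in>window N E\<^sub>2 (scale k). (cmod (shift_elem N t v \<beta> \<alpha>))\<^sup>2)
        \<le> scale k * variance_bound t (scale k) * real N"
  let ?g = "\<lambda>k. grid a b (scale k / 2)"
  let ?I = "\<lambda>k. T \<times> ?g k \<times> ?g k"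
  have sc: "0 < scale k / 2" for k using scale(1)[of k] by simp
  note g = grid[OF sc ab(1)]
  define good where "good k i B \<longleftrightarrow> (\<forall>N. finite (B N) \<and> B N \<subseteq> cvec N) \<and> negligible (\<lambda>N. real (card (B N))) \<and>
      (\<forall>\<^sub>F N in along \<N>. ?P k (fst i) (fst (snd i)) (snd (snd i)) N (B N))"
    for k :: nat and i and B :: "nat \<Rightarrow> (nat \<Rightarrow> complex) set"
  have ex: "\<exists>B. good k i B" if "i \<in> ?I k" for k i
  proof -
    obtain t E\<^sub>1 E\<^sub>2 where i: "i = (t, E\<^sub>1, E\<^sub>2)" by (cases i)
    have E: "E\<^sub>1 \<in> I\<^sub>0" "E\<^sub>2 \<in> I\<^sub>0" "t \<in> carrier G" using that i g(2)[of k] ab(2) T(2) by auto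
    obtain B :: "nat \<Rightarrow> (nat \<Rightarrow> complex) set" where
      "\<And>N. finite (B N)" "\<And>N. B N \<subseteq> cvec N" "negligible (\<lambda>N. real (card (B N)))"
      "\<forall>\<^sub>F N in along \<N>. ?P k t E\<^sub>1 E\<^sub>2 N (B N)"
      by (rule window_variance[OF E(1,2) scale[of k] E(3)]) blast
    then show ?thesis unfolding good_def i by (intro exI[of _ B]) simp
  qed
  define B where "B k i = (SOME B. good k i B)" for k i
  have good: "good k i (B k i)" if "i \<in> ?I k" for k i
    unfolding B_def by (rule someI_ex[OF ex[OF that]])
  have B: "\<And>k i N. i \<in> ?I k \<Longrightarrow> finite (B k i N) \<and> B k i N \<subseteq> cvec N"
    "\<And>k i. i \<in> ?I k \<Longrightarrow> negligible (\<lambda>N. real (card (B k i N)))"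
    "\<And>k i. i \<in> ?I k \<Longrightarrow> \<forall>\<^sub>F N in along \<N>. ?P k (fst i) (fst (snd i)) (snd (snd i)) N (B k i N)"
    using good unfolding good_def by auto
  have finI: "finite (?I k)" for k using T(1) g(1)[of k] by simp
  define U where "U k N = (\<Union>i\<in>?I k. B k i N)" for k N
  have U: "finite (U k N)" "U k N \<subseteq> cvec N" for k N
    unfolding U_def by (rule finite_UN_I[OF finI], use B(1) in blast, rule UN_least, use B(1) in blast)
  have Uneg: "negligible (\<lambda>N. real (card (U k N)))" for k
  proof (rule negligible_mono)
    show "negligible (\<lambda>N. \<Sum>i\<in>?I k. real (card (B k i N)))" by (rule negligible_sum) (rule B(2))
    show "\<forall>\<^sub>F N in along \<N>. 0 \<le> real (card (U k N)) \<and> real (card (U k N)) \<le> (\<Sum>i\<in>?I k. real (card (B k i N)))"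
      unfolding U_def of_nat_sum[symmetric] of_nat_le_iff
      by (intro always_eventually allI conjI of_nat_0_le_iff card_UN_le finI)
  qed
  obtain D where D: "\<And>N. finite (D N)" "\<And>N. D N \<subseteq> (\<Union>k. U k N)" "negligible (\<lambda>N. real (card (D N)))"
    "\<And>k. \<forall>\<^sub>F N in along \<N>. U k N \<subseteq> D N"
    by (rule diagonal_union[where B=U, OF U(1) Uneg]) blast
  show thesis
  proof (rule that[OF D(1) _ D(3)])
    show "D N \<subseteq> cvec N" for N using D(2)[of N] U(2) by blast
    fix k
    have "\<forall>\<^sub>F N in along \<N>. \<forall>i\<in>?I k. ?P k (fst i) (fst (snd i)) (snd (snd i)) N (B k i N)"
      by (rule eventually_ball_finite[OF finI]) (use B(3) in blast)
    with D(4)[of k] show "\<forall>\<^sub>F N in along \<N>. controls T a b k N (D N)"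
    proof eventually_elim
      case (elim N)
      show ?case unfolding controls_def
      proof (intro ballI impI)
        fix t E\<^sub>1 E\<^sub>2 v
        assume i: "t \<in> T" "E\<^sub>1 \<in> ?g k" "E\<^sub>2 \<in> ?g k" and v: "v \<in> cvec N" "\<forall>x\<in>{1..N}. cmod (v x) \<le> 1"
          "\<forall>d\<in>D N. ell2_inner {1..N} d v = 0"
        have mem: "(t, E\<^sub>1, E\<^sub>2) \<in> ?I k" using i by simp
        then have "B k (t, E\<^sub>1, E\<^sub>2) N \<subseteq> D N" using elim(1) unfolding U_def by blast
        then have "\<forall>d\<in>B k (t, E\<^sub>1, E\<^sub>2) N. ell2_inner {1..N} d v = 0" using v(3) by blast
        then show "(\<Sum>\<alpha>\<in>window N E\<^sub>1 (scale k). \<Sum>\<beta>\<in>window N E\<^sub>2 (scale k). (cmod (shift_elem N t v \<beta> \<alpha>))\<^sup>2)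
          \<le> scale k * variance_bound t (scale k) * real N"
          using bspec[OF elim(2) mem, unfolded fst_conv snd_conv] v(1,2) by blast
      qed
    qed
  qed
qed

end

section \<open>Ergodicity and mixing\<close>

lemma ennreal_tendsto_0I:
  fixes f :: "'z \<Rightarrow> ennreal"
  assumes "\<And>e. 0 < e \<Longrightarrow> \<forall>\<^sub>F x in F. f x \<le> ennreal e"
  shows "(f \<longlongrightarrow> 0) F"
proof (rule order_tendstoI)
  fix u :: ennreal assume u: "0 < u"
  have "\<exists>e>0. ennreal e < u"
  proof (cases u)
    case (real r)
    then show ?thesis using u by (intro exI[of _ "r / 2"]) (auto simp: ennreal_less_iff)
  next
    case top
    then show ?thesis by (intro exI[of _ 1]) auto
  qed
  then obtain e where e: "0 < e" "ennreal e < u" by blast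
  show "\<forall>\<^sub>F x in F. f x < u" using assms[OF e(1)] by eventually_elim (use e(2) in auto)
qed simp

lemma negligible_dim:
  assumes "\<And>N. finite (D N)" 
    and "((\<lambda>N. real (card (D N)) / real N) \<longlongrightarrow> 0) (along \<N>)" and "0 \<notin> \<N>"
  shows "(\<lambda>N. real (cseq.dim (cseq.span (D N)))) \<in> o[along \<N>](\<lambda>N. real N)"
proof (rule smalloI_tendsto)
  have "real (cseq.dim (cseq.span (D N))) \<le> real (card (D N))" for N
    using cseq.dim_le_card[OF order_refl assms(1)] by (simp add: cseq.dim_span)
  then show "((\<lambda>N. real (cseq.dim (cseq.span (D N))) / real N) \<longlongrightarrow> 0) (along \<N>)"
    by (intro tendsto_sandwich[OF _ _ tendsto_const assms(2)] always_eventually)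
      (auto intro: divide_right_mono)
  show "\<forall>\<^sub>F N in along \<N>. real N \<noteq> 0" unfolding eventually_along using assms(3) by (metis of_nat_eq_0_iff)
qed

context quantum_setting
begin

text \<open>The mixing sum before normalisation, for arbitrary sets of indices; its diagonal terms make up the ergodicity sum.\<close>

definition fluctuation :: "'a set \<Rightarrow> nat \<Rightarrow> cmatrix \<Rightarrow> nat set \<Rightarrow> nat set \<Rightarrow> real" where
  "fluctuation T N M \<Lambda>\<^sub>1 \<Lambda>\<^sub>2 = (\<Sum>\<alpha>\<in>\<Lambda>\<^sub>1. \<Sum>\<beta>\<in>\<Lambda>\<^sub>2.
     (cmod (mat_elem N (\<phi> N \<beta>) M (\<phi> N \<alpha>) - mat_elem N (\<phi> N \<beta>) (avg (\<rho> N) T N M) (\<phi> N \<alpha>)))\<^sup>2)"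

lemma fluctuation_mono:
  assumes "\<Lambda>\<^sub>1 \<subseteq> \<Lambda>\<^sub>1'" "\<Lambda>\<^sub>2 \<subseteq> \<Lambda>\<^sub>2'" "finite \<Lambda>\<^sub>1'" "finite \<Lambda>\<^sub>2'"
  shows "fluctuation T N M \<Lambda>\<^sub>1 \<Lambda>\<^sub>2 \<le> fluctuation T N M \<Lambda>\<^sub>1' \<Lambda>\<^sub>2'"
proof -
  have "fluctuation T N M \<Lambda>\<^sub>1 \<Lambda>\<^sub>2 \<le> fluctuation T N M \<Lambda>\<^sub>1 \<Lambda>\<^sub>2'"
    unfolding fluctuation_def using assms by (intro sum_mono sum_mono2) auto
  also have "\<dots> \<le> fluctuation T N M \<Lambda>\<^sub>1' \<Lambda>\<^sub>2'"
    unfolding fluctuation_def using assms by (intro sum_mono2 sum_nonneg) auto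
  finally show ?thesis .
qed

lemma avg_elem_zero:
  assumes "\<And>t. t \<in> T \<Longrightarrow> (\<Sum>x\<in>{1..N}. M (\<rho> N t x) x) = 0"
  shows "mat_elem N u (avg (\<rho> N) T N M) w = 0"
proof -
  have "avg_coeff (\<rho> N) T N M = (\<lambda>g. 0)" using assms by (auto simp: avg_coeff_def fun_eq_iff)
  then have "avg (\<rho> N) T N M = (\<lambda>x y. 0)" by (simp add: avg_def rep_matrix_def[abs_def] supp_def)
  then show ?thesis by (simp add: mat_elem_def mat_vec_def ell2_inner_def)
qed

text \<open>The variance of the pieces \<open>\<rho>(t)D\<^sub>t\<close>, recombined by Cauchy-Schwarz, and an allowance for the points at which the
  action is not free.\<close>

definition total_bound :: "'a set \<Rightarrow> nat \<Rightarrow> real" where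
  "total_bound T k = 2 * real (card T) * (\<Sum>t\<in>T. variance_bound t (scale k)) + 2 * scale k"

lemma total_bound_limit: "total_bound T \<longlonglongrightarrow> 0"
proof -
  have "(\<lambda>k. 2 * real (card T) * (\<Sum>t\<in>T. variance_bound t (scale k)) + 2 * scale k)
      \<longlonglongrightarrow> 2 * real (card T) * (\<Sum>t\<in>T. 0) + 2 * 0"
    by (intro tendsto_intros filterlim_compose[OF variance_bound_limit scale_limit]
        filterlim_mono[OF scale_limit _ order_refl]) (simp add: at_within_le_nhds)
  then show ?thesis by (simp add: total_bound_def[abs_def])
qed

definition small_windows :: "'a set \<Rightarrow> real \<Rightarrow> real \<Rightarrow> nat \<Rightarrow> nat \<Rightarrow> cmatrix \<Rightarrow> bool" where
  "small_windows T a b k N M \<longleftrightarrow> (\<forall>E\<^sub>1\<in>grid a b (scale k / 2). \<forall>E\<^sub>2\<in>grid a b (scale k / 2).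
      fluctuation T N M (window N E\<^sub>1 (scale k)) (window N E\<^sub>2 (scale k)) \<le> scale k * total_bound T k * real N)"

text \<open>The constant function is among the vectors to which the observable is orthogonal.  This makes every
  coefficient of the average vanish, so that only the matrix elements of the observable itself remain.\<close>

lemma fluctuation_window:
  assumes T: "finite T" "T \<subseteq> carrier G"
    and D: "\<And>k. \<forall>\<^sub>F N in along \<N>. controls T a b k N (D N)"
    and loc: "\<And>N. N \<in> \<N> \<Longrightarrow> is_local (\<rho> N) T N (K N)" and K1: "\<And>N. N \<in> \<N> \<Longrightarrow> norm_1_inf N (K N) \<le> 1"
    and perp: "\<And>N t d. N \<in> \<N> \<Longrightarrow> t \<in> T \<Longrightarrow> d \<in> insert (\<lambda>x. if x \<in> {1..N} then 1 else 0) (D N) \<Longrightarrow>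
      ell2_inner {1..N} d (local_vector (\<rho> N) t N (K N)) = 0"
  shows "\<forall>\<^sub>F N in along \<N>. small_windows T a b k N (K N)"
proof -
  have "\<forall>\<^sub>F N in along \<N>. nonfree T N \<le> (scale k)\<^sup>2 * real N"
    using scale(1)[of k] by (intro negligible_le nonfree_negligible T) simp
  with D[of k] eventually_pos show ?thesis
  proof eventually_elim
    case (elim N)
    then have N: "N \<in> \<N>" by blast
    interpret perm_action G "{1..N}" "\<rho> N" by (rule action[OF N])
    let ?v = "\<lambda>t. local_vector (\<rho> N) t N (K N)"
    have ent: "cmod (K N x y) \<le> 1" if "x \<in> {1..N}" "y \<in> {1..N}" for x y
    proof -
      have "finite {cmod (K N x y) |x y. x \<in> {1..N} \<and> y \<in> {1..N}}"
        by (rule finite_subset[of _ "(\<lambda>(x, y). cmod (K N x y)) ` ({1..N} \<times> {1..N})"]) auto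
      then have "cmod (K N x y) \<le> norm_1_inf N (K N)"
        unfolding norm_1_inf_def using that by (intro Max_ge) blast+
      then show ?thesis using K1[OF N] by simp
    qed
    have v: "?v t \<in> cvec N" "\<forall>x\<in>{1..N}. cmod (?v t x) \<le> 1" if "t \<in> T" for t
    proof -
      show "?v t \<in> cvec N" by (simp add: ell2_finite(1) local_vector_def)
      have "\<rho> N t x \<in> {1..N}" if "x \<in> {1..N}" for x
        using \<open>t \<in> T\<close> T(2) that by (intro act_closed) auto
      then show "\<forall>x\<in>{1..N}. cmod (?v t x) \<le> 1" using ent by (simp add: local_vector_def del: One_nat_def)
    qed
    have zero: "(\<Sum>x\<in>{1..N}. K N (\<rho> N t x) x) = 0" if "t \<in> T" for t
      using perp[OF N that, of "\<lambda>x. if x \<in> {1..N} then 1 else 0"]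
      by (simp add: ell2_finite(2) local_vector_def del: One_nat_def)
    show ?case unfolding small_windows_def
    proof (intro ballI)
      fix E\<^sub>1 E\<^sub>2 assume E: "E\<^sub>1 \<in> grid a b (scale k / 2)" "E\<^sub>2 \<in> grid a b (scale k / 2)"
      have "fluctuation T N (K N) (window N E\<^sub>1 (scale k)) (window N E\<^sub>2 (scale k))
          = (\<Sum>\<alpha>\<in>window N E\<^sub>1 (scale k). \<Sum>\<beta>\<in>window N E\<^sub>2 (scale k).
              (cmod (mat_elem N (\<phi> N \<beta>) (K N) (\<phi> N \<alpha>)))\<^sup>2)"
        unfolding fluctuation_def by (simp add: avg_elem_zero zero del: One_nat_def)
      also have "\<dots> \<le> 2 * real (card T) * (\<Sum>t\<in>T. \<Sum>\<alpha>\<in>window N E\<^sub>1 (scale k). \<Sum>\<beta>\<in>window N E\<^sub>2 (scale k).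
          (cmod (shift_elem N t (?v t) \<beta> \<alpha>))\<^sup>2) + 2 * nonfree T N"
        by (rule local_decomposition[OF N T loc[OF N] ent window_subset window_subset])
      also have "\<dots> \<le> 2 * real (card T) * (\<Sum>t\<in>T. scale k * variance_bound t (scale k) * real N)
          + 2 * ((scale k)\<^sup>2 * real N)"
      proof (intro add_mono mult_left_mono sum_mono)
        fix t assume t: "t \<in> T"
        have "\<forall>d\<in>D N. ell2_inner {1..N} d (?v t) = 0" using perp[OF N t] by blast
        then show "(\<Sum>\<alpha>\<in>window N E\<^sub>1 (scale k). \<Sum>\<beta>\<in>window N E\<^sub>2 (scale k). (cmod (shift_elem N t (?v t) \<beta> \<alpha>))\<^sup>2)
            \<le> scale k * variance_bound t (scale k) * real N"
          using elim(1)[unfolded controls_def] t E v[OF t] by blast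
      qed (use elim in auto)
      also have "\<dots> = scale k * total_bound T k * real N"
        by (simp add: total_bound_def sum_distrib_left sum_distrib_right algebra_simps power2_eq_square)
      finally show "fluctuation T N (K N) (window N E\<^sub>1 (scale k)) (window N E\<^sub>2 (scale k))
          \<le> scale k * total_bound T k * real N" .
    qed
  qed
qed

text \<open>The diagonal terms are covered by the sums over single windows.  A grid has about \<open>2(b - a)/\<eta>\<close> points and each
  window contributes \<open>o(\<eta>)N\<close>, whereas a positive proportion of the eigenvalues lies in the interval.\<close>

lemma ergodicity_from_windows:
  assumes ab: "a < b" "{a..b} \<subseteq> I\<^sub>0"
    and W: "\<And>k. \<forall>\<^sub>F N in along \<N>. small_windows T a b k N (K N)"
  shows "quantum_ergodicity \<N> \<rho> ev \<phi> T K {a..b}"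
proof -
  obtain \<kappa> where \<kappa>: "0 < \<kappa>" "\<And>E \<eta>. E \<in> I\<^sub>0 \<Longrightarrow> 0 < \<eta> \<Longrightarrow> \<eta> < \<eta>\<^sub>0 \<Longrightarrow>
      \<forall>\<^sub>F N in along \<N>. \<kappa> * \<eta> * real N \<le> real (card (window N E \<eta>))"
    by (rule count_lower) blast
  define \<eta> where "\<eta> = min (\<eta>\<^sub>0 / 2) ((b - a) / 2)"
  have \<eta>: "0 < \<eta>" "\<eta> < \<eta>\<^sub>0" using \<eta>0 ab by (auto simp: \<eta>_def)
  have "\<eta> \<le> (b - a) / 2" unfolding \<eta>_def by (rule min.cobounded2)
  then have \<eta>_sub: "a \<le> (a + b) / 2 - \<eta>" "(a + b) / 2 + \<eta> \<le> b" by (simp_all add: field_simps)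
  have mid: "(a + b) / 2 \<in> I\<^sub>0" using ab by (auto simp: subset_iff)
  let ?d = "\<lambda>N \<alpha> \<beta>. (cmod (mat_elem N (\<phi> N \<beta>) (K N) (\<phi> N \<alpha>)
      - mat_elem N (\<phi> N \<beta>) (avg (\<rho> N) T N (K N)) (\<phi> N \<alpha>)))\<^sup>2"
  let ?L = "\<lambda>N. spec_indices N (ev N) {a..b}"
  let ?c = "(2 * (b - a) + 1) / (\<kappa> * \<eta>)"
  show ?thesis
    unfolding quantum_ergodicity_def
  proof (rule tendstoI)
    fix \<epsilon> :: real assume \<epsilon>: "0 < \<epsilon>"
    have "(\<lambda>k. ?c * total_bound T k) \<longlonglongrightarrow> ?c * 0" by (intro tendsto_intros total_bound_limit)
    then have "\<forall>\<^sub>F k in sequentially. ?c * total_bound T k < \<epsilon>"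
      by (rule order_tendstoD(2)) (use \<epsilon> in simp)
    then obtain k where k: "?c * total_bound T k < \<epsilon>" by (meson eventually_happens sequentially_bot)
    let ?g = "grid a b (scale k / 2)" and ?s = "scale k"
    have sc: "0 < ?s / 2" using scale(1)[of k] by simp
    note g = grid[OF sc less_imp_le[OF ab(1)]]
    show "\<forall>\<^sub>F N in along \<N>. dist (1 / real (card (?L N)) * (\<Sum>\<alpha>\<in>?L N. ?d N \<alpha> \<alpha>)) 0 < \<epsilon>"
      using W[of k] \<kappa>(2)[OF mid \<eta>(1,2)] eventually_pos
    proof eventually_elim
      case (elim N)
      then have N: "0 < real N" by simp
      have "window N ((a + b) / 2) \<eta> \<subseteq> ?L N" using \<eta>_sub by (auto simp: window_def spec_indices_def)
      then have "card (window N ((a + b) / 2) \<eta>) \<le> card (?L N)"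
        by (intro card_mono) (auto simp: spec_indices_def)
      then have cL: "\<kappa> * \<eta> * real N \<le> real (card (?L N))" using elim(2) by linarith
      have "(\<Sum>\<alpha>\<in>?L N. ?d N \<alpha> \<alpha>) \<le> (\<Sum>\<alpha>\<in>?L N. \<Sum>e\<in>?g. if \<alpha> \<in> window N e ?s then ?d N \<alpha> \<alpha> else 0)"
      proof (rule sum_mono)
        fix \<alpha> assume \<alpha>: "\<alpha> \<in> ?L N"
        then have "ev N \<alpha> \<in> {a..b}" by (simp add: spec_indices_def)
        then obtain e where e: "e \<in> ?g" "\<bar>ev N \<alpha> - e\<bar> \<le> ?s / 2" using g(4) by blast
        then have "e - ?s \<le> ev N \<alpha>" "ev N \<alpha> \<le> e + ?s" using scale(1)[of k] by linarith+
        then have "\<alpha> \<in> window N e ?s" using \<alpha> by (auto simp: window_def spec_indices_def)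
        then have "?d N \<alpha> \<alpha> = (if \<alpha> \<in> window N e ?s then ?d N \<alpha> \<alpha> else 0)" by simp
        also have "\<dots> \<le> (\<Sum>e\<in>?g. if \<alpha> \<in> window N e ?s then ?d N \<alpha> \<alpha> else 0)"
          by (rule member_le_sum[OF e(1), of "\<lambda>e. if \<alpha> \<in> window N e ?s then ?d N \<alpha> \<alpha> else 0"]) (use g(1) in auto)
        finally show "?d N \<alpha> \<alpha> \<le> (\<Sum>e\<in>?g. if \<alpha> \<in> window N e ?s then ?d N \<alpha> \<alpha> else 0)" .
      qed
      also have "\<dots> = (\<Sum>e\<in>?g. \<Sum>\<alpha>\<in>?L N. if \<alpha> \<in> window N e ?s then ?d N \<alpha> \<alpha> else 0)" by (rule sum.swap)
      also have "\<dots> \<le> (\<Sum>e\<in>?g. ?s * total_bound T k * real N)"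
      proof (rule sum_mono)
        fix e assume e: "e \<in> ?g"
        have "(\<Sum>\<alpha>\<in>?L N. if \<alpha> \<in> window N e ?s then ?d N \<alpha> \<alpha> else 0) = (\<Sum>\<alpha>\<in>?L N \<inter> window N e ?s. ?d N \<alpha> \<alpha>)"
          by (simp add: sum.inter_restrict spec_indices_def)
        also have "\<dots> \<le> (\<Sum>\<alpha>\<in>window N e ?s. ?d N \<alpha> \<alpha>)" by (intro sum_mono2) auto
        also have "\<dots> \<le> fluctuation T N (K N) (window N e ?s) (window N e ?s)"
          unfolding fluctuation_def
          by (intro sum_mono member_le_sum[where f="?d N _"]) auto
        also have "\<dots> \<le> ?s * total_bound T k * real N" using elim(1)[unfolded small_windows_def] e by blast
        finally show "(\<Sum>\<alpha>\<in>?L N. if \<alpha> \<in> window N e ?s then ?d N \<alpha> \<alpha> else 0) \<le> ?s * total_bound T k * real N" .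
      qed
      also have "\<dots> = (real (card ?g) * ?s) * (total_bound T k * real N)" by simp
      also have "\<dots> \<le> (2 * (b - a) + 1) * (total_bound T k * real N)"
      proof (rule mult_right_mono)
        have "real (card ?g) * ?s \<le> ((b - a) / (?s / 2) + 1) * ?s"
          using g(3) scale(1)[of k] by (intro mult_right_mono) auto
        also have "\<dots> = 2 * (b - a) + ?s" using scale(1)[of k] by (simp add: field_simps)
        finally show "real (card ?g) * ?s \<le> 2 * (b - a) + 1" using scale(2)[of k] \<eta>0 by linarith
        have "0 \<le> fluctuation T N (K N) (window N a ?s) (window N a ?s)"
          unfolding fluctuation_def by (intro sum_nonneg) auto
        moreover have "a \<in> ?g" unfolding grid_def by (intro image_eqI[of _ _ 0]) auto
        ultimately have "0 \<le> ?s * total_bound T k * real N" using elim(1)[unfolded small_windows_def] by (meson order_trans)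
        then show "0 \<le> total_bound T k * real N"
          using scale(1)[of k] by (simp add: mult.assoc zero_le_mult_iff)
      qed
      also have "\<dots> = (?c * total_bound T k) * (\<kappa> * \<eta> * real N)" using \<kappa>(1) \<eta>(1) by simp
      also have "\<dots> < \<epsilon> * (\<kappa> * \<eta> * real N)" using k \<kappa>(1) \<eta>(1) N by (intro mult_strict_right_mono) auto
      also have "\<dots> \<le> \<epsilon> * real (card (?L N))" using cL \<epsilon> by (intro mult_left_mono) auto
      finally have lt: "(\<Sum>\<alpha>\<in>?L N. ?d N \<alpha> \<alpha>) < \<epsilon> * real (card (?L N))" .
      have "0 < real (card (?L N))" using cL mult_pos_pos[OF mult_pos_pos[OF \<kappa>(1) \<eta>(1)] N] by linarith
      then show ?case using lt by (simp add: sum_nonneg pos_divide_less_eq)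
    qed
  qed
qed

text \<open>A window of arbitrary small size \<open>\<eta>\<close> is contained in a grid window at a comparable scale, and contains a window of
  half its size around a point of a finer grid; the latter bounds the number of its eigenvalues below,
  uniformly in the energy.\<close>

lemma mixing_from_windows:
  assumes ab: "a < b" "{a..b} \<subseteq> I\<^sub>0"
    and W: "\<And>k. \<forall>\<^sub>F N in along \<N>. small_windows T a b k N (K N)"
  shows "quantum_mixing \<N> \<rho> ev \<phi> T K {a..b}"
  unfolding quantum_mixing_def
proof (rule ennreal_tendsto_0I)
  fix e :: real assume e: "0 < e"
  obtain \<kappa> where \<kappa>: "0 < \<kappa>" "\<And>E \<eta>. E \<in> I\<^sub>0 \<Longrightarrow> 0 < \<eta> \<Longrightarrow> \<eta> < \<eta>\<^sub>0 \<Longrightarrow>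
      \<forall>\<^sub>F N in along \<N>. \<kappa> * \<eta> * real N \<le> real (card (window N E \<eta>))"
    by (rule count_lower) blast
  have "(\<lambda>k. 8 / \<kappa> * total_bound T k) \<longlonglongrightarrow> 8 / \<kappa> * 0" by (intro tendsto_intros total_bound_limit)
  then have "\<forall>\<^sub>F k in sequentially. 8 / \<kappa> * total_bound T k < e"
    by (rule order_tendstoD(2)) (use e in simp)
  then obtain k0 where k0: "\<And>k. k0 \<le> k \<Longrightarrow> 8 / \<kappa> * total_bound T k < e"
    unfolding eventually_sequentially by blast
  let ?I = "interior {a..b}"
  let ?Q = "\<lambda>\<eta>. Limsup (along \<N>) (\<lambda>N. SUP (E\<^sub>1, E\<^sub>2)\<in>?I \<times> ?I.
      ennreal (mixing_average \<rho> ev \<phi> T K N {E\<^sub>1 - \<eta>..E\<^sub>1 + \<eta>} {E\<^sub>2 - \<eta>..E\<^sub>2 + \<eta>})) \<le> ennreal e"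
  have "?Q \<eta>" if \<eta>: "0 < \<eta>" "\<eta> < \<eta>\<^sub>0 / 2 ^ (k0 + 2)" for \<eta>
  proof -
    obtain j where j: "(1 / 2 :: real) ^ j < \<eta> / \<eta>\<^sub>0"
      using real_arch_pow_inv[of "\<eta> / \<eta>\<^sub>0" "1 / 2"] \<eta> \<eta>0 by auto
    have "\<eta>\<^sub>0 / 2 ^ (j + 3) < \<eta>"
    proof -
      have "\<eta>\<^sub>0 / 2 ^ (j + 3) \<le> \<eta>\<^sub>0 / 2 ^ j" using \<eta>0 by (intro divide_left_mono) (auto intro: power_increasing)
      also have "\<dots> < \<eta>" using j \<eta>0 by (simp add: field_simps power_divide)
      finally show ?thesis .
    qed
    \<comment> \<open>The scale for which \<open>\<eta>\<close> lies between a quarter and a half of \<open>scale k\<close>.\<close>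
    define k where "k = (LEAST k. \<eta>\<^sub>0 / 2 ^ (k + 3) < \<eta>)"
    have k1: "\<eta>\<^sub>0 / 2 ^ (k + 3) < \<eta>" unfolding k_def by (rule LeastI) fact
    have k2: "\<eta> \<le> \<eta>\<^sub>0 / 2 ^ (k + 2)"
    proof (cases k)
      case 0
      have "\<eta>\<^sub>0 / 2 ^ (k0 + 2) \<le> \<eta>\<^sub>0 / 2 ^ (0 + 2)" using \<eta>0 by (intro divide_left_mono power_increasing) auto
      then show ?thesis using \<eta>(2) unfolding 0 by linarith
    next
      case (Suc l)
      have "\<not> \<eta>\<^sub>0 / 2 ^ (l + 3) < \<eta>" using not_less_Least[of l "\<lambda>k. \<eta>\<^sub>0 / 2 ^ (k + 3) < \<eta>"] Suc k_def by simp
      then show ?thesis using Suc by (simp add: numeral_eq_Suc)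
    qed
    have k3: "k0 \<le> k"
    proof (rule ccontr)
      assume "\<not> k0 \<le> k"
      then have "\<eta>\<^sub>0 / 2 ^ (k0 + 2) \<le> \<eta>\<^sub>0 / 2 ^ (k + 3)" using \<eta>0 by (intro divide_left_mono power_increasing) auto
      then show False using k1 \<eta>(2) by linarith
    qed
    let ?s = "scale k"
    have s: "\<eta> \<le> ?s / 2" "?s < 4 * \<eta>" using k1 k2 by (simp_all add: scale_def numeral_eq_Suc)
    have \<eta>lt: "\<eta> / 2 < \<eta>\<^sub>0" using s(1) scale[of k] \<eta>(1) by linarith
    have h: "0 < ?s / 2" "0 < \<eta> / 2" using scale(1)[of k] \<eta>(1) by simp_all
    note g = grid[OF h(1) less_imp_le[OF ab(1)]] and g' = grid[OF h(2) less_imp_le[OF ab(1)]]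
    have "\<forall>\<^sub>F N in along \<N>. \<forall>E\<in>grid a b (\<eta> / 2). \<kappa> * (\<eta> / 2) * real N \<le> real (card (window N E (\<eta> / 2)))"
      by (rule eventually_ball_finite[OF g'(1)]) (use \<kappa>(2) g'(2) ab(2) h(2) \<eta>lt in blast)
    with W[of k] eventually_pos
    have "\<forall>\<^sub>F N in along \<N>. (SUP (E\<^sub>1, E\<^sub>2)\<in>?I \<times> ?I.
      ennreal (mixing_average \<rho> ev \<phi> T K N {E\<^sub>1 - \<eta>..E\<^sub>1 + \<eta>} {E\<^sub>2 - \<eta>..E\<^sub>2 + \<eta>})) \<le> ennreal e"
    proof eventually_elim
      case (elim N)
      then have N: "0 < real N" by simp
      show ?case
      proof (rule SUP_least, clarify)
        fix E\<^sub>1 E\<^sub>2 assume "E\<^sub>1 \<in> ?I" "E\<^sub>2 \<in> ?I"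
        then have E: "E\<^sub>1 \<in> {a..b}" "E\<^sub>2 \<in> {a..b}" using interior_subset by blast+
        obtain e\<^sub>1 e\<^sub>2 e\<^sub>3 where e: "e\<^sub>1 \<in> grid a b (?s / 2)" "\<bar>E\<^sub>1 - e\<^sub>1\<bar> \<le> ?s / 2"
          "e\<^sub>2 \<in> grid a b (?s / 2)" "\<bar>E\<^sub>2 - e\<^sub>2\<bar> \<le> ?s / 2" "e\<^sub>3 \<in> grid a b (\<eta> / 2)" "\<bar>E\<^sub>1 - e\<^sub>3\<bar> \<le> \<eta> / 2"
          using g(4)[OF E(1)] g(4)[OF E(2)] g'(4)[OF E(1)] by blast
        let ?n = "real (card (window N E\<^sub>1 \<eta>))" and ?f = "fluctuation T N (K N) (window N E\<^sub>1 \<eta>) (window N E\<^sub>2 \<eta>)"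
        have "window N e\<^sub>3 (\<eta> / 2) \<subseteq> window N E\<^sub>1 \<eta>" using e(6) by (intro window_mono) linarith
        then have "card (window N e\<^sub>3 (\<eta> / 2)) \<le> card (window N E\<^sub>1 \<eta>)" by (intro card_mono) auto
        moreover have "\<kappa> * (\<eta> / 2) * real N \<le> real (card (window N e\<^sub>3 (\<eta> / 2)))" using elim(3) e(5) by blast
        ultimately have n: "\<kappa> * (\<eta> / 2) * real N \<le> ?n" by linarith
        have pos: "0 < \<kappa> * (\<eta> / 2) * real N" using \<kappa>(1) \<eta>(1) N by simp
        have f0: "0 \<le> ?f" unfolding fluctuation_def by (intro sum_nonneg) auto
        have fle: "?f \<le> ?s * total_bound T k * real N"
        proof -
          have "?f \<le> fluctuation T N (K N) (window N e\<^sub>1 ?s) (window N e\<^sub>2 ?s)"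
            by (intro fluctuation_mono window_mono window_finite) (use e s(1) in linarith)+
          also have "\<dots> \<le> ?s * total_bound T k * real N" using elim(1)[unfolded small_windows_def] e by blast
          finally show ?thesis .
        qed
        have tb: "0 \<le> total_bound T k"
          using order_trans[OF f0 fle] scale(1)[of k] N by (simp add: zero_le_mult_iff)
        have "?f \<le> (4 * \<eta>) * total_bound T k * real N"
          using fle s(2) tb N by (meson less_imp_le mult_right_mono order_trans)
        also have "\<dots> = (8 / \<kappa> * total_bound T k) * (\<kappa> * (\<eta> / 2) * real N)" using \<kappa>(1) by simp
        also have "\<dots> \<le> e * (\<kappa> * (\<eta> / 2) * real N)" using k0[OF k3] pos by (intro mult_right_mono) auto
        also have "\<dots> \<le> e * ?n" using n e(1) \<open>0 < e\<close> by (intro mult_left_mono) auto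
        finally have "1 / ?n * ?f \<le> e" using n pos by (simp add: pos_divide_le_eq)
        then show "ennreal (mixing_average \<rho> ev \<phi> T K N {E\<^sub>1 - \<eta>..E\<^sub>1 + \<eta>} {E\<^sub>2 - \<eta>..E\<^sub>2 + \<eta>}) \<le> ennreal e"
          by (intro ennreal_leI) (simp add: mixing_average_def fluctuation_def window_def)
      qed
    qed
    then show "?Q \<eta>" by (rule Limsup_bounded)
  qed
  moreover have "0 < \<eta>\<^sub>0 / 2 ^ (k0 + 2)" using \<eta>0 by simp
  ultimately show "eventually ?Q (at_right 0)"
    unfolding eventually_at_right_field by blast
qed

theorem ergodicity_and_mixing:
  assumes T: "finite T" "T \<subseteq> carrier G" and ab: "a < b" "{a..b} \<subseteq> I\<^sub>0"
  shows "\<exists>H :: nat \<Rightarrow> (nat \<Rightarrow> complex) set.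
           (\<forall>N\<in>\<N>. cseq.subspace (H N) \<and> H N \<subseteq> cvec N) \<and>
           (\<lambda>N. real (cseq.dim (H N))) \<in> o[along \<N>](\<lambda>N. real N) \<and>
           (\<forall>K :: nat \<Rightarrow> cmatrix.
              (\<forall>N\<in>\<N>. is_local (\<rho> N) T N (K N) \<and> norm_1_inf N (K N) \<le> 1 \<and>
                 (\<forall>t\<in>T. local_vector (\<rho> N) t N (K N) \<in> orth_compl N (H N)))
              \<longrightarrow> quantum_ergodicity \<N> \<rho> ev \<phi> T K {a..b} \<and>
                  quantum_mixing \<N> \<rho> ev \<phi> T K {a..b})"
proof -
  obtain D :: "nat \<Rightarrow> (nat \<Rightarrow> complex) set" where
    D: "\<And>N. finite (D N)" "\<And>N. D N \<subseteq> cvec N" "negligible (\<lambda>N. real (card (D N)))"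
    and Dk: "\<And>k. \<forall>\<^sub>F N in along \<N>. controls T a b k N (D N)"
    by (rule exceptional_sets[OF T less_imp_le[OF ab(1)] ab(2)]) blast
  \<comment> \<open>Orthogonality to the constants makes the average of the observable vanish.\<close>
  define one :: "nat \<Rightarrow> nat \<Rightarrow> complex" where "one N = (\<lambda>x. if x \<in> {1..N} then 1 else 0)" for N
  define D' where "D' N = insert (one N) (D N)" for N
  have "one N \<in> cvec N" for N by (simp add: one_def ell2_finite(1))
  then have D': "finite (D' N)" "D' N \<subseteq> cvec N" for N using D by (auto simp: D'_def)
  have "((\<lambda>N. 1 / real N) \<longlongrightarrow> 0) (along \<N>)"
    by (rule tendsto_mono[OF _ lim_1_over_n]) (simp add: along_def)
  then have "negligible (\<lambda>N. real (card (D N)) + 1)"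
    by (intro negligible_add D(3)) (simp add: negligible_def)
  then have neg: "negligible (\<lambda>N. real (card (D' N)))"
    by (rule negligible_mono) (use D(1) in \<open>auto simp: D'_def card_insert_if\<close>)
  define H where "H N = cseq.span (D' N)" for N
  show ?thesis
  proof (intro exI[of _ H] conjI allI impI ballI)
    fix N
    show "cseq.subspace (H N)" by (simp add: H_def cseq.subspace_span)
    have "cseq.subspace (cvec N)" by (rule cseq.subspaceI) (auto simp: ell2_finite(1))
    then show "H N \<subseteq> cvec N" unfolding H_def by (rule cseq.span_minimal[OF D'(2)])
  next
    show "(\<lambda>N. real (cseq.dim (H N))) \<in> o[along \<N>](\<lambda>N. real N)"
      unfolding H_def by (rule negligible_dim[OF D'(1) neg[unfolded negligible_def] zero])
  next
    fix K :: "nat \<Rightarrow> cmatrix"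
    assume K: "\<forall>N\<in>\<N>. is_local (\<rho> N) T N (K N) \<and> norm_1_inf N (K N) \<le> 1 \<and>
                 (\<forall>t\<in>T. local_vector (\<rho> N) t N (K N) \<in> orth_compl N (H N))"
    have perp: "ell2_inner {1..N} d (local_vector (\<rho> N) t N (K N)) = 0"
      if "N \<in> \<N>" "t \<in> T" "d \<in> insert (\<lambda>x. if x \<in> {1..N} then 1 else 0) (D N)" for N t d
    proof -
      have "d \<in> H N" using that(3) unfolding H_def D'_def one_def by (rule cseq.span_base)
      then show ?thesis using K that(1,2) unfolding orth_compl_def by blast
    qed
    have W: "\<forall>\<^sub>F N in along \<N>. small_windows T a b k N (K N)" for k
      by (rule fluctuation_window[OF T Dk _ _ perp]) (use K in auto)
    show "quantum_ergodicity \<N> \<rho> ev \<phi> T K {a..b}" by (rule ergodicity_from_windows[OF ab W])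
    show "quantum_mixing \<N> \<rho> ev \<phi> T K {a..b}" by (rule mixing_from_windows[OF ab W])
  qed
qed

end

theorem theorem1p5:
  fixes G :: "('a, 'b) monoid_scheme"
    and S T :: "'a set"
    and C\<^sub>1 a\<^sub>0 b\<^sub>0 a b :: real
    and p :: "'a \<Rightarrow> complex"
    and \<N> :: "nat set"
    and \<rho> :: "nat \<Rightarrow> 'a \<Rightarrow> nat \<Rightarrow> nat"
    and ev :: "nat \<Rightarrow> nat \<Rightarrow> real"
    and \<phi> :: "nat \<Rightarrow> nat \<Rightarrow> nat \<Rightarrow> complex"
  assumes "group G"
    and "finite_generating_set G S"
    and "rapid_decay G C\<^sub>1"
    and "infinite \<N>" and "0 \<notin> \<N>"
    and "\<forall>N\<in>\<N>. \<rho> N \<in> hom G (sym_group N)"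
    and "converges_to_regular G \<N> \<rho>"
    and "p \<in> group_algebra G" and "p = ga_star G p"
    and "cond_AC G p {a\<^sub>0..b\<^sub>0}"
    and "cond_R4 G S C\<^sub>1 p {a\<^sub>0..b\<^sub>0}"
    and "a < b" and "{a..b} \<subseteq> interior {a\<^sub>0..b\<^sub>0}"
    and "\<forall>N\<in>\<N>. orthonormal_eigenbasis N (rep_matrix (\<rho> N) p) (ev N) (\<phi> N)"
    and "finite T" and "T \<subseteq> carrier G"
  shows "\<exists>H :: nat \<Rightarrow> (nat \<Rightarrow> complex) set.
           (\<forall>N\<in>\<N>. cseq.subspace (H N) \<and> H N \<subseteq> cvec N) \<and>
           (\<lambda>N. real (cseq.dim (H N))) \<in> o[along \<N>](\<lambda>N. real N) \<and>
           (\<forall>K :: nat \<Rightarrow> cmatrix.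
              (\<forall>N\<in>\<N>. is_local (\<rho> N) T N (K N) \<and> norm_1_inf N (K N) \<le> 1 \<and>
                 (\<forall>t\<in>T. local_vector (\<rho> N) t N (K N) \<in> orth_compl N (H N)))
              \<longrightarrow> quantum_ergodicity \<N> \<rho> ev \<phi> T K {a..b} \<and>
                  quantum_mixing \<N> \<rho> ev \<phi> T K {a..b})"
proof -
  interpret finitely_generated G S
    using assms(1,2) by (simp add: finitely_generated_def finitely_generated_axioms_def)
  let ?I = "{a\<^sub>0..b\<^sub>0}"
  let ?im = "\<lambda>E \<eta> g. cmod (ImR G p (Complex E \<eta>) \<one>\<^bsub>G\<^esub> g)"
  obtain C\<^sub>0 where C0: "1 \<le> C\<^sub>0"
    and AC: "\<And>E \<eta>. E \<in> ?I \<Longrightarrow> 0 < \<eta> \<Longrightarrow> \<eta> \<le> 1 \<Longrightarrow>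
      1 / C\<^sub>0 \<le> Re (ImR G p (Complex E \<eta>) \<one>\<^bsub>G\<^esub> \<one>\<^bsub>G\<^esub>) \<and> Re (ImR G p (Complex E \<eta>) \<one>\<^bsub>G\<^esub> \<one>\<^bsub>G\<^esub>) \<le> C\<^sub>0"
    using assms(10) unfolding cond_AC_def by blast
  define d where "d c \<eta> = (SUP E\<in>?I. \<Sum>\<^sub>\<infinity>g\<in>carrier G. ennreal (\<eta>\<^sup>2 * ?im E \<eta> g ^ 4 * real (wl g) powr c))" for c \<eta>
  obtain c where c: "2 * C\<^sub>1 + 1 < c" and d: "(d c \<longlongrightarrow> 0) (at_right 0)"
    using assms(11) unfolding cond_R4_def d_def by blast
  have "0 < C\<^sub>1" using assms(3) unfolding rapid_decay_def by blast
  with c have c0: "0 < c" by linarith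
  obtain C\<^sub>2 where C2: "0 < C\<^sub>2"
    and RD: "\<And>A f. A \<in> group_algebra G \<Longrightarrow> f \<in> ell2 (carrier G) \<Longrightarrow>
      ell2_norm (carrier G) (left_regular G A f)
        \<le> C\<^sub>2 * sqrt (\<Sum>g\<in>supp A. (1 + real (wl g)) powr c * (cmod (A g))\<^sup>2) * ell2_norm (carrier G) f"
    by (rule rapid_decay_weighted[OF assms(3) c]) blast
  define \<delta> where "\<delta> \<eta> = enn2real (d c \<eta>)" for \<eta>
  have \<delta>: "(\<delta> \<longlongrightarrow> 0) (at_right 0)"
    unfolding \<delta>_def using tendsto_enn2real[of "d c" 0 "at_right 0"] d by simp
  \<comment> \<open>The supremum may be infinite for large \<open>\<eta>\<close>, so real bounds exist only below a threshold.\<close>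
  have "\<forall>\<^sub>F \<eta> in at_right 0. d c \<eta> < top_class.top" by (rule order_tendstoD(2)[OF d]) simp
  then obtain h where h: "0 < h" "\<And>\<eta>. 0 < \<eta> \<Longrightarrow> \<eta> < h \<Longrightarrow> d c \<eta> < top_class.top"
    unfolding eventually_at_right_field by blast
  define \<eta>\<^sub>0 where "\<eta>\<^sub>0 = min h 1"
  have R4: "(\<Sum>g\<in>F. \<eta>\<^sup>2 * ?im E \<eta> g ^ 4 * real (wl g) powr c) \<le> \<delta> \<eta>"
    if "E \<in> ?I" "0 < \<eta>" "\<eta> < \<eta>\<^sub>0" "finite F" "F \<subseteq> carrier G" for E \<eta> F
  proof -
    let ?t = "\<lambda>g. \<eta>\<^sup>2 * ?im E \<eta> g ^ 4 * real (wl g) powr c"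
    have fin: "d c \<eta> < top_class.top" using h(2)[of \<eta>] that by (simp add: \<eta>\<^sub>0_def)
    have "ennreal (\<Sum>g\<in>F. ?t g) = (\<Sum>g\<in>F. ennreal (?t g))" by (rule sum_ennreal[symmetric]) simp
    also have "\<dots> \<le> (\<Sum>\<^sub>\<infinity>g\<in>carrier G. ennreal (?t g))"
      unfolding infsum_finite[OF that(4), symmetric]
      by (rule infsum_mono_neutral) (use that(5) in \<open>auto intro!: nonneg_summable_on_complete\<close>)
    also have "\<dots> \<le> d c \<eta>" unfolding d_def by (rule SUP_upper[OF that(1)])
    also have "\<dots> = ennreal (\<delta> \<eta>)" using fin by (simp add: \<delta>_def)
    finally show ?thesis by (simp add: \<delta>_def)
  qed
  have \<eta>0: "0 < \<eta>\<^sub>0" "\<eta>\<^sub>0 \<le> 1" using h(1) by (auto simp: \<eta>\<^sub>0_def)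
  have "quantum_setting G \<N> \<rho> p ev \<phi> S ?I C\<^sub>0 c C\<^sub>2 \<eta>\<^sub>0 \<delta>"
    using assms C0 AC c0 C2 RD \<delta> R4 \<eta>0
    by (intro quantum_setting.intro fg_eigen_sequence.intro eigen_sequence.intro permutation_sequence.intro
        permutation_sequence_axioms.intro eigen_sequence_axioms.intro quantum_setting_axioms.intro
        finitely_generated_axioms) auto
  then interpret quantum_setting G \<N> \<rho> p ev \<phi> S ?I C\<^sub>0 c C\<^sub>2 \<eta>\<^sub>0 \<delta> .
  have "{a..b} \<subseteq> ?I" using assms(13) interior_subset by blast
  then show ?thesis by (intro ergodicity_and_mixing assms)
qed

end
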